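(* Let $X$ be a projective variety of degree $D$ defined over a number field $K$ equipped with a line bundle $L$ giving an embedding $X \hookrightarrow \mathbb{P}^N$. Let $f:X \to X$ be a morphism such that $f^{\ast}L \cong L^{\otimes d}$, $d \geq 2$. Let $\mathfrak{p}$ be a prime of $K$, lying over the rational prime $p$, with residue field $k$, for which $f$ has good reduction. Let $P\in X(K)$ be a periodic point of primitive period $n$ for $f$. Then $$ n \leq \#X(k) \cdot \#\mathrm{GL}_{M+1}(k) \cdot p^e \leq \#\mathbb{P}^N(k) \cdot \#\mathrm{GL}_{M+1}(k) \cdot p^e,$$ where $M = \binom{N+D}{N}-1$ and $e\ge 0$ is an integer satisfying $$ e \leq \begin{cases} 1 + \log_2(v(p)) & p \neq 2,\\ 1 + \log_{\alpha}\left(\dfrac{\sqrt{5}\,v(2) + \sqrt{5(v(2))^2 + 4}}{2}\right) & p=2, \end{cases} \qquad \alpha = \frac{1+\sqrt{5}}{2}.$$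
   Context: The variety $X$ is allowed to be singular. The degree $D$ is the degree of $X$ in $\mathbb{P}^N$, and $L$ is the pullback of $\mathcal{O}(1)$ under the embedding. The morphism $f$ has good reduction at $\mathfrak{p}$ if $f$ extends to a morphism of the closure of $X$ in $\mathbb{P}^N$ over the local ring of $\mathfrak{p}$, so that it induces a morphism on the reduction of $X$ modulo $\mathfrak{p}$; $X(k)$ denotes the set of $k$-points of this reduction. $v$ is the normalized $\mathfrak{p}$-adic valuation on $K$ (value group $\mathbb{Z}$). The primitive period of $P$ is the least $n\ge1$ with $f^n(P)=P$. *)

theory Defs
  imports
    Complex_Main
    "HOL-Library.Poly_Mapping"
    "HOL-Computational_Algebra.Computational_Algebra"
    "HOL-Algebra.Ideal_Product"
    "Jordan_Normal_Form.Matrix"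
begin

section \<open>Polynomials in \<open>x\<^sub>0, x\<^sub>1, \<dots>\<close>\<close>

text \<open>Exponent vectors are finitely supported functions, and the product of the ring
  \<open>'a mpoly\<close> is the convolution product of finitely supported functions.\<close>

type_synonym 'a mpoly = "(nat \<Rightarrow>\<^sub>0 nat) \<Rightarrow>\<^sub>0 'a"

definition mconst :: "'a::zero \<Rightarrow> 'a mpoly" where
  "mconst c = Poly_Mapping.single 0 c"

definition mvar :: "nat \<Rightarrow> 'a::zero_neq_one mpoly" where
  "mvar i = Poly_Mapping.single (Poly_Mapping.single i 1) 1"

text \<open>\<open>mpolys A N\<close> is \<open>A[x\<^sub>0, \<dots>, x\<^sub>N]\<close> for a subring \<open>A\<close> of \<open>'a\<close>.\<close>

definition mpolys :: "'a::zero set \<Rightarrow> nat \<Rightarrow> 'a mpoly set" where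
  "mpolys A N = {F. (\<forall>m. Poly_Mapping.lookup F m \<in> A) \<and>
                    (\<forall>m\<in>Poly_Mapping.keys F. Poly_Mapping.keys m \<subseteq> {..N})}"

text \<open>The zero polynomial is homogeneous of every degree.\<close>

definition homogeneous :: "nat \<Rightarrow> 'a::zero mpoly \<Rightarrow> bool" where
  "homogeneous e F \<longleftrightarrow>
     (\<forall>m\<in>Poly_Mapping.keys F. (\<Sum>i\<in>Poly_Mapping.keys m. Poly_Mapping.lookup m i) = e)"

text \<open>Value at \<open>b\<close> of the polynomial obtained from \<open>F\<close> by applying \<open>h\<close> to the coefficients.\<close>

definition mpeval :: "('a::zero \<Rightarrow> 'b::comm_semiring_1) \<Rightarrow> (nat \<Rightarrow> 'b) \<Rightarrow> 'a mpoly \<Rightarrow> 'b" where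
  "mpeval h b F = (\<Sum>m\<in>Poly_Mapping.keys F. h (Poly_Mapping.lookup F m) *
                     (\<Prod>i\<in>Poly_Mapping.keys m. b i ^ Poly_Mapping.lookup m i))"

abbreviation mpsubst :: "(nat \<Rightarrow> 'a mpoly) \<Rightarrow> 'a mpoly \<Rightarrow> 'a::comm_semiring_1 mpoly" where
  "mpsubst \<equiv> mpeval mconst"

text \<open>A subset of a type-class ring, as a ring in the sense of HOL-Algebra.\<close>

definition ring_on :: "'a::comm_ring_1 set \<Rightarrow> 'a ring" where
  "ring_on A = \<lparr>carrier = A, monoid.mult = (*), one = 1, zero = 0, add = (+)\<rparr>"


section \<open>Number fields and their primes\<close>

definition number_field :: "'a::field_char_0 itself \<Rightarrow> bool" where
  "number_field _ \<longleftrightarrow> (\<exists>B::'a set. finite B \<and> module.span (\<lambda>q x. of_rat q * x) B = UNIV)"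

definition ring_of_integers :: "'a::field_char_0 set" where
  "ring_of_integers = {x. algebraic_int x}"

definition is_prime_of :: "'a::field_char_0 set \<Rightarrow> bool" where
  "is_prime_of \<pp> \<longleftrightarrow> primeideal \<pp> (ring_on ring_of_integers) \<and> \<pp> \<noteq> {0}"

text \<open>The localisation of the ring of integers at \<open>\<pp>\<close>, and its maximal ideal.\<close>

definition local_ring :: "'a::field_char_0 set \<Rightarrow> 'a set" where
  "local_ring \<pp> = {a / b | a b. a \<in> ring_of_integers \<and> b \<in> ring_of_integers - \<pp>}"

definition local_max_ideal :: "'a::field_char_0 set \<Rightarrow> 'a set" where
  "local_max_ideal \<pp> = {a / b | a b. a \<in> \<pp> \<and> b \<in> ring_of_integers - \<pp>}"

text \<open>The field \<open>'k\<close> is the residue field of \<open>\<pp>\<close>, with reduction map \<open>red\<close> from the local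
  ring (the values of \<open>red\<close> outside the local ring are irrelevant).\<close>

definition residue_field_map :: "'a::field_char_0 set \<Rightarrow> ('a \<Rightarrow> 'k::field) \<Rightarrow> bool" where
  "residue_field_map \<pp> red \<longleftrightarrow>
     red \<in> Ring.ring_hom (ring_on (local_ring \<pp>)) (ring_on UNIV) \<and>
     red ` local_ring \<pp> = UNIV \<and>
     {x \<in> local_ring \<pp>. red x = 0} = local_max_ideal \<pp>"

text \<open>The normalised \<open>\<pp>\<close>-adic valuation, at nonzero elements of the ring of integers: the
  exponent of the largest power of \<open>\<pp>\<close> containing the element.\<close>

definition prime_valuation :: "'a::field_char_0 set \<Rightarrow> 'a \<Rightarrow> nat" where
  "prime_valuation \<pp> x =
     (GREATEST n::nat. x \<in> \<pp> [^]\<^bsub>ideals_set (ring_on ring_of_integers)\<^esub> n)"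


section \<open>Integral closed subschemes of projective space\<close>

text \<open>\<open>proj_point A N Q\<close>: \<open>Q\<close> is a point of the scheme \<open>Proj A[x\<^sub>0, \<dots>, x\<^sub>N]\<close>, that is, a
  homogeneous prime ideal not containing the irrelevant ideal.\<close>

abbreviation mpoly_ring :: "'a::comm_ring_1 set \<Rightarrow> nat \<Rightarrow> 'a mpoly ring" where
  "mpoly_ring A N \<equiv> ring_on (mpolys A N)"

definition proj_point :: "'a::comm_ring_1 set \<Rightarrow> nat \<Rightarrow> 'a mpoly set \<Rightarrow> bool" where
  "proj_point A N Q \<longleftrightarrow>
     primeideal Q (mpoly_ring A N) \<and>
     Q = Idl\<^bsub>mpoly_ring A N\<^esub> {F \<in> Q. \<exists>e. homogeneous e F} \<and>
     (\<exists>i\<le>N. mvar i \<notin> Q)"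

text \<open>An integral closed subscheme of projective \<open>N\<close>-space over \<open>A\<close> is \<open>Proj A[x\<^sub>0, \<dots>, x\<^sub>N]/I\<close>
  for a unique such prime \<open>I\<close>, its generic point; its points are the homogeneous primes
  containing \<open>I\<close>. For \<open>A = UNIV\<close>, the field \<open>'a\<close>, these are the projective varieties embedded in
  projective \<open>N\<close>-space over \<open>'a\<close>.\<close>

abbreviation proj_variety :: "nat \<Rightarrow> 'a::field mpoly set \<Rightarrow> bool" where
  "proj_variety N I \<equiv> proj_point UNIV N I"

definition scheme_points :: "'a::comm_ring_1 set \<Rightarrow> nat \<Rightarrow> 'a mpoly set \<Rightarrow> 'a mpoly set set" where
  "scheme_points A N I = {Q. proj_point A N Q \<and> I \<subseteq> Q}"

text \<open>The ideal of the Zariski closure, in projective \<open>N\<close>-space over a subring \<open>A\<close> of the field,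
  of the variety with ideal \<open>I\<close>.\<close>

definition closure_ideal :: "'a::zero set \<Rightarrow> nat \<Rightarrow> 'a mpoly set \<Rightarrow> 'a mpoly set" where
  "closure_ideal A N I = I \<inter> mpolys A N"

definition hilbert_function :: "nat \<Rightarrow> 'a::field mpoly set \<Rightarrow> nat \<Rightarrow> int" where
  "hilbert_function N I t =
     int (vector_space.dim (\<lambda>(c::'a) F. mconst c * F) {F \<in> mpolys UNIV N. homogeneous t F}) -
     int (vector_space.dim (\<lambda>(c::'a) F. mconst c * F) {F \<in> I. homogeneous t F})"

text \<open>The degree is \<open>r!\<close> times the leading coefficient of the Hilbert polynomial, whose degree
  \<open>r\<close> is the dimension of the variety.\<close>

definition has_degree :: "nat \<Rightarrow> 'a::field mpoly set \<Rightarrow> nat \<Rightarrow> bool" where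
  "has_degree N I D \<longleftrightarrow>
     (\<exists>h::rat poly. (\<forall>\<^sub>F t in sequentially. poly h (of_nat t) = of_int (hilbert_function N I t)) \<and>
                    of_nat D = fact (degree h) * lead_coeff h)"


section \<open>Rational points\<close>

definition proj_class :: "(nat \<Rightarrow> 'b::field) \<Rightarrow> (nat \<Rightarrow> 'b) set" where
  "proj_class a = {\<lambda>i. c * a i | c. c \<noteq> 0}"

definition proj_space :: "nat \<Rightarrow> (nat \<Rightarrow> 'b::field) set set" where
  "proj_space N = {proj_class a | a. (\<exists>i\<le>N. a i \<noteq> 0) \<and> (\<forall>i>N. a i = 0)}"

text \<open>The points of projective space over \<open>'b\<close> at which all polynomials in \<open>J\<close> vanish after \<open>h\<close>
  is applied to the coefficients. With \<open>h = id\<close> these are the rational points of the variety with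
  ideal \<open>J\<close>; with \<open>h\<close> the reduction map and \<open>J\<close> the ideal of the closure over the local ring they
  are the points of the reduction over the residue field.\<close>

definition zero_points :: "('a::zero \<Rightarrow> 'b::field) \<Rightarrow> nat \<Rightarrow> 'a mpoly set \<Rightarrow> (nat \<Rightarrow> 'b) set set" where
  "zero_points h N J = {P \<in> proj_space N. \<forall>F\<in>J. \<forall>a\<in>P. mpeval h a F = 0}"


section \<open>Morphisms\<close>

text \<open>A rational map from \<open>Proj A[x\<^sub>0, \<dots>, x\<^sub>N]/I\<close> to projective \<open>N\<close>-space over \<open>A\<close> is given by
  homogeneous polynomials \<open>\<phi>\<^sub>0, \<dots>, \<phi>\<^sub>N\<close> over \<open>A\<close> of the same degree, not all in \<open>I\<close>; tuples that
  are proportional modulo \<open>I\<close> give the same rational map. It is regular at a point \<open>Q\<close> if it is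
  given by some tuple whose members are not all in \<open>Q\<close>. Morphisms are the rational maps that are
  regular at every point. A self-map moreover has \<open>G(\<phi>\<^sub>0, \<dots>, \<phi>\<^sub>N)\<close> in \<open>I\<close> for every \<open>G\<close> in \<open>I\<close>.\<close>

definition homogeneous_tuple :: "'a::comm_ring_1 set \<Rightarrow> nat \<Rightarrow> (nat \<Rightarrow> 'a mpoly) \<Rightarrow> bool" where
  "homogeneous_tuple A N \<phi> \<longleftrightarrow> (\<exists>e. \<forall>i\<le>N. \<phi> i \<in> mpolys A N \<and> homogeneous e (\<phi> i))"

definition same_rational_map ::
    "nat \<Rightarrow> 'a::comm_ring_1 mpoly set \<Rightarrow> (nat \<Rightarrow> 'a mpoly) \<Rightarrow> (nat \<Rightarrow> 'a mpoly) \<Rightarrow> bool" where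
  "same_rational_map N I \<phi> \<psi> \<longleftrightarrow> (\<forall>i\<le>N. \<forall>j\<le>N. \<phi> i * \<psi> j - \<phi> j * \<psi> i \<in> I)"

definition local_reps ::
    "'a::comm_ring_1 set \<Rightarrow> nat \<Rightarrow> 'a mpoly set \<Rightarrow> (nat \<Rightarrow> 'a mpoly) \<Rightarrow> 'a mpoly set
       \<Rightarrow> (nat \<Rightarrow> 'a mpoly) set" where
  "local_reps A N I \<phi> Q =
     {\<psi>. homogeneous_tuple A N \<psi> \<and> same_rational_map N I \<phi> \<psi> \<and> (\<exists>i\<le>N. \<psi> i \<notin> Q)}"

definition self_morphism ::
    "'a::comm_ring_1 set \<Rightarrow> nat \<Rightarrow> 'a mpoly set \<Rightarrow> (nat \<Rightarrow> 'a mpoly) \<Rightarrow> bool" where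
  "self_morphism A N I \<phi> \<longleftrightarrow>
     homogeneous_tuple A N \<phi> \<and> (\<exists>i\<le>N. \<phi> i \<notin> I) \<and>
     (\<forall>G\<in>I. mpsubst \<phi> G \<in> I) \<and>
     (\<forall>Q\<in>scheme_points A N I. local_reps A N I \<phi> Q \<noteq> {})"

text \<open>The image of a rational point is computed by any tuple for the map whose members do not all
  vanish at the point.\<close>

definition morphism_apply ::
    "nat \<Rightarrow> 'a::field mpoly set \<Rightarrow> (nat \<Rightarrow> 'a mpoly) \<Rightarrow> (nat \<Rightarrow> 'a) set \<Rightarrow> (nat \<Rightarrow> 'a) set" where
  "morphism_apply N I \<phi> P =
     (THE R. \<exists>\<psi>. \<exists>a\<in>P. homogeneous_tuple UNIV N \<psi> \<and> same_rational_map N I \<phi> \<psi> \<and>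
        (\<exists>i\<le>N. mpeval id a (\<psi> i) \<noteq> 0) \<and>
        R = proj_class (\<lambda>i. if i \<le> N then mpeval id a (\<psi> i) else 0))"

definition primitive_period :: "('p \<Rightarrow> 'p) \<Rightarrow> 'p \<Rightarrow> nat \<Rightarrow> bool" where
  "primitive_period f P n \<longleftrightarrow>
     n \<ge> 1 \<and> (f ^^ n) P = P \<and> (\<forall>m. 1 \<le> m \<and> m < n \<longrightarrow> (f ^^ m) P \<noteq> P)"

text \<open>Good reduction: the morphism extends to the closure over the local ring. The closure has
  the same function field as the variety, so the extension is a tuple over the local ring that
  gives the same rational map and is regular at all points of the closure, including those
  of the special fibre.\<close>

definition good_reduction ::
    "nat \<Rightarrow> 'a::field_char_0 mpoly set \<Rightarrow> (nat \<Rightarrow> 'a mpoly) \<Rightarrow> 'a set \<Rightarrow> bool" where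
  "good_reduction N I \<phi> \<pp> \<longleftrightarrow>
     (\<exists>\<psi>. self_morphism (local_ring \<pp>) N (closure_ideal (local_ring \<pp>) N I) \<psi> \<and>
          same_rational_map N I \<phi> \<psi>)"


section \<open>The function field\<close>

text \<open>Elements of the function field of the variety with ideal \<open>I\<close> are classes of fractions \<open>F/G\<close>
  of homogeneous polynomials of the same degree with \<open>G\<close> not in \<open>I\<close>.\<close>

type_synonym 'a ratfun = "('a mpoly \<times> 'a mpoly) set"

definition fractions :: "nat \<Rightarrow> 'a::field mpoly set \<Rightarrow> ('a mpoly \<times> 'a mpoly) set" where
  "fractions N I = {(F, G). F \<in> mpolys UNIV N \<and> G \<in> mpolys UNIV N \<and> G \<notin> I \<and>
                            (\<exists>e. homogeneous e F \<and> homogeneous e G)}"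

definition ratfun :: "nat \<Rightarrow> 'a::field mpoly set \<Rightarrow> 'a mpoly \<Rightarrow> 'a mpoly \<Rightarrow> 'a ratfun" where
  "ratfun N I F G = {(F', G') \<in> fractions N I. F * G' - F' * G \<in> I}"

definition function_field :: "nat \<Rightarrow> 'a::field mpoly set \<Rightarrow> 'a ratfun set" where
  "function_field N I = {ratfun N I F G | F G. (F, G) \<in> fractions N I}"

definition ratfun_mult :: "nat \<Rightarrow> 'a::field mpoly set \<Rightarrow> 'a ratfun \<Rightarrow> 'a ratfun \<Rightarrow> 'a ratfun" where
  "ratfun_mult N I r s = (\<Union>(F, G)\<in>r. \<Union>(F', G')\<in>s. ratfun N I (F * F') (G * G'))"

definition ratfun_power :: "nat \<Rightarrow> 'a::field mpoly set \<Rightarrow> 'a ratfun \<Rightarrow> nat \<Rightarrow> 'a ratfun" where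
  "ratfun_power N I r d = (\<Union>(F, G)\<in>r. ratfun N I (F ^ d) (G ^ d))"

text \<open>\<open>r\<close> is a unit of the local ring of the variety at the point \<open>Q\<close>.\<close>

definition unit_at :: "'a::field ratfun \<Rightarrow> 'a mpoly set \<Rightarrow> bool" where
  "unit_at r Q \<longleftrightarrow> (\<exists>(F, G)\<in>r. F \<notin> Q \<and> G \<notin> Q)"

text \<open>The pullback of \<open>r\<close> along the morphism given by \<open>\<phi>\<close>, for \<open>r\<close> regular at the image of the
  generic point.\<close>

definition ratfun_pullback ::
    "nat \<Rightarrow> 'a::field mpoly set \<Rightarrow> (nat \<Rightarrow> 'a mpoly) \<Rightarrow> 'a ratfun \<Rightarrow> 'a ratfun" where
  "ratfun_pullback N I \<phi> r =
     (\<Union>(F, G)\<in>{(F, G) \<in> r. mpsubst \<phi> G \<notin> I}. ratfun N I (mpsubst \<phi> F) (mpsubst \<phi> G))"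


section \<open>Line bundles\<close>

text \<open>A line bundle is given by an open cover by nonempty sets \<open>U\<^sub>i\<close> over which it is trivial and by
  transition functions \<open>g\<^sub>i\<^sub>j\<close>, invertible on the intersection of \<open>U\<^sub>i\<close> and \<open>U\<^sub>j\<close>, with
  \<open>g\<^sub>i\<^sub>j g\<^sub>j\<^sub>k = g\<^sub>i\<^sub>k\<close>: the local expressions of a section \<open>s\<close> satisfy \<open>s\<^sub>i = g\<^sub>i\<^sub>j s\<^sub>j\<close>. As the variety
  is integral, nonempty open sets meet and functions on them are elements of the function field,
  so identities between functions are identities there.\<close>

record (overloaded) ('i, 'a) line_bundle =
  lb_index :: "'i set"
  lb_open :: "'i \<Rightarrow> 'a mpoly set set"
  lb_trans :: "'i \<Rightarrow> 'i \<Rightarrow> 'a ratfun"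

text \<open>The restriction of \<open>\<O>(1)\<close>: on the set where \<open>x\<^sub>i\<close> does not vanish, the section \<open>s\<close> has local
  expression \<open>s/x\<^sub>i\<close>.\<close>

definition hyperplane_bundle :: "nat \<Rightarrow> 'a::field mpoly set \<Rightarrow> (nat, 'a) line_bundle" where
  "hyperplane_bundle N I =
     \<lparr>lb_index = {i. i \<le> N \<and> mvar i \<notin> I},
      lb_open = (\<lambda>i. {Q \<in> scheme_points UNIV N I. mvar i \<notin> Q}),
      lb_trans = (\<lambda>i j. ratfun N I (mvar j) (mvar i))\<rparr>"

definition bundle_power ::
    "nat \<Rightarrow> 'a::field mpoly set \<Rightarrow> ('i, 'a) line_bundle \<Rightarrow> nat \<Rightarrow> ('i, 'a) line_bundle" where
  "bundle_power N I L d =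
     \<lparr>lb_index = lb_index L,
      lb_open = lb_open L,
      lb_trans = (\<lambda>i j. ratfun_power N I (lb_trans L i j) d)\<rparr>"

text \<open>The image of a point \<open>Q\<close> of the scheme under the morphism given by \<open>\<phi>\<close>: the homogeneous
  polynomials in it are those whose pullback vanishes at \<open>Q\<close>.\<close>

definition image_point ::
    "nat \<Rightarrow> 'a::field mpoly set \<Rightarrow> (nat \<Rightarrow> 'a mpoly) \<Rightarrow> 'a mpoly set \<Rightarrow> 'a mpoly set" where
  "image_point N I \<phi> Q =
     Idl\<^bsub>mpoly_ring UNIV N\<^esub>
       {H \<in> mpolys UNIV N. (\<exists>e. homogeneous e H) \<and>
                          (\<exists>\<psi>\<in>local_reps UNIV N I \<phi> Q. mpsubst \<psi> H \<in> Q)}"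

definition preimage_open ::
    "nat \<Rightarrow> 'a::field mpoly set \<Rightarrow> (nat \<Rightarrow> 'a mpoly) \<Rightarrow> 'a mpoly set set \<Rightarrow> 'a mpoly set set" where
  "preimage_open N I \<phi> U = {Q \<in> scheme_points UNIV N I. image_point N I \<phi> Q \<in> U}"

definition bundle_pullback ::
    "nat \<Rightarrow> 'a::field mpoly set \<Rightarrow> (nat \<Rightarrow> 'a mpoly) \<Rightarrow> ('i, 'a) line_bundle
       \<Rightarrow> ('i, 'a) line_bundle" where
  "bundle_pullback N I \<phi> L =
     \<lparr>lb_index = {i \<in> lb_index L. preimage_open N I \<phi> (lb_open L i) \<noteq> {}},
      lb_open = (\<lambda>i. preimage_open N I \<phi> (lb_open L i)),
      lb_trans = (\<lambda>i j. ratfun_pullback N I \<phi> (lb_trans L i j))\<rparr>"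

text \<open>An isomorphism is given by invertible functions \<open>h\<^sub>a\<^sub>i\<close> on the intersections of the covering
  sets, through which the local expressions of a section are related by \<open>s'\<^sub>a = h\<^sub>a\<^sub>i s\<^sub>i\<close>.\<close>

definition bundle_iso ::
    "nat \<Rightarrow> 'a::field mpoly set \<Rightarrow> ('i, 'a) line_bundle \<Rightarrow> ('j, 'a) line_bundle \<Rightarrow> bool" where
  "bundle_iso N I L L' \<longleftrightarrow>
     (\<exists>h. (\<forall>a\<in>lb_index L'. \<forall>i\<in>lb_index L.
             h a i \<in> function_field N I \<and>
             (\<forall>Q\<in>lb_open L' a \<inter> lb_open L i. unit_at (h a i) Q)) \<and>
          (\<forall>a\<in>lb_index L'. \<forall>b\<in>lb_index L'. \<forall>i\<in>lb_index L. \<forall>j\<in>lb_index L.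
             ratfun_mult N I (h a i) (lb_trans L i j) =
             ratfun_mult N I (lb_trans L' a b) (h b j)))"


section \<open>General linear groups\<close>

definition GL_mat :: "nat \<Rightarrow> 'k::field mat set" where
  "GL_mat m = {A \<in> carrier_mat m m. invertible_mat A}"

end

theory Submission
  imports Defs "HOL-Number_Theory.Fib" "Jordan_Normal_Form.Char_Poly"
begin

text \<open>
  The bound is proved on the orbit itself, without extending the morphism to a larger projective
  space. Let \<open>R\<close> be the local ring of \<open>\<pp>\<close>: a discrete valuation ring with a uniformiser \<open>\<pi>\<close>, a
  finite residue field \<open>k\<close> and \<open>v = v(p)\<close>. Scale every point of the orbit to a vector over \<open>R\<close>
  whose first unit coordinate is \<open>1\<close>.

  \<^emph>\<open>The factor \<open>#X(k)\<close>.\<close> A point of \<open>X(k)\<close> is a point of the closure of \<open>X\<close> over \<open>R\<close>, so by good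
  reduction a single tuple over \<open>R\<close>, not vanishing at it, computes the morphism on all points with
  that reduction (\<open>local_representative\<close>). Hence the reduction of \<open>f(P)\<close> is determined by that of
  \<open>P\<close>, and the reductions of the orbit form a cycle of some length \<open>m \<le> #X(k)\<close> with \<open>m\<close> dividing \<open>n\<close>.

  \<^emph>\<open>The factor \<open>#GL\<close>.\<close> Consider the points \<open>f\<^sup>m\<^sup>j(P)\<close>, which have one common reduction. The functions
  \<open>j \<mapsto> h(f\<^sup>m\<^sup>j(P))\<close>, for the rational functions \<open>h\<close> over \<open>R\<close> that are regular at this reduction, form
  a ring \<open>A\<close> of sequences. The shift \<open>T\<close> is an automorphism of \<open>A\<close> of finite order, although \<open>f\<close>
  itself need not be invertible. With \<open>\<nn>\<close> the sequences in \<open>A\<close> that vanish at \<open>0\<close>, the quotient of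
  \<open>A\<close> by \<open>R + \<pi>\<nn> + \<nn>\<^sup>2\<close> is a vector space over \<open>k\<close> spanned by the \<open>N + 1\<close> coordinates, so that some
  \<open>T\<^sup>r\<close> with \<open>1 \<le> r \<le> #GL\<^sub>M\<^sub>+\<^sub>1(k)\<close> acts trivially on it (\<open>cotangent_order\<close>). Here \<open>N \<le> M\<close> because the
  degree of the variety is positive (\<open>degree_pos\<close>).

  \<^emph>\<open>The factor \<open>p\<^sup>e\<close>.\<close> For \<open>q = r p\<^sup>i\<close> let \<open>s\<close> and \<open>b\<close> be such that \<open>u(q) - u(0)\<close> is divisible by
  \<open>\<pi>\<^sup>s\<close> for all \<open>u\<close> in \<open>A\<close>, and \<open>T\<^sup>q - 1\<close> maps \<open>A\<close> to \<open>R + \<pi>\<^sup>b\<nn> + \<nn>\<^sup>2\<close>. Summing first differences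
  shows that
  \<open>u(pq) - u(0) \<equiv> p (u(q) - u(0))\<close> modulo \<open>\<pi>\<close> to the power \<open>min (2s) (s + cb) (s + v + b)\<close>, where \<open>c\<close>
  is \<open>1\<close> for \<open>p = 2\<close> and \<open>2\<close> otherwise, and that \<open>b\<close> may be replaced by \<open>min s (2b) (b + v)\<close> when
  \<open>q\<close> is replaced by \<open>pq\<close>. If \<open>v < min s (cb)\<close> with \<open>s\<close> as large as possible, then the term
  \<open>p (u(q) - u(0))\<close> prevails at this and at all later steps, and the orbit never closes. So
  \<open>min s (cb) \<le> v\<close> until the orbit closes, while \<open>s\<close> and \<open>b\<close> grow at least like the powers of two
  if \<open>p\<close> is odd and like the Fibonacci numbers if \<open>p = 2\<close> (\<open>period_bound\<close>). This bounds \<open>e\<close>.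
\<close>

text \<open>The first power of the maximal ideal is written \<open>pw 1\<close>, which the simplifier must not turn into
  \<open>pw (Suc 0)\<close>.\<close>
declare One_nat_def [simp del]

section \<open>Discrete valuation rings in a field of characteristic zero\<close>

text \<open>The ring \<open>R\<close> is a discrete valuation ring with uniformiser \<open>\<pi>\<close> and with \<open>v\<close> the valuation of
  the residue characteristic \<open>p\<close>; the axioms are stated for elements of the ambient field.\<close>
locale uniformized =
  fixes R :: "'a::field_char_0 set" and \<pi> :: 'a and p v :: nat
  assumes one_R: "1 \<in> R"
    and diff_R: "x \<in> R \<Longrightarrow> y \<in> R \<Longrightarrow> x - y \<in> R"
    and mult_R: "x \<in> R \<Longrightarrow> y \<in> R \<Longrightarrow> x * y \<in> R"
    and unif_R: "\<pi> \<in> R" and unif_nonzero: "\<pi> \<noteq> 0" and unif_nonunit: "inverse \<pi> \<notin> R"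
    and factor_R: "x \<in> R \<Longrightarrow> x \<noteq> 0 \<Longrightarrow> \<exists>k. \<exists>w\<in>R. inverse w \<in> R \<and> x = \<pi> ^ k * w"
    and prime_p: "prime p"
    and p_factor: "\<exists>w\<in>R. inverse w \<in> R \<and> of_nat p = \<pi> ^ v * w"
    and v_pos: "v \<ge> 1"
begin

text \<open>The ideal \<open>\<pi>\<^sup>s R\<close>. Membership in it replaces the inequality \<open>v(x) \<ge> s\<close>, with no exception at
  \<open>x = 0\<close>.\<close>
definition pw :: "nat \<Rightarrow> 'a set" where
  "pw s = (\<lambda>y. \<pi> ^ s * y) ` R"

lemma zero_R: "0 \<in> R" using diff_R[OF one_R one_R] by simp
lemma uminus_R: "x \<in> R \<Longrightarrow> - x \<in> R" using diff_R[OF zero_R] by fastforce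
lemma add_R: "x \<in> R \<Longrightarrow> y \<in> R \<Longrightarrow> x + y \<in> R"
  using diff_R[of x "- y"] uminus_R[of y] by simp
lemma of_nat_R: "of_nat k \<in> R" by (induction k) (auto intro: zero_R one_R add_R)
lemma power_R: "x \<in> R \<Longrightarrow> x ^ k \<in> R" by (induction k) (auto intro: one_R mult_R)
lemma sum_R: "(\<And>i. i \<in> S \<Longrightarrow> g i \<in> R) \<Longrightarrow> sum g S \<in> R"
  by (induction S rule: infinite_finite_induct) (auto intro: zero_R add_R)

lemma pwI: "y \<in> R \<Longrightarrow> \<pi> ^ s * y \<in> pw s" unfolding pw_def by blast
lemma pw_0: "pw 0 = R" by (simp add: pw_def)
lemma zero_pw: "0 \<in> pw s" using pwI[OF zero_R] by simp
lemma pw_subset_R: "x \<in> pw s \<Longrightarrow> x \<in> R" by (auto simp: pw_def intro: mult_R power_R unif_R)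
lemma add_pw: "x \<in> pw s \<Longrightarrow> y \<in> pw s \<Longrightarrow> x + y \<in> pw s"
  unfolding pw_def by (auto simp: distrib_left[symmetric] intro!: imageI add_R)
lemma diff_pw: "x \<in> pw s \<Longrightarrow> y \<in> pw s \<Longrightarrow> x - y \<in> pw s"
  unfolding pw_def by (auto simp: right_diff_distrib[symmetric] intro!: imageI diff_R)
lemma uminus_pw: "x \<in> pw s \<Longrightarrow> - x \<in> pw s" using diff_pw[OF zero_pw] by fastforce
lemma mult_pw: "x \<in> pw s \<Longrightarrow> y \<in> pw t \<Longrightarrow> x * y \<in> pw (s + t)"
proof -
  assume "x \<in> pw s" "y \<in> pw t"
  then obtain x' y' where "x' \<in> R" "y' \<in> R" "x = \<pi> ^ s * x'" "y = \<pi> ^ t * y'"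
    unfolding pw_def by auto
  then have "x * y = \<pi> ^ (s + t) * (x' * y')" "x' * y' \<in> R"
    by (auto simp: power_add mult_R)
  then show ?thesis using pwI by auto
qed
lemma mult_pw_left: "c \<in> R \<Longrightarrow> y \<in> pw t \<Longrightarrow> c * y \<in> pw t"
  using mult_pw[of c 0 y t] by (simp add: pw_0)
lemma mult_pw_right: "y \<in> pw t \<Longrightarrow> c \<in> R \<Longrightarrow> y * c \<in> pw t"
  using mult_pw_left by (simp add: mult.commute)
lemma pw_mono: "x \<in> pw s \<Longrightarrow> t \<le> s \<Longrightarrow> x \<in> pw t"
proof -
  assume "x \<in> pw s" and ts: "t \<le> s"
  then obtain y where y: "y \<in> R" "x = \<pi> ^ s * y" unfolding pw_def by auto
  have "x = \<pi> ^ t * (\<pi> ^ (s - t) * y)"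
    using y ts by (simp add: mult.assoc[symmetric] power_add[symmetric])
  then show ?thesis using pwI[of "\<pi> ^ (s - t) * y" t] y mult_R power_R unif_R by metis
qed
lemma sum_pw: "(\<And>i. i \<in> S \<Longrightarrow> g i \<in> pw s) \<Longrightarrow> sum g S \<in> pw s"
  by (induction S rule: infinite_finite_induct) (auto intro: zero_pw add_pw)
lemma unif_power_pw: "\<pi> ^ s \<in> pw s" using pwI[OF one_R] by simp

lemma unit_notin_pw1: "w \<in> R \<Longrightarrow> inverse w \<in> R \<Longrightarrow> w \<noteq> 0 \<Longrightarrow> w \<notin> pw 1"
proof
  assume w: "w \<in> R" "inverse w \<in> R" "w \<noteq> 0" and "w \<in> pw 1"
  then obtain y where y: "y \<in> R" "w = \<pi> * y" unfolding pw_def by auto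
  then have "inverse \<pi> = y * inverse w" using w unif_nonzero by (simp add: field_simps)
  then show False using unif_nonunit y w mult_R by metis
qed

lemma power_unit_notin_pw_Suc:
  assumes "w \<in> R" "inverse w \<in> R" "w \<noteq> 0"
  shows "\<pi> ^ s * w \<notin> pw (Suc s)"
proof
  assume "\<pi> ^ s * w \<in> pw (Suc s)"
  then obtain y where "y \<in> R" "\<pi> ^ s * w = \<pi> ^ Suc s * y" unfolding pw_def by auto
  then have "w = \<pi> * y" using unif_nonzero by simp
  then have "w \<in> pw 1" using \<open>y \<in> R\<close> unfolding pw_def by auto
  then show False using unit_notin_pw1 assms by blast
qed

lemma exact_power:
  assumes "x \<in> R" "x \<noteq> 0"
  obtains s w where "w \<in> R" "inverse w \<in> R" "w \<noteq> 0" "x = \<pi> ^ s * w"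
    "x \<in> pw s" "x \<notin> pw (Suc s)"
  using factor_R[OF assms] power_unit_notin_pw_Suc pwI assms
  by (metis mult_zero_right)

lemma unit_if_notin_pw1:
  assumes "x \<in> R" "x \<notin> pw 1"
  shows "inverse x \<in> R"
proof -
  have "x \<noteq> 0" using assms zero_pw by auto
  from exact_power[OF assms(1) this] obtain s w where w: "inverse w \<in> R" "x = \<pi> ^ s * w" "x \<in> pw s"
    by metis
  have "s = 0" using w(3) assms(2) pw_mono[of x s 1] by fastforce
  then show ?thesis using w by simp
qed

text \<open>The valuation of a product is at most the sum of the valuations: this is where divisibility
  bounds can be turned into contradictions.\<close>
lemma notin_pw_Suc_mult:
  assumes "x \<in> R" "y \<in> R" "x \<notin> pw (Suc s)" "y \<notin> pw (Suc t)"
  shows "x * y \<notin> pw (Suc (s + t))"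
proof -
  have nz: "x \<noteq> 0" "y \<noteq> 0" using assms zero_pw by auto
  obtain i a where a: "a \<in> R" "inverse a \<in> R" "a \<noteq> 0" "x = \<pi> ^ i * a" "x \<in> pw i"
    using exact_power[OF assms(1) nz(1)] by metis
  obtain j b where b: "b \<in> R" "inverse b \<in> R" "b \<noteq> 0" "y = \<pi> ^ j * b" "y \<in> pw j"
    using exact_power[OF assms(2) nz(2)] by metis
  have ij: "i \<le> s" "j \<le> t" using assms a b pw_mono not_less_eq_eq by blast+
  have xy: "x * y = \<pi> ^ (i + j) * (a * b)" using a b by (simp add: power_add)
  have "x * y \<notin> pw (Suc (i + j))"
    unfolding xy by (rule power_unit_notin_pw_Suc) (use a b in \<open>auto simp: mult_R\<close>)
  then show ?thesis using pw_mono[of "x*y" "Suc (s+t)" "Suc (i+j)"] ij by auto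
qed

lemma p_pw: "of_nat p \<in> pw v" using p_factor pwI by auto
lemma p_notin: "of_nat p \<notin> pw (Suc v)"
  using p_factor power_unit_notin_pw_Suc prime_p
  by (metis mult_zero_right of_nat_eq_0_iff not_prime_0)
lemma p_pw1: "of_nat p \<in> pw 1" using pw_mono[OF p_pw] v_pos by simp

text \<open>Integers prime to \<open>p\<close> are units, by Bezout.\<close>
lemma of_nat_notin_pw1:
  assumes "\<not> p dvd j" shows "of_nat j \<notin> pw 1"
proof
  assume j: "of_nat j \<in> pw 1"
  have "coprime (int p) (int j)" using assms prime_p prime_imp_coprime by auto
  then obtain a b :: int where ab: "a * int p + b * int j = 1"
    using bezout_int[of "int p" "int j"] by (auto simp: coprime_iff_gcd_eq_1)
  have of_int_R: "of_int c \<in> R" for c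
    by (cases c) (auto intro: of_nat_R diff_R uminus_R simp del: of_nat_Suc)
  have "(of_int a * of_nat p + of_int b * of_nat j :: 'a) = of_int (a * int p + b * int j)" by simp
  then have "(1::'a) = of_int a * of_nat p + of_int b * of_nat j" using ab by simp
  also have "\<dots> \<in> pw 1" by (intro add_pw mult_pw_left of_int_R j p_pw1)
  finally show False using unit_notin_pw1 one_R by auto
qed

end

section \<open>Rings of sequences under the shift\<close>

text \<open>A sequence is thought of as a function on an orbit, and the shift as the pullback along the
  map that generates the orbit. All values of a sequence are congruent, since all points of the
  orbit have the same reduction.\<close>
locale sequence_ring = uniformized +
  fixes A :: "(nat \<Rightarrow> 'a) set"
  assumes const_A: "c \<in> R \<Longrightarrow> (\<lambda>_. c) \<in> A"
    and diff_A: "u \<in> A \<Longrightarrow> w \<in> A \<Longrightarrow> (\<lambda>j. u j - w j) \<in> A"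
    and mult_A: "u \<in> A \<Longrightarrow> w \<in> A \<Longrightarrow> (\<lambda>j. u j * w j) \<in> A"
    and val_A: "u \<in> A \<Longrightarrow> u j \<in> R"
    and cong_A: "u \<in> A \<Longrightarrow> u j - u 0 \<in> pw 1"
    and shift1_A: "u \<in> A \<Longrightarrow> (\<lambda>j. u (Suc j)) \<in> A"
begin

lemma add_A: "u \<in> A \<Longrightarrow> w \<in> A \<Longrightarrow> (\<lambda>j. u j + w j) \<in> A"
  using diff_A[of u "\<lambda>j. 0 - w j"] diff_A[OF const_A[OF zero_R], of w] by simp
lemma scale_A: "c \<in> R \<Longrightarrow> u \<in> A \<Longrightarrow> (\<lambda>j. c * u j) \<in> A"
  using mult_A[OF const_A] by simp
lemma shift_A: "u \<in> A \<Longrightarrow> (\<lambda>j. u (j + q)) \<in> A"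
  by (induction q arbitrary: u) (auto dest: shift1_A)

text \<open>The ideal \<open>\<nn>\<close> of functions vanishing at the base point \<open>0\<close> of the orbit.\<close>
definition van :: "(nat \<Rightarrow> 'a) set" where "van = {u \<in> A. u 0 = 0}"

text \<open>The square \<open>\<nn>\<^sup>2\<close> of this ideal.\<close>
inductive_set van2 :: "(nat \<Rightarrow> 'a) set" where
  zero_van2: "(\<lambda>_. 0) \<in> van2"
| step_van2: "y \<in> van \<Longrightarrow> z \<in> van \<Longrightarrow> w \<in> van2 \<Longrightarrow> (\<lambda>j. y j * z j + w j) \<in> van2"

text \<open>The sequences that are constant up to \<open>\<pi>\<^sup>b\<close> times a vanishing function and terms of second
  order: \<open>R + \<pi>\<^sup>b\<nn> + \<nn>\<^sup>2\<close>. For \<open>b = 1\<close> these are the functions with trivial class in the cotangent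
  space at the common reduction of the orbit. Constants are included because the
  shift does not preserve \<open>\<nn>\<close>.\<close>
definition flat :: "nat \<Rightarrow> (nat \<Rightarrow> 'a) set" where
  "flat b = {\<lambda>j. c + \<pi> ^ b * w j + z j | c w z. c \<in> R \<and> w \<in> van \<and> z \<in> van2}"

lemma van_A: "u \<in> van \<Longrightarrow> u \<in> A" by (simp add: van_def)
lemma zero_van: "(\<lambda>_. 0) \<in> van" by (simp add: van_def const_A zero_R)
lemma add_van: "u \<in> van \<Longrightarrow> w \<in> van \<Longrightarrow> (\<lambda>j. u j + w j) \<in> van" by (simp add: van_def add_A)
lemma scale_van: "c \<in> R \<Longrightarrow> w \<in> van \<Longrightarrow> (\<lambda>j. c * w j) \<in> van" by (simp add: van_def scale_A)
lemma shift_van: "u \<in> A \<Longrightarrow> (\<lambda>j. u (j + q) - u q) \<in> van"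
  using diff_A[OF shift_A const_A, of u "u q" q] val_A by (simp add: van_def)

lemma add_van2: "z \<in> van2 \<Longrightarrow> z' \<in> van2 \<Longrightarrow> (\<lambda>j. z j + z' j) \<in> van2"
  by (induction rule: van2.induct) (auto simp: add.assoc intro: van2.intros)
lemma scale_van2: "z \<in> van2 \<Longrightarrow> c \<in> R \<Longrightarrow> (\<lambda>j. c * z j) \<in> van2"
proof (induction rule: van2.induct)
  case zero_van2 then show ?case using van2.zero_van2 by simp
next
  case (step_van2 y z w)
  then show ?case using van2.step_van2[OF scale_van[of c y] step_van2(2)]
    by (simp add: distrib_left mult.assoc)
qed
lemma van2_0: "z \<in> van2 \<Longrightarrow> z 0 = 0"
  by (induction rule: van2.induct) (auto simp: van_def)
lemma mult_van2: "y \<in> van \<Longrightarrow> z \<in> van \<Longrightarrow> (\<lambda>j. y j * z j) \<in> van2"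
  using van2.step_van2[OF _ _ van2.zero_van2] by simp
lemma van2_A: "z \<in> van2 \<Longrightarrow> z \<in> A"
  by (induction rule: van2.induct) (simp_all add: const_A zero_R add_A mult_A van_A)

lemma flatI: "c \<in> R \<Longrightarrow> w \<in> van \<Longrightarrow> z \<in> van2 \<Longrightarrow> (\<lambda>j. c + \<pi> ^ b * w j + z j) \<in> flat b"
  unfolding flat_def by blast
lemma flatE:
  assumes "u \<in> flat b"
  obtains c w z where "c \<in> R" "w \<in> van" "z \<in> van2" "u = (\<lambda>j. c + \<pi> ^ b * w j + z j)"
  using assms unfolding flat_def by blast
lemma const_flat: "c \<in> R \<Longrightarrow> (\<lambda>_. c) \<in> flat b"
  using flatI[OF _ zero_van zero_van2, of c b] by simp
lemma van2_flat: "z \<in> van2 \<Longrightarrow> z \<in> flat b"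
  using flatI[OF zero_R zero_van, of z b] by simp
lemma add_flat: "u \<in> flat b \<Longrightarrow> u' \<in> flat b \<Longrightarrow> (\<lambda>j. u j + u' j) \<in> flat b"
proof -
  assume "u \<in> flat b" "u' \<in> flat b"
  then obtain c w z c' w' z' where 1: "c \<in> R" "w \<in> van" "z \<in> van2" "u = (\<lambda>j. c + \<pi> ^ b * w j + z j)"
    "c' \<in> R" "w' \<in> van" "z' \<in> van2" "u' = (\<lambda>j. c' + \<pi> ^ b * w' j + z' j)" by (meson flatE)
  have "(\<lambda>j. u j + u' j) = (\<lambda>j. (c + c') + \<pi> ^ b * (w j + w' j) + (z j + z' j))"
    by (auto simp: 1 algebra_simps)
  also have "\<dots> \<in> flat b" using 1 by (intro flatI add_R add_van add_van2)
  finally show ?thesis .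
qed
lemma scale_flat: "u \<in> flat b \<Longrightarrow> c \<in> R \<Longrightarrow> (\<lambda>j. c * u j) \<in> flat b"
proof -
  assume "u \<in> flat b" and c: "c \<in> R"
  then obtain c' w z where 1: "c' \<in> R" "w \<in> van" "z \<in> van2" "u = (\<lambda>j. c' + \<pi> ^ b * w j + z j)"
    by (meson flatE)
  have "(\<lambda>j. c * u j) = (\<lambda>j. c * c' + \<pi> ^ b * (c * w j) + c * z j)"
    by (auto simp: 1 algebra_simps)
  also have "\<dots> \<in> flat b" using 1 c by (intro flatI mult_R scale_van scale_van2)
  finally show ?thesis .
qed
lemma sum_flat: "(\<And>i. i \<in> S \<Longrightarrow> g i \<in> flat b) \<Longrightarrow> (\<lambda>j. \<Sum>i\<in>S. g i j) \<in> flat b"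
  by (induction S rule: infinite_finite_induct) (auto intro: const_flat zero_R add_flat)
lemma diff_flat: "u \<in> flat b \<Longrightarrow> u' \<in> flat b \<Longrightarrow> (\<lambda>j. u j - u' j) \<in> flat b"
  using add_flat[OF _ scale_flat[of u' b "-1"]] one_R uminus_R by simp
lemma unif_scale_flat: "u \<in> flat b \<Longrightarrow> (\<lambda>j. \<pi> ^ t * u j) \<in> flat (b + t)"
proof -
  assume "u \<in> flat b"
  then obtain c' w z where 1: "c' \<in> R" "w \<in> van" "z \<in> van2" "u = (\<lambda>j. c' + \<pi> ^ b * w j + z j)"
    by (meson flatE)
  have "(\<lambda>j. \<pi> ^ t * u j) = (\<lambda>j. \<pi> ^ t * c' + \<pi> ^ (b + t) * w j + \<pi> ^ t * z j)"
    by (auto simp: 1 algebra_simps power_add)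
  also have "\<dots> \<in> flat (b + t)" using 1 by (intro flatI mult_R scale_van2 power_R unif_R)
  finally show ?thesis .
qed
lemma pw_scale_flat: "x \<in> pw b \<Longrightarrow> u \<in> A \<Longrightarrow> (\<lambda>j. x * u j) \<in> flat b"
proof -
  assume "x \<in> pw b" and u: "u \<in> A"
  then obtain y where y: "y \<in> R" "x = \<pi> ^ b * y" unfolding pw_def by auto
  have "(\<lambda>j. x * u j) = (\<lambda>j. x * u 0 + \<pi> ^ b * (y * (u (j + 0) - u 0)) + 0)"
    using y by (auto simp: algebra_simps)
  also have "\<dots> \<in> flat b" using y val_A[OF u]
    by (intro flatI mult_R scale_van shift_van u zero_van2 power_R unif_R) (auto intro: mult_R power_R unif_R)
  finally show ?thesis .
qed
lemma flat_mono: "u \<in> flat b \<Longrightarrow> b' \<le> b \<Longrightarrow> u \<in> flat b'"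
proof -
  assume "u \<in> flat b" and le: "b' \<le> b"
  then obtain c' w z where 1: "c' \<in> R" "w \<in> van" "z \<in> van2" "u = (\<lambda>j. c' + \<pi> ^ b * w j + z j)"
    by (meson flatE)
  have "u = (\<lambda>j. c' + \<pi> ^ b' * (\<pi> ^ (b - b') * w j) + z j)"
    using le by (simp add: 1 mult.assoc[symmetric] power_add[symmetric])
  also have "\<dots> \<in> flat b'" using 1 by (intro flatI mult_R scale_van power_R unif_R)
  finally show ?thesis .
qed

text \<open>A shifted product \<open>y z\<close> of vanishing functions is \<open>(y(q) + y')(z(q) + z')\<close> with \<open>y'\<close> and \<open>z'\<close>
  again vanishing, and \<open>y(q)\<close>, \<open>z(q)\<close> are divisible by \<open>\<pi>\<^sup>s\<close>.\<close>
lemma shift_van2: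
  assumes s: "\<And>u. u \<in> A \<Longrightarrow> u q - u 0 \<in> pw s"
  shows "z \<in> van2 \<Longrightarrow> (\<lambda>j. z (j + q)) \<in> flat s"
proof (induction rule: van2.induct)
  case zero_van2 then show ?case using const_flat zero_R by simp
next
  case (step_van2 y z w)
  have yz: "y q \<in> pw s" "z q \<in> pw s" using step_van2(1,2) s[of y] s[of z] by (auto simp: van_def)
  let ?y = "\<lambda>j. y (j + q) - y q" and ?z = "\<lambda>j. z (j + q) - z q"
  have n: "?y \<in> van" "?z \<in> van" using step_van2(1,2) shift_van van_A by auto
  have "(\<lambda>j. y (j + q) * z (j + q) + w (j + q)) =
      (\<lambda>j. (y q * z q + (y q * ?z j + z q * ?y j) + ?y j * ?z j) + w (j + q))"
    by (auto simp: algebra_simps)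
  also have "\<dots> \<in> flat s"
    using n yz step_van2.IH
    by (intro add_flat const_flat pw_scale_flat van2_flat[OF mult_van2] mult_R)
      (auto intro: pw_subset_R van_A)
  finally show ?case .
qed

lemma shift_flat:
  assumes s: "\<And>u. u \<in> A \<Longrightarrow> u q - u 0 \<in> pw s" and "b \<le> s" and u: "u \<in> flat b"
  shows "(\<lambda>j. u (j + q)) \<in> flat b"
proof -
  from u obtain c w z where 1: "c \<in> R" "w \<in> van" "z \<in> van2" "u = (\<lambda>j. c + \<pi> ^ b * w j + z j)"
    by (meson flatE)
  show ?thesis unfolding 1(4)
    using 1 shift_van2[of q s, OF s 1(3)] flat_mono[OF _ \<open>b \<le> s\<close>]
    by (intro add_flat const_flat pw_scale_flat unif_power_pw shift_A van_A) auto
qed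

text \<open>The \<open>q\<close>-th power of the shift is close to the identity: to order \<open>s\<close> at the base point, and to
  order \<open>b\<close> on the cotangent space.\<close>
definition near_identity :: "nat \<Rightarrow> nat \<Rightarrow> nat \<Rightarrow> bool" where
  "near_identity q s b \<longleftrightarrow> 1 \<le> s \<and> 1 \<le> b \<and> (\<forall>u\<in>A. u q - u 0 \<in> pw s) \<and>
     (\<forall>u\<in>A. (\<lambda>j. u (j + q) - u j) \<in> flat b)"

lemma near_identity_mult:
  assumes "near_identity q s b" "u \<in> A"
  shows "u (i * q) - u 0 \<in> pw s"
proof (induction i)
  case 0 then show ?case using zero_pw by simp
next
  case (Suc i)
  have "u (q + i * q) - u (0 + i * q) \<in> pw s"
    using assms(1) shift_A[OF assms(2), of "i * q"] unfolding near_identity_def by fastforce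
  from add_pw[OF this Suc] show ?case by simp
qed

lemma van2_near_identity:
  assumes "near_identity q s b"
  shows "z \<in> van2 \<Longrightarrow> z (i * q) \<in> pw (2 * s)"
proof (induction rule: van2.induct)
  case zero_van2 then show ?case using zero_pw by simp
next
  case (step_van2 y z w)
  then have "y (i * q) \<in> pw s" "z (i * q) \<in> pw s"
    using near_identity_mult[OF assms, of y i] near_identity_mult[OF assms, of z i] by (auto simp: van_def)
  from mult_pw[OF this] step_van2 show ?case by (auto intro: add_pw simp: mult_2)
qed

lemma shift_flat_near_identity:
  assumes "near_identity q s b" "b' \<le> s" "u \<in> flat b'"
  shows "(\<lambda>j. u (j + i * q)) \<in> flat b'"
  using shift_flat[of "i * q" s, OF near_identity_mult[OF assms(1)] assms(2,3)] .

lemma telescope_shift: "(u::nat \<Rightarrow> 'a) (j + i * q) - u j = (\<Sum>l<i. u (j + l * q + q) - u (j + l * q))"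
proof (induction i)
  case (Suc i)
  have "u (j + Suc i * q) = u (j + i * q + q)" by (simp add: algebra_simps)
  then show ?case using Suc by (simp add: algebra_simps)
qed simp

text \<open>The constant in the expansion of a first difference is its value at the base point.\<close>
lemma near_identity_expand:
  assumes N: "near_identity q s b" and u: "u \<in> A"
  obtains w z where "w \<in> van" "z \<in> van2" "\<And>j. u (j + q) - u j = (u q - u 0) + \<pi> ^ b * w j + z j"
proof -
  have "(\<lambda>j. u (j + q) - u j) \<in> flat b" using N u by (simp add: near_identity_def)
  then obtain c w z where 1: "c \<in> R" "w \<in> van" "z \<in> van2"
    and 2: "(\<lambda>j. u (j + q) - u j) = (\<lambda>j. c + \<pi> ^ b * w j + z j)" by (meson flatE)
  have "c = u q - u 0" using fun_cong[OF 2, of 0] 1 van2_0 by (simp add: van_def)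
  with 1 fun_cong[OF 2] that show thesis by blast
qed

lemma near_identity_multiple_diff:
  assumes N: "near_identity q s b" and u: "u \<in> A"
  shows "(\<lambda>j. u (j + i * q) - u j) \<in> flat (min b s)"
proof -
  have "(\<lambda>j. u (j + q) - u j) \<in> flat (min b s)" using N u flat_mono by (auto simp: near_identity_def)
  then have "(\<lambda>j. u (j + l * q + q) - u (j + l * q)) \<in> flat (min b s)" for l
    using shift_flat_near_identity[OF N, of "min b s" "\<lambda>j. u (j + q) - u j" l] by simp
  then show ?thesis unfolding telescope_shift by (rule sum_flat)
qed

text \<open>Write \<open>T\<^sup>p\<^sup>q - 1\<close> as the sum of the \<open>T\<^sup>l\<^sup>q (T\<^sup>q - 1)\<close> for \<open>l < p\<close>. To first order each summand
  is \<open>\<pi>\<^sup>b w\<close> with the same \<open>w\<close>, and the sum of \<open>p\<close> equal terms gains \<open>v\<close>; the deviations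
  \<open>\<pi>\<^sup>b (T\<^sup>l\<^sup>q w - w)\<close> gain another \<open>min b s\<close>.\<close>
lemma near_identity_step_operator:
  assumes N: "near_identity q s b" and u: "u \<in> A"
  shows "(\<lambda>j. u (j + p * q) - u j) \<in> flat (min s (min (2 * b) (b + v)))"
proof -
  let ?m = "min s (min (2 * b) (b + v))"
  obtain w z where wz: "w \<in> van" "z \<in> van2" "\<And>j. u (j + q) - u j = (u q - u 0) + \<pi> ^ b * w j + z j"
    using near_identity_expand[OF N u] by metis
  have uR: "u q - u 0 \<in> R" using val_A[OF u] diff_R by auto
  have "(\<lambda>j. u (j + p * q) - u j) =
     (\<lambda>j. (\<Sum>l<p. ((u q - u 0) + z (j + l * q)) + \<pi> ^ b * (w (j + l * q) - w j))
           + (\<pi> ^ b * of_nat p) * w j)"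
  proof
    fix j
    have "u (j + p * q) - u j = (\<Sum>l<p. (u q - u 0) + \<pi> ^ b * w (j + l * q) + z (j + l * q))"
      unfolding telescope_shift[of u j p q] by (simp only: wz(3))
    also have "\<dots> = (\<Sum>l<p. ((u q - u 0) + z (j + l * q)) + \<pi> ^ b * (w (j + l * q) - w j) + \<pi> ^ b * w j)"
      by (intro sum.cong) (auto simp: algebra_simps)
    also have "\<dots> = (\<Sum>l<p. ((u q - u 0) + z (j + l * q)) + \<pi> ^ b * (w (j + l * q) - w j))
           + (\<pi> ^ b * of_nat p) * w j"
      by (subst sum.distrib) (simp add: mult_ac)
    finally show "u (j + p * q) - u j = \<dots>" .
  qed
  also have "\<dots> \<in> flat ?m"
  proof (intro add_flat sum_flat const_flat uR)
    fix l
    show "(\<lambda>j. z (j + l * q)) \<in> flat ?m"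
      using shift_flat_near_identity[OF N _ van2_flat[OF wz(2), of s], of l] flat_mono by auto
    have "(\<lambda>j. \<pi> ^ b * (w (j + l * q) - w j)) \<in> flat (min b s + b)"
      using unif_scale_flat[OF near_identity_multiple_diff[OF N van_A[OF wz(1)]]] .
    then show "(\<lambda>j. \<pi> ^ b * (w (j + l * q) - w j)) \<in> flat ?m"
      by (rule flat_mono) auto
  next
    have "\<pi> ^ b * of_nat p \<in> pw (b + v)" by (intro mult_pw unif_power_pw p_pw)
    from flat_mono[OF pw_scale_flat[OF this van_A[OF wz(1)]], of ?m]
    show "(\<lambda>j. \<pi> ^ b * of_nat p * w j) \<in> flat ?m" by simp
  qed
  finally show ?thesis .
qed

text \<open>How many factors \<open>\<pi>\<^sup>b\<close> are gained in the second order term of \<open>u(pq) - u(0)\<close>: the term of first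
  order in \<open>\<pi>\<^sup>b\<close> is multiplied by \<open>p (p - 1) / 2\<close>, which is divisible by \<open>p\<close> unless \<open>p = 2\<close>.\<close>
definition cexp :: nat where "cexp = (if p = 2 then 1 else 2)"

text \<open>The value at \<open>pq\<close> is the sum of the first differences at the points \<open>l q\<close>. Their constant parts
  add up to \<open>p (u(q) - u(0))\<close> and their second order parts are divisible by \<open>\<pi>\<^sup>2\<^sup>s\<close>. The middle
  parts are \<open>\<pi>\<^sup>b w(l q)\<close>; expanding \<open>w\<close> once more gives \<open>w(l q) \<equiv> l w(q)\<close>, and the numbers
  \<open>l < p\<close> sum to a multiple of \<open>p\<close> if \<open>p\<close> is odd.\<close>
lemma near_identity_step_value:
  assumes N: "near_identity q s b" and u: "u \<in> A"
  shows "u (p * q) - u 0 - of_nat p * (u q - u 0) \<in> pw (min (2 * s) (min (s + cexp * b) (s + v + b)))"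
proof -
  let ?m = "min (2 * s) (min (s + cexp * b) (s + v + b))"
  obtain w z where wz: "w \<in> van" "z \<in> van2" "\<And>j. u (j + q) - u j = (u q - u 0) + \<pi> ^ b * w j + z j"
    using near_identity_expand[OF N u] by metis
  have w0: "w 0 = 0" using wz(1) by (simp add: van_def)
  have "u (p * q) - u 0 = (\<Sum>l<p. u (l * q + q) - u (l * q))"
    using telescope_shift[of u 0 p q] by simp
  also have "\<dots> = of_nat p * (u q - u 0) + \<pi> ^ b * (\<Sum>l<p. w (l * q)) + (\<Sum>l<p. z (l * q))"
    by (simp only: wz(3)) (simp add: sum.distrib sum_distrib_left)
  finally have eq: "u (p * q) - u 0 - of_nat p * (u q - u 0) =
     \<pi> ^ b * (\<Sum>l<p. w (l * q)) + (\<Sum>l<p. z (l * q))" by simp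
  have z: "(\<Sum>l<p. z (l * q)) \<in> pw ?m"
    by (rule sum_pw, rule pw_mono[OF van2_near_identity[OF N wz(2)]]) simp
  have wA: "w \<in> A" using wz(1) van_A by auto
  have "\<pi> ^ b * (\<Sum>l<p. w (l * q)) \<in> pw ?m"
  proof (cases "p = 2")
    case True
    have "(\<Sum>l<p. w (l * q)) = w q" using w0 True by (simp add: numeral_2_eq_2)
    moreover have "w q \<in> pw s" using N wA w0 by (auto simp: near_identity_def)
    ultimately have "\<pi> ^ b * (\<Sum>l<p. w (l * q)) \<in> pw (b + s)"
      by (auto intro: mult_pw unif_power_pw)
    moreover have "cexp = 1" unfolding cexp_def using True by simp
    ultimately show ?thesis by (elim pw_mono) simp
  next
    case False
    obtain w' z' where wz': "w' \<in> van" "z' \<in> van2"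
      "\<And>j. w (j + q) - w j = (w q - w 0) + \<pi> ^ b * w' j + z' j"
      using near_identity_expand[OF N wA] by metis
    let ?g = "\<lambda>l. \<pi> ^ b * w' (l * q) + z' (l * q)"
    have g: "?g l \<in> pw (min (b + s) (2 * s))" for l
    proof (intro add_pw)
      have "w' (l * q) \<in> pw s" using near_identity_mult[OF N van_A[OF wz'(1)], of l] wz'(1) by (auto simp: van_def)
      then have "\<pi> ^ b * w' (l * q) \<in> pw (b + s)" by (intro mult_pw unif_power_pw)
      then show "\<pi> ^ b * w' (l * q) \<in> pw (min (b + s) (2 * s))" by (rule pw_mono) auto
      show "z' (l * q) \<in> pw (min (b + s) (2 * s))"
        using van2_near_identity[OF N wz'(2)] by (rule pw_mono) auto
    qed
    have wl: "w (l * q) = of_nat l * w q + (\<Sum>i<l. ?g i)" for l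
      using telescope_shift[of w 0 l q] w0 wz'(3) by (simp add: sum.distrib)
    have "odd p" using False prime_p primes_dvd_imp_eq two_is_prime_nat by blast
    then have "(\<Sum>l<p. of_nat l :: 'a) = of_nat p * of_nat ((p - 1) div 2)"
    proof -
      have *: "(\<Sum>l<p. l) = p * ((p - 1) div 2)"
        using Sum_Ico_nat[of 0 p] \<open>odd p\<close> by (auto elim!: oddE simp: atLeast0LessThan)
      show ?thesis using arg_cong[OF *, of "of_nat :: nat \<Rightarrow> 'a"] by simp
    qed
    then have "(\<Sum>l<p. w (l * q)) =
        of_nat p * (of_nat ((p - 1) div 2) * w q) + (\<Sum>l<p. \<Sum>i<l. ?g i)"
      unfolding wl by (simp add: sum.distrib sum_distrib_right[symmetric])
    moreover have "of_nat p * (of_nat ((p - 1) div 2) * w q) \<in> pw (v + s)"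
      using N wA w0 by (intro mult_pw p_pw mult_pw_left of_nat_R) (auto simp: near_identity_def)
    moreover have "(\<Sum>l<p. \<Sum>i<l. ?g i) \<in> pw (min (b + s) (2 * s))"
      by (intro sum_pw g)
    moreover have "min (v + s) (min (b + s) (2 * s)) \<le> v + s"
      "min (v + s) (min (b + s) (2 * s)) \<le> min (b + s) (2 * s)" by auto
    ultimately have "(\<Sum>l<p. w (l * q)) \<in> pw (min (v + s) (min (b + s) (2 * s)))"
      by (metis (no_types, lifting) add_pw pw_mono)
    then have "\<pi> ^ b * (\<Sum>l<p. w (l * q)) \<in> pw (b + min (v + s) (min (b + s) (2 * s)))"
      by (intro mult_pw unif_power_pw)
    then show ?thesis
      by (rule pw_mono) (auto simp: cexp_def False)
  qed
  with z eq show ?thesis by (auto intro: add_pw)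
qed

lemma near_identity_step:
  assumes N: "near_identity q s b"
  shows "near_identity (p * q) (min (2 * s) (min (s + cexp * b) (s + v))) (min s (min (2 * b) (b + v)))"
proof -
  have sb: "1 \<le> s" "1 \<le> b" using N by (auto simp: near_identity_def)
  have c_val: "1 \<le> cexp" by (simp add: cexp_def)
  let ?m = "min (2 * s) (min (s + cexp * b) (s + v))"
  have "u (p * q) - u 0 \<in> pw ?m" if u: "u \<in> A" for u
  proof -
    have "of_nat p * (u q - u 0) \<in> pw (v + s)" using N u by (intro mult_pw p_pw) (auto simp: near_identity_def)
    then have "of_nat p * (u q - u 0) \<in> pw ?m" by (rule pw_mono) auto
    moreover have "u (p * q) - u 0 - of_nat p * (u q - u 0) \<in> pw ?m"
      using near_identity_step_value[OF N u] by (rule pw_mono) auto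
    ultimately show ?thesis using add_pw by fastforce
  qed
  then show ?thesis using near_identity_step_operator[OF N] sb v_pos c_val
    unfolding near_identity_def by auto
qed

text \<open>While the orbit has not closed, the order \<open>s\<close> can be taken as large as possible.\<close>
lemma near_identity_sharpen:
  assumes N: "near_identity q s b" and u: "u \<in> A" "u q \<noteq> u 0"
  obtains s' where "s \<le> s'" "near_identity q s' b" "\<exists>u\<in>A. u q - u 0 \<notin> pw (Suc s')"
proof -
  have "u q - u 0 \<in> R" "u q - u 0 \<noteq> 0" using u val_A diff_R by auto
  then obtain t where t: "u q - u 0 \<notin> pw (Suc t)" using exact_power by metis
  let ?P = "\<lambda>t. \<forall>u\<in>A. u q - u 0 \<in> pw t"
  have bound: "?P t' \<Longrightarrow> t' \<le> t" for t' using t u(1) pw_mono not_less_eq_eq by blast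
  have Ps: "?P s" using N by (simp add: near_identity_def)
  define s' where "s' = (GREATEST t. ?P t)"
  have "?P s'" unfolding s'_def using GreatestI_nat[of ?P s t] Ps bound by blast
  moreover have "s \<le> s'" unfolding s'_def using Greatest_le_nat[of ?P s t] Ps bound by blast
  moreover have "\<not> ?P (Suc s')"
    using Greatest_le_nat[of ?P "Suc s'" t] bound unfolding s'_def by fastforce
  ultimately show thesis using that N unfolding near_identity_def by auto
qed

text \<open>To leading order the orbit moves along a straight line.\<close>
lemma near_identity_linear:
  assumes N: "near_identity q s b" and u: "u \<in> A"
  shows "u (i * q) - u 0 - of_nat i * (u q - u 0) \<in> pw (Suc s)"
proof -
  obtain w z where wz: "w \<in> van" "z \<in> van2" "\<And>j. u (j + q) - u j = (u q - u 0) + \<pi> ^ b * w j + z j"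
    using near_identity_expand[OF N u] by metis
  have sb: "1 \<le> s" "1 \<le> b" using N by (auto simp: near_identity_def)
  have g: "\<pi> ^ b * w (l * q) + z (l * q) \<in> pw (Suc s)" for l
  proof (intro add_pw)
    have "w (l * q) \<in> pw s" using near_identity_mult[OF N van_A[OF wz(1)], of l] wz(1) by (auto simp: van_def)
    then have "\<pi> ^ b * w (l * q) \<in> pw (b + s)" by (intro mult_pw unif_power_pw)
    then show "\<pi> ^ b * w (l * q) \<in> pw (Suc s)" by (rule pw_mono) (use sb in auto)
    show "z (l * q) \<in> pw (Suc s)"
      using van2_near_identity[OF N wz(2)] by (rule pw_mono) (use sb in auto)
  qed
  have "u (i * q) - u 0 - of_nat i * (u q - u 0) = (\<Sum>l<i. \<pi> ^ b * w (l * q) + z (l * q))"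
    using telescope_shift[of u 0 i q] by (simp add: wz(3) sum.distrib)
  then show ?thesis using g sum_pw[of "{..<i}"] by simp
qed

text \<open>In this situation multiplication by \<open>p\<close> is the leading term in passing from \<open>q\<close> to \<open>pq\<close>; the
  last conjunct says that \<open>s\<close> is exact.\<close>
definition p_dominates :: "nat \<Rightarrow> bool" where
  "p_dominates q \<longleftrightarrow> (\<exists>s b. near_identity q s b \<and> v < s \<and> v < cexp * b \<and> (\<exists>u\<in>A. u q - u 0 \<notin> pw (Suc s)))"

lemma p_dominates_step: "p_dominates q \<Longrightarrow> p_dominates (p * q)"
proof -
  assume "p_dominates q"
  then obtain s b u where N: "near_identity q s b" and vs: "v < s" "v < cexp * b" and u: "u \<in> A"
    and us: "u q - u 0 \<notin> pw (Suc s)" unfolding p_dominates_def by blast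
  let ?b = "min s (min (2 * b) (b + v))"
  have sb: "1 \<le> b" using N by (simp add: near_identity_def)
  have N': "near_identity (p * q) (s + v) ?b"
    using near_identity_step[OF N] vs by (simp add: min_def)
  have "u (p * q) - u 0 \<notin> pw (Suc (s + v))"
  proof
    assume *: "u (p * q) - u 0 \<in> pw (Suc (s + v))"
    have "u (p * q) - u 0 - of_nat p * (u q - u 0) \<in> pw (Suc (s + v))"
      using near_identity_step_value[OF N u] by (rule pw_mono) (use vs sb in auto)
    from diff_pw[OF * this] have "of_nat p * (u q - u 0) \<in> pw (Suc (v + s))" by (simp add: add.commute)
    moreover have "of_nat p * (u q - u 0) \<notin> pw (Suc (v + s))"
      using us p_notin val_A[OF u] by (intro notin_pw_Suc_mult of_nat_R diff_R)
    ultimately show False by simp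
  qed
  moreover have "v < cexp * ?b" using vs sb by (auto simp: cexp_def min_def split: if_splits)
  ultimately show ?thesis using N' u vs unfolding p_dominates_def
    by (metis trans_less_add1)
qed

text \<open>By linearity to leading order, the factor of \<open>n\<close> prime to \<open>p\<close> contributes nothing beyond \<open>r\<close>, so
  \<open>n\<close> divides some \<open>r p\<^sup>e\<close>; take \<open>e\<close> minimal. Before step \<open>e\<close> the orbit is not closed, and
  \<open>p_dominates\<close> is impossible because it would persist. Hence \<open>min s (c b) \<le> v\<close> at each of these
  steps, and one step turns \<open>(s, b)\<close> into at least \<open>(s + min s (c b), min s (2 b))\<close>.\<close>
lemma period_bound:
  assumes n: "n \<ge> 1"
    and periodic: "\<And>u q. u \<in> A \<Longrightarrow> n dvd q \<Longrightarrow> u q = u 0"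
    and separated: "\<And>q. \<not> n dvd q \<Longrightarrow> \<exists>u\<in>A. u q \<noteq> u 0"
    and base: "near_identity r 1 1"
  obtains e where "n dvd r * p ^ e" "e = 0 \<or> (p \<noteq> 2 \<and> 2 ^ (e - 1) \<le> v) \<or> (p = 2 \<and> fib e \<le> v)"
proof -
  define Q where "Q i = r * p ^ i" for i
  have near_identity_ex: "\<exists>s b. near_identity (Q i) s b" for i
  proof (induction i)
    case 0 then show ?case using base by (auto simp: Q_def)
  next
    case (Suc i)
    have "Q (Suc i) = p * Q i" by (simp add: Q_def)
    then show ?case using near_identity_step Suc by (metis (no_types))
  qed
  have "\<exists>e. n dvd Q e"
  proof -
    have "n \<noteq> 0" "\<not> is_unit p" using n prime_p by auto
    then obtain k n0 where n0: "n = p ^ k * n0" "\<not> p dvd n0"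
      using multiplicity_decompose'[of n p] by metis
    let ?q = "Q k"
    have "n dvd ?q"
    proof (rule ccontr)
      assume "\<not> n dvd ?q"
      then obtain u where u: "u \<in> A" "u ?q \<noteq> u 0" using separated by blast
      obtain s0 b where N0: "near_identity ?q s0 b" using near_identity_ex by blast
      obtain s where N: "near_identity ?q s b" and "\<exists>u\<in>A. u ?q - u 0 \<notin> pw (Suc s)"
        by (rule near_identity_sharpen[OF N0 u])
      then obtain u where u: "u \<in> A" "u ?q - u 0 \<notin> pw (Suc s)" by blast
      have "n0 * Q k = n * r" unfolding Q_def n0(1) by (simp only: mult_ac)
      then have "n dvd n0 * Q k" by (metis dvd_triv_left)
      then have "u (n0 * ?q) - u 0 = 0" by (simp only: periodic[OF u(1)] diff_self)
      then have "of_nat n0 * (u ?q - u 0) \<in> pw (Suc s)"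
        using uminus_pw[OF near_identity_linear[OF N u(1), of n0]] by (simp only: diff_0 minus_minus)
      moreover have "of_nat n0 * (u ?q - u 0) \<notin> pw (Suc (0 + s))"
        using of_nat_notin_pw1[OF n0(2)] u val_A
        by (intro notin_pw_Suc_mult of_nat_R diff_R) (auto simp: One_nat_def)
      ultimately show False by simp
    qed
    then show ?thesis by blast
  qed
  define e where "e = (LEAST e. n dvd Q e)"
  have e: "n dvd Q e" and least: "\<And>i. i < e \<Longrightarrow> \<not> n dvd Q i"
    unfolding e_def using LeastI_ex[OF \<open>\<exists>e. n dvd Q e\<close>] not_less_Least by blast+
  have not_p_dominates: "\<not> p_dominates (Q i)" if "i \<le> e" for i
  proof
    assume st: "p_dominates (Q i)"
    have "p_dominates (Q (i + k))" for k
      by (induction k) (use st p_dominates_step in \<open>auto simp: Q_def mult.left_commute\<close>)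
    from this[of "e - i"] that have "p_dominates (Q e)" by simp
    then obtain u s where u: "u \<in> A" "u (Q e) - u 0 \<notin> pw (Suc s)" unfolding p_dominates_def by blast
    have "u (Q e) - u 0 = 0" by (simp only: periodic[OF u(1) e] diff_self)
    then show False using u(2) zero_pw by metis
  qed
  have bound: "min s (cexp * b) \<le> v" and next_near_identity:
    "near_identity (Q (Suc i)) (s + min s (cexp * b)) (min s (2 * b))"
    if N: "near_identity (Q i) s b" and i: "i < e" for i s b
  proof -
    obtain u where u: "u \<in> A" "u (Q i) \<noteq> u 0" using separated least[OF i] by blast
    obtain s' where s': "s \<le> s'" "near_identity (Q i) s' b" "\<exists>u\<in>A. u (Q i) - u 0 \<notin> pw (Suc s')"
      by (rule near_identity_sharpen[OF N u])
    have "\<not> (v < s' \<and> v < cexp * b)" using not_p_dominates[of i] i s' unfolding p_dominates_def by fastforce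
    then show v: "min s (cexp * b) \<le> v" using s'(1) by linarith
    have c_val: "1 \<le> cexp" by (simp add: cexp_def)
    have next_step: "near_identity (Q (Suc i)) (min (2 * s) (min (s + cexp * b) (s + v))) (min s (min (2 * b) (b + v)))"
      using near_identity_step[OF N] by (simp add: Q_def mult.left_commute)
    have A1: "\<forall>u\<in>A. u (Q (Suc i)) - u 0 \<in> pw (s + min s (cexp * b))"
      and A2: "\<forall>u\<in>A. (\<lambda>j. u (j + Q (Suc i)) - u j) \<in> flat (min s (2 * b))"
    proof -
      have *: "s + min s (cexp * b) \<le> min (2 * s) (min (s + cexp * b) (s + v))" using v by linarith
      have "b \<le> cexp * b" using c_val by simp
      then have **: "min s (2 * b) \<le> min s (min (2 * b) (b + v))" using v by linarith
      show "\<forall>u\<in>A. u (Q (Suc i)) - u 0 \<in> pw (s + min s (cexp * b))"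
        "\<forall>u\<in>A. (\<lambda>j. u (j + Q (Suc i)) - u j) \<in> flat (min s (2 * b))"
        using next_step pw_mono[OF _ *] flat_mono[OF _ **] unfolding near_identity_def by blast+
    qed
    have "1 \<le> s" "1 \<le> b" using N by (auto simp: near_identity_def)
    then show "near_identity (Q (Suc i)) (s + min s (cexp * b)) (min s (2 * b))"
      using A1 A2 c_val unfolding near_identity_def by auto
  qed
  have "e = 0 \<or> (p \<noteq> 2 \<and> 2 ^ (e - 1) \<le> v) \<or> (p = 2 \<and> fib e \<le> v)"
  proof (cases "p = 2")
    case True
    have c_val: "cexp = 1" unfolding cexp_def using True by simp
    have "i < e \<Longrightarrow> \<exists>s b. near_identity (Q i) s b \<and> fib (i + 2) \<le> s \<and> fib (i + 1) \<le> b" for i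
    proof (induction i)
      case 0 then show ?case using base by (auto simp: Q_def numeral_2_eq_2)
    next
      case (Suc i)
      then obtain s b where N: "near_identity (Q i) s b" and sb: "fib (i + 2) \<le> s" "fib (i + 1) \<le> b" by auto
      have f: "fib (i + 2) = fib (i + 1) + fib i" "fib (Suc i + 2) = fib (i + 2) + fib (i + 1)"
        by (simp_all add: One_nat_def)
      have g: "fib i \<le> fib (i + 1)" using fib_mono by simp
      have "fib (Suc i + 2) \<le> s + min s (cexp * b)" "fib (Suc i + 1) \<le> min s (2 * b)"
        using sb f g c_val by (auto simp: One_nat_def)
      moreover have "near_identity (Q (Suc i)) (s + min s (cexp * b)) (min s (2 * b))"
        using next_near_identity[OF N] Suc.prems by simp
      ultimately show ?case by blast
    qed
    note IH = this
    show ?thesis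
    proof (cases e)
      case (Suc k)
      then obtain s b where N: "near_identity (Q k) s b" and sb: "fib (k + 2) \<le> s" "fib (k + 1) \<le> b"
        using IH[of k] by auto
      have "fib (k + 1) \<le> fib (k + 2)" by (rule fib_mono) simp
      moreover have "min s b \<le> v" using bound[OF N] Suc c_val by simp
      ultimately have "fib (k + 1) \<le> v" using sb by linarith
      then show ?thesis using True Suc by (simp add: One_nat_def)
    qed simp
  next
    case False
    have c_val: "cexp = 2" by (simp add: cexp_def False)
    have "i < e \<Longrightarrow> \<exists>s b. near_identity (Q i) s b \<and> 2 ^ i \<le> s \<and> 2 ^ i \<le> 2 * b" for i
    proof (induction i)
      case 0 then show ?case using base by (intro exI[of _ 1]) (simp add: Q_def)
    next
      case (Suc i)
      then obtain s b where N: "near_identity (Q i) s b" and sb: "2 ^ i \<le> s" "2 ^ i \<le> 2 * b" by auto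
      have "2 ^ Suc i \<le> s + min s (cexp * b)" "2 ^ Suc i \<le> 2 * min s (2 * b)"
        using sb c_val by auto
      moreover have "near_identity (Q (Suc i)) (s + min s (cexp * b)) (min s (2 * b))"
        using next_near_identity[OF N] Suc.prems by simp
      ultimately show ?case by blast
    qed
    note IH = this
    show ?thesis
    proof (cases e)
      case (Suc k)
      then obtain s b where N: "near_identity (Q k) s b" and sb: "2 ^ k \<le> s" "2 ^ k \<le> 2 * b"
        using IH[of k] by auto
      have "min s (2 * b) \<le> v" using bound[OF N] Suc c_val by simp
      then have "2 ^ k \<le> v" using sb by linarith
      then show ?thesis using False Suc by simp
    qed simp
  qed
  then show thesis using that e Q_def by auto
qed

lemma shift_flat1: "u \<in> flat 1 \<Longrightarrow> (\<lambda>j. u (j + q)) \<in> flat 1"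
  using shift_flat[of q 1 1 u] cong_A by blast
end

section \<open>The action on the cotangent space\<close>

lemma finite_GL_mat: "finite (UNIV :: 'k::field set) \<Longrightarrow> finite (GL_mat m :: 'k mat set)"
proof -
  assume fin: "finite (UNIV :: 'k set)"
  have "(GL_mat m :: 'k mat set) \<subseteq> (\<lambda>f. mat m m f) ` (({0..<m} \<times> {0..<m}) \<rightarrow>\<^sub>E UNIV)"
  proof
    fix B :: "'k mat" assume "B \<in> GL_mat m"
    then have B: "B \<in> carrier_mat m m" by (simp add: GL_mat_def)
    let ?f = "restrict (\<lambda>ij. B $$ ij) ({0..<m} \<times> {0..<m})"
    have "B = mat m m ?f" using B by (intro eq_matI) auto
    moreover have "?f \<in> ({0..<m} \<times> {0..<m}) \<rightarrow>\<^sub>E UNIV" by simp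
    ultimately show "B \<in> (\<lambda>f. mat m m f) ` (({0..<m} \<times> {0..<m}) \<rightarrow>\<^sub>E UNIV)"
      by (rule image_eqI)
  qed
  then show ?thesis using fin by (meson finite_PiE finite_SigmaI finite_atLeastLessThan finite_imageI finite_subset)
qed

locale residue_map = uniformized +
  fixes red :: "'a \<Rightarrow> 'k::field"
  assumes red_add: "x \<in> R \<Longrightarrow> y \<in> R \<Longrightarrow> red (x + y) = red x + red y"
    and red_mult: "x \<in> R \<Longrightarrow> y \<in> R \<Longrightarrow> red (x * y) = red x * red y"
    and red_one: "red 1 = 1"
    and red_eq_0_iff: "x \<in> R \<Longrightarrow> red x = 0 \<longleftrightarrow> x \<in> pw 1"
begin
lemma red_zero: "red 0 = 0" using red_eq_0_iff[OF zero_R] zero_pw by simp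
lemma red_uminus: "x \<in> R \<Longrightarrow> red (- x) = - red x"
  using red_add[of x "- x"] uminus_R red_zero by (simp add: eq_neg_iff_add_eq_0 add.commute)
lemma red_diff: "x \<in> R \<Longrightarrow> y \<in> R \<Longrightarrow> red (x - y) = red x - red y"
  using red_add[of x "- y"] red_uminus[of y] uminus_R[of y] by simp
lemma red_eq_iff: "x \<in> R \<Longrightarrow> y \<in> R \<Longrightarrow> red x = red y \<longleftrightarrow> x - y \<in> pw 1"
  using red_diff[of x y] red_eq_0_iff[OF diff_R, of x y] by auto
lemma red_sum: "(\<And>i. i \<in> S \<Longrightarrow> g i \<in> R) \<Longrightarrow> red (sum g S) = (\<Sum>i\<in>S. red (g i))"
  by (induction S rule: infinite_finite_induct) (auto simp: red_zero red_add sum_R)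
end

text \<open>The coordinate sequences of an orbit in one residue class; \<open>gen\<close> is the ring of sequences that
  they generate over the local ring, including inverses of units: the functions on the orbit that
  are regular at its reduction.\<close>
locale coordinate_sequences = uniformized +
  fixes x :: "nat \<Rightarrow> nat \<Rightarrow> 'a" and N :: nat
  assumes x_R: "i \<le> N \<Longrightarrow> x i j \<in> R"
    and x_cong: "i \<le> N \<Longrightarrow> x i j - x i 0 \<in> pw 1"
begin

inductive_set gen :: "(nat \<Rightarrow> 'a) set" where
  gen_const: "c \<in> R \<Longrightarrow> (\<lambda>_. c) \<in> gen"
| gen_coord: "i \<le> N \<Longrightarrow> x i \<in> gen"
| gen_add: "u \<in> gen \<Longrightarrow> w \<in> gen \<Longrightarrow> (\<lambda>j. u j + w j) \<in> gen"
| gen_mult: "u \<in> gen \<Longrightarrow> w \<in> gen \<Longrightarrow> (\<lambda>j. u j * w j) \<in> gen"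
| gen_inverse: "u \<in> gen \<Longrightarrow> u 0 \<notin> pw 1 \<Longrightarrow> (\<lambda>j. inverse (u j)) \<in> gen"

lemma notin_pw1_cong: "a - b \<in> pw 1 \<Longrightarrow> b \<notin> pw 1 \<Longrightarrow> a \<notin> pw 1"
  using diff_pw[of a 1 "a - b"] by auto

lemma gen_R_cong: "u \<in> gen \<Longrightarrow> (\<forall>j. u j \<in> R) \<and> (\<forall>j. u j - u 0 \<in> pw 1)"
proof (induction rule: gen.induct)
  case (gen_add u w)
  have "(u j + w j) - (u 0 + w 0) \<in> pw 1" for j
    using add_pw[of "u j - u 0" 1 "w j - w 0"] gen_add by (simp add: algebra_simps)
  then show ?case using gen_add add_R by blast
next
  case (gen_mult u w)
  have "u j * w j - u 0 * w 0 = (u j - u 0) * w j + u 0 * (w j - w 0)" for j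
    by (simp add: algebra_simps)
  then have "u j * w j - u 0 * w 0 \<in> pw 1" for j
    using gen_mult by (simp add: add_pw mult_pw_left mult_pw_right)
  then show ?case using gen_mult mult_R by blast
next
  case (gen_inverse u)
  have n: "u j \<notin> pw 1" for j using gen_inverse notin_pw1_cong by blast
  have iR: "inverse (u j) \<in> R" for j using n gen_inverse unit_if_notin_pw1 by blast
  have nz: "u j \<noteq> 0" for j using n[of j] zero_pw by auto
  have "inverse (u j) - inverse (u 0) = - (u j - u 0) * (inverse (u j) * inverse (u 0))" for j
    using nz[of j] nz[of 0] by (simp add: field_simps)
  then have "inverse (u j) - inverse (u 0) \<in> pw 1" for j
    using gen_inverse iR by (simp only:) (intro mult_pw_right uminus_pw mult_R, auto)
  then show ?case using iR by blast
qed (auto simp: zero_pw x_R x_cong)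

lemma gen_R: "u \<in> gen \<Longrightarrow> u j \<in> R" and gen_cong: "u \<in> gen \<Longrightarrow> u j - u 0 \<in> pw 1"
  using gen_R_cong by blast+

lemma gen_diff: "u \<in> gen \<Longrightarrow> w \<in> gen \<Longrightarrow> (\<lambda>j. u j - w j) \<in> gen"
  using gen_add[OF _ gen_mult[OF gen_const[of "-1"], of w], of u] one_R uminus_R by simp
lemma gen_sum: "(\<And>i. i \<in> S \<Longrightarrow> g i \<in> gen) \<Longrightarrow> (\<lambda>j. \<Sum>i\<in>S. g i j) \<in> gen"
  by (induction S rule: infinite_finite_induct) (auto intro: gen_const zero_R gen_add)
lemma gen_prod: "(\<And>i. i \<in> S \<Longrightarrow> g i \<in> gen) \<Longrightarrow> (\<lambda>j. \<Prod>i\<in>S. g i j) \<in> gen"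
  by (induction S rule: infinite_finite_induct) (auto intro: gen_const one_R gen_mult)
lemma gen_power: "u \<in> gen \<Longrightarrow> (\<lambda>j. u j ^ k) \<in> gen"
  by (induction k) (auto intro: gen_const one_R gen_mult)

end

lemma affine_diff: "a = b + c * d \<Longrightarrow> s = c * t \<Longrightarrow> a - s = b + c * (d - t)" for a :: "'b::comm_ring"
  by (simp add: algebra_simps)

text \<open>Invariance of the ring under the shift expresses that the map generating the orbit is regular
  at the reduction of the orbit.\<close>
locale shifted_coordinates = coordinate_sequences +
  fixes n :: nat
  assumes gen_shift: "u \<in> gen \<Longrightarrow> (\<lambda>j. u (Suc j)) \<in> gen"
    and n_pos: "n \<ge> 1" and x_periodic: "i \<le> N \<Longrightarrow> x i (j + n) = x i j"
begin

sublocale sequence_ring R \<pi> p v gen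
  by unfold_locales (auto intro: gen.intros gen_diff gen_R gen_cong gen_shift)

lemma gen_periodic: "u \<in> gen \<Longrightarrow> u (j + n) = u j"
  by (induction rule: gen.induct) (auto simp: x_periodic)
lemma gen_periodic_mult: "u \<in> gen \<Longrightarrow> u (j + k * n) = u j"
  using gen_periodic[of u] by (induction k) (auto simp: algebra_simps, metis add.assoc add.commute)

text \<open>The cotangent space, as a vector space over the residue field, is the quotient of \<open>gen\<close> by
  \<open>flat 1\<close>; linear algebra in it is done with coefficients in \<open>R\<close>.\<close>
definition spans :: "nat set \<Rightarrow> bool" where
  "spans S \<longleftrightarrow> (\<forall>u\<in>gen. \<exists>c. (\<forall>i. c i \<in> R) \<and> (\<lambda>j. u j - (\<Sum>i\<in>S. c i * x i j)) \<in> flat 1)"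

text \<open>The cotangent space is spanned by the coordinates, by the product rule and the rule for
  \<open>1/u\<close>: up to constants and terms of second order, \<open>u w \<equiv> w(0) u + u(0) w\<close> and
  \<open>1/u \<equiv> - u / u(0)\<^sup>2\<close>.\<close>
lemma spans_all: "spans {..N}"
  unfolding spans_def
proof
  fix u assume "u \<in> gen"
  then show "\<exists>c. (\<forall>i. c i \<in> R) \<and> (\<lambda>j. u j - (\<Sum>i\<le>N. c i * x i j)) \<in> flat 1"
  proof (induction rule: gen.induct)
    case (gen_const c)
    then show ?case by (intro exI[of _ "\<lambda>_. 0"]) (auto intro: zero_R const_flat)
  next
    case (gen_coord i)
    have "(\<Sum>l\<le>N. (if l = i then 1 else 0) * x l j) = x i j" for j
      using gen_coord by (simp add: if_distrib[of "\<lambda>t. t * _"] sum.delta cong: if_cong)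
    then show ?case
      by (intro exI[of _ "\<lambda>l. if l = i then 1 else 0"]) (auto intro: zero_R one_R const_flat)
  next
    case (gen_add u w)
    then obtain c c' where c: "\<forall>i. c i \<in> R" "(\<lambda>j. u j - (\<Sum>i\<le>N. c i * x i j)) \<in> flat 1"
      "\<forall>i. c' i \<in> R" "(\<lambda>j. w j - (\<Sum>i\<le>N. c' i * x i j)) \<in> flat 1" by blast
    have "(\<lambda>j. u j + w j - (\<Sum>i\<le>N. (c i + c' i) * x i j)) \<in> flat 1"
      using add_flat[OF c(2,4)] by (simp add: algebra_simps sum.distrib)
    then show ?case using c(1,3) add_R by (intro exI[of _ "\<lambda>i. c i + c' i"]) auto
  next
    case (gen_mult u w)
    then obtain c c' where c: "\<forall>i. c i \<in> R" "(\<lambda>j. u j - (\<Sum>i\<le>N. c i * x i j)) \<in> flat 1"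
      "\<forall>i. c' i \<in> R" "(\<lambda>j. w j - (\<Sum>i\<le>N. c' i * x i j)) \<in> flat 1" by blast
    have uw: "u 0 \<in> R" "w 0 \<in> R" using gen_mult gen_R by auto
    let ?u = "\<lambda>j. u (j + 0) - u 0" and ?w = "\<lambda>j. w (j + 0) - w 0"
    have "(\<lambda>j. ?u j * ?w j) \<in> flat 1" using gen_mult
      by (intro van2_flat mult_van2 shift_van)
    then have "(\<lambda>j. (?u j * ?w j + (- (u 0 * w 0))) + (w 0 * (u j - (\<Sum>i\<le>N. c i * x i j)) +
        u 0 * (w j - (\<Sum>i\<le>N. c' i * x i j)))) \<in> flat 1"
      by (intro add_flat scale_flat c const_flat uw uminus_R mult_R)
    moreover have "u j * w j - (\<Sum>i\<le>N. (w 0 * c i + u 0 * c' i) * x i j) =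
      (?u j * ?w j + (- (u 0 * w 0))) + (w 0 * (u j - (\<Sum>i\<le>N. c i * x i j)) +
        u 0 * (w j - (\<Sum>i\<le>N. c' i * x i j)))" for j
      by (simp add: algebra_simps sum.distrib sum_distrib_left)
    ultimately have "(\<lambda>j. u j * w j - (\<Sum>i\<le>N. (w 0 * c i + u 0 * c' i) * x i j)) \<in> flat 1" by simp
    then show ?case using c(1,3) uw
      by (intro exI[of _ "\<lambda>i. w 0 * c i + u 0 * c' i"]) (auto intro: add_R mult_R)
  next
    case (gen_inverse u)
    then obtain c where c: "\<forall>i. c i \<in> R" "(\<lambda>j. u j - (\<Sum>i\<le>N. c i * x i j)) \<in> flat 1" by blast
    have n: "u j \<notin> pw 1" for j using gen_inverse notin_pw1_cong gen_cong by blast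
    have nz: "u j \<noteq> 0" for j using n[of j] zero_pw by auto
    define h where "h = inverse (u 0)"
    have h: "h \<in> R" unfolding h_def using gen_inverse gen_R unit_if_notin_pw1 by blast
    let ?u = "\<lambda>j. u (j + 0) - u 0" and ?w = "\<lambda>j. inverse (u (j + 0)) - h"
    have "?w \<in> van" unfolding h_def using shift_van[OF gen.gen_inverse, of u 0] gen_inverse by simp
    then have uw: "(\<lambda>j. (- h) * (?u j * ?w j)) \<in> flat 1"
      using shift_van[of u 0] gen_inverse h by (intro scale_flat van2_flat mult_van2 uminus_R) auto
    then have *: "(\<lambda>j. (2 * h + (- h) * (?u j * ?w j)) + (- (h * h)) * (u j - (\<Sum>i\<le>N. c i * x i j))) \<in> flat 1"
      using of_nat_R[of 2] h
      by (intro add_flat[OF add_flat[OF const_flat uw] scale_flat[OF c(2)]] uminus_R mult_R) auto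
    have "inverse (u j) - (\<Sum>i\<le>N. (- (h * h) * c i) * x i j) =
      (2 * h + (- h) * (?u j * ?w j)) + (- (h * h)) * (u j - (\<Sum>i\<le>N. c i * x i j))" for j
    proof -
      \<comment> \<open>The product of the vanishing functions \<open>u - u(0)\<close> and \<open>1/u - h\<close> is of second order.\<close>
      have "inverse (u j) = (2 * h + (- h) * (?u j * ?w j)) + (- (h * h)) * u j"
        using nz[of 0] nz[of j] by (simp add: h_def field_simps)
      moreover have "(\<Sum>i\<le>N. (- (h * h) * c i) * x i j) = (- (h * h)) * (\<Sum>i\<le>N. c i * x i j)"
        by (simp only: sum_distrib_left mult.assoc)
      ultimately show ?thesis by (rule affine_diff)
    qed
    with * have "(\<lambda>j. inverse (u j) - (\<Sum>i\<le>N. (- (h * h) * c i) * x i j)) \<in> flat 1"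
      by presburger
    then show ?case using c(1) h
      by (intro exI[of _ "\<lambda>i. - (h * h) * c i"]) (auto intro: uminus_R mult_R)
  qed
qed

definition indep :: "nat set \<Rightarrow> bool" where
  "indep S \<longleftrightarrow> (\<forall>c. (\<forall>i. c i \<in> R) \<longrightarrow> (\<lambda>j. \<Sum>i\<in>S. c i * x i j) \<in> flat 1 \<longrightarrow> (\<forall>i\<in>S. c i \<in> pw 1))"

text \<open>A spanning set of coordinates of least cardinality is a basis: an index whose coefficient in a
  relation is a unit could be dropped.\<close>
lemma obtain_basis:
  obtains S where "S \<subseteq> {..N}" "spans S" "indep S"
proof -
  define P where "P k \<longleftrightarrow> (\<exists>S\<subseteq>{..N}. spans S \<and> card S = k)" for k
  have "\<exists>k. P k" unfolding P_def using spans_all by blast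
  then obtain S where S: "S \<subseteq> {..N}" "spans S" "card S = (LEAST k. P k)"
    using LeastI_ex[of P] unfolding P_def by blast
  have fin: "finite S" using S(1) finite_subset by blast
  have "\<forall>i\<in>S. c i \<in> pw 1"
    if c: "\<And>i. c i \<in> R" and e: "(\<lambda>j. \<Sum>i\<in>S. c i * x i j) \<in> flat 1" for c
  proof (rule ccontr)
    assume "\<not> ?thesis"
    then obtain l where l: "l \<in> S" "c l \<notin> pw 1" by blast
    define h where "h = inverse (c l)"
    have "c l \<noteq> 0" using l zero_pw by auto
    then have h: "h \<in> R" "h * c l = 1" unfolding h_def using l c unit_if_notin_pw1 by auto
    have "spans (S - {l})" unfolding spans_def
    proof
      fix u assume "u \<in> gen"
      then obtain a where a: "\<And>i. a i \<in> R" "(\<lambda>j. u j - (\<Sum>i\<in>S. a i * x i j)) \<in> flat 1"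
        using S(2) unfolding spans_def by blast
      have "(\<lambda>j. (u j - (\<Sum>i\<in>S. a i * x i j)) + (a l * h) * (\<Sum>i\<in>S. c i * x i j)) \<in> flat 1"
        by (intro add_flat scale_flat a e mult_R h)
      moreover have "(u j - (\<Sum>i\<in>S. a i * x i j)) + (a l * h) * (\<Sum>i\<in>S. c i * x i j) =
         u j - (\<Sum>i\<in>S - {l}. (a i - a l * h * c i) * x i j)" for j
      proof -
        have "(\<Sum>i\<in>S. (a i - a l * h * c i) * x i j) =
          (a l - a l * (h * c l)) * x l j + (\<Sum>i\<in>S - {l}. (a i - a l * h * c i) * x i j)"
          by (subst sum.remove[OF fin l(1)]) (simp add: mult.assoc)
        then show ?thesis by (simp add: h sum_distrib_left sum_subtractf algebra_simps)
      qed
      ultimately have "(\<lambda>j. u j - (\<Sum>i\<in>S - {l}. (a i - a l * h * c i) * x i j)) \<in> flat 1" by simp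
      then show "\<exists>c. (\<forall>i. c i \<in> R) \<and> (\<lambda>j. u j - (\<Sum>i\<in>S - {l}. c i * x i j)) \<in> flat 1"
        using a(1) h c by (intro exI[of _ "\<lambda>i. a i - a l * h * c i"]) (auto intro: diff_R mult_R)
    qed
    then have "P (card (S - {l}))" unfolding P_def using S(1) by blast
    moreover have "card (S - {l}) < card S" using card_Diff1_less[OF fin l(1)] .
    ultimately show False using S(3) not_less_Least by auto
  qed
  then have "indep S" unfolding indep_def by blast
  with S that show thesis by blast
qed

end

locale shifted_coordinates_residue = shifted_coordinates R \<pi> p v x N n + residue_map R \<pi> p v red
  for R :: "'a::field_char_0 set" and \<pi> :: 'a and p v :: nat and x :: "nat \<Rightarrow> nat \<Rightarrow> 'a"
    and N n :: nat and red :: "'a \<Rightarrow> 'k::field"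
begin

text \<open>Each power of the shift is described, in a basis of coordinates, by an invertible matrix over
  the residue field, extended by the identity to the remaining indices below \<open>m\<close>. It is invertible
  because the shift has finite order. Two of the first \<open>#GL\<^sub>m + 1\<close> powers have equal matrices, and
  their quotient acts trivially.\<close>
lemma cotangent_order:
  assumes fin: "finite (UNIV :: 'k set)" and m: "N < m"
  obtains r where "1 \<le> r" "r \<le> card (GL_mat m :: 'k mat set)" "near_identity r 1 1"
proof -
  obtain S where S: "S \<subseteq> {..N}" "spans S" and S_indep: "indep S"
    by (rule obtain_basis)
  have Sm: "S \<subseteq> {0..<m}" using S(1) m by auto
  have finS: "finite S" using S(1) finite_subset by blast
  have xg: "i \<in> S \<Longrightarrow> x i \<in> gen" for i using S(1) gen_coord by auto
  define good where "good r i c \<longleftrightarrow> (\<forall>l. c l \<in> R) \<and>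
    (\<lambda>j. x i (j + r) - (\<Sum>l\<in>S. c l * x l j)) \<in> flat 1" for r i c
  have good_ex: "\<exists>c. good r i c" if "i \<in> S" for r i
    unfolding good_def using S(2)[unfolded spans_def] shift_A[OF xg[OF that], of r] by (rule bspec)
  define co where "co r i = (SOME c. good r i c)" for r i
  have co_good: "good r i (co r i)" if "i \<in> S" for r i
    unfolding co_def using good_ex[OF that] by (rule someI_ex)
  then have co: "\<And>r i l. i \<in> S \<Longrightarrow> co r i l \<in> R"
    "\<And>r i. i \<in> S \<Longrightarrow> (\<lambda>j. x i (j + r) - (\<Sum>l\<in>S. co r i l * x l j)) \<in> flat 1"
    unfolding good_def by blast+
  define Mt where "Mt r = mat m m (\<lambda>(i, l). if i \<in> S \<and> l \<in> S then red (co r i l)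
     else if i = l then 1 else 0)" for r
  have Mt_carrier: "Mt r \<in> carrier_mat m m" for r by (simp add: Mt_def)
  have unique: "red (co r i h) = red (d h)"
    if i: "i \<in> S" and h: "h \<in> S" and d: "\<And>l. d l \<in> R"
      and e: "(\<lambda>j. x i (j + r) - (\<Sum>l\<in>S. d l * x l j)) \<in> flat 1" for r i h d
  proof -
    have "(\<lambda>j. \<Sum>l\<in>S. (co r i l - d l) * x l j) \<in> flat 1"
      using diff_flat[OF e co(2)[OF i, of r]] by (simp add: sum_subtractf algebra_simps)
    moreover have "\<forall>l. co r i l - d l \<in> R" using co(1)[OF i] d diff_R by blast
    ultimately have "co r i h - d h \<in> pw 1" using S_indep h unfolding indep_def by fast
    then show ?thesis using red_eq_iff co(1)[OF i] d by blast
  qed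
  have Mt_id: "Mt r = 1\<^sub>m m" if "\<And>i j. i \<in> S \<Longrightarrow> x i (j + r) = x i j" for r
  proof (rule eq_matI)
    fix i l assume il: "i < dim_row (1\<^sub>m m :: 'k mat)" "l < dim_col (1\<^sub>m m :: 'k mat)"
    have "red (co r i l) = (if i = l then 1 else 0)" if "i \<in> S" "l \<in> S"
    proof -
      have "(\<Sum>h\<in>S. (if i = h then 1 else 0) * x h j) = x i j" for j
        using that finS by (simp add: if_distrib[of "\<lambda>t. t * _"] sum.delta cong: if_cong)
      then have "red (co r i l) = red (if i = l then 1 else 0)"
        using that \<open>\<And>i j. i \<in> S \<Longrightarrow> x i (j + r) = x i j\<close>
        by (intro unique[where d = "\<lambda>h. if i = h then 1 else 0"]) (auto simp: one_R zero_R const_flat)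
      then show ?thesis by (simp add: red_one red_zero)
    qed
    then show "Mt r $$ (i, l) = 1\<^sub>m m $$ (i, l)" using il by (auto simp: Mt_def)
  qed (auto simp: Mt_def)
  have Mt_mult: "Mt (r + r') = Mt r * Mt r'" for r r'
  proof (rule eq_matI)
    fix i h assume "i < dim_row (Mt r * Mt r')" "h < dim_col (Mt r * Mt r')"
    then have ih: "i < m" "h < m" by (auto simp: Mt_def)
    have "(Mt r * Mt r') $$ (i, h) = (\<Sum>l\<in>{0..<m}. Mt r $$ (i, l) * Mt r' $$ (l, h))"
      using ih Mt_carrier by (simp add: times_mat_def scalar_prod_def Mt_def)
    also have "\<dots> = Mt (r + r') $$ (i, h)"
    proof (cases "i \<in> S")
      case False
      have "(\<Sum>l\<in>{0..<m}. Mt r $$ (i, l) * Mt r' $$ (l, h)) = (\<Sum>l\<in>{0..<m}. if i = l then Mt r' $$ (i, h) else 0)"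
        by (intro sum.cong) (use False ih in \<open>auto simp: Mt_def\<close>)
      then show ?thesis using ih False by (simp add: Mt_def)
    next
      case True
      have "(\<Sum>l\<in>{0..<m}. Mt r $$ (i, l) * Mt r' $$ (l, h)) = (\<Sum>l\<in>S. Mt r $$ (i, l) * Mt r' $$ (l, h))"
        by (rule sum.mono_neutral_right) (use Sm True ih in \<open>auto simp: Mt_def\<close>)
      also have "\<dots> = Mt (r + r') $$ (i, h)"
      proof (cases "h \<in> S")
        case False
        then have "(\<Sum>l\<in>S. Mt r $$ (i, l) * Mt r' $$ (l, h)) = 0"
        proof (intro sum.neutral ballI)
          fix l assume "l \<in> S"
          then have "Mt r' $$ (l, h) = 0" using False subsetD[OF Sm, of l] ih by (auto simp: Mt_def)
          then show "Mt r $$ (i, l) * Mt r' $$ (l, h) = 0" by simp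
        qed
        then show ?thesis using False True ih by (auto simp: Mt_def)
      next
        case h: True
        let ?d = "\<lambda>g. \<Sum>l\<in>S. co r i l * co r' l g"
        have "(\<lambda>j. x i (j + r' + r) - (\<Sum>l\<in>S. co r i l * x l (j + r'))) \<in> flat 1"
          using shift_flat1[OF co(2)[OF True, of r], of r'] .
        moreover have "(\<lambda>j. \<Sum>l\<in>S. co r i l * (x l (j + r') - (\<Sum>g\<in>S. co r' l g * x g j))) \<in> flat 1"
          by (intro sum_flat scale_flat co True)
        ultimately have "(\<lambda>j. (x i (j + r' + r) - (\<Sum>l\<in>S. co r i l * x l (j + r'))) +
          (\<Sum>l\<in>S. co r i l * (x l (j + r') - (\<Sum>g\<in>S. co r' l g * x g j)))) \<in> flat 1"
          by (rule add_flat)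
        moreover have "(x i (j + r' + r) - (\<Sum>l\<in>S. co r i l * x l (j + r'))) +
          (\<Sum>l\<in>S. co r i l * (x l (j + r') - (\<Sum>g\<in>S. co r' l g * x g j))) =
          x i (j + (r + r')) - (\<Sum>g\<in>S. ?d g * x g j)" for j
        proof -
          have "(\<Sum>g\<in>S. ?d g * x g j) = (\<Sum>l\<in>S. co r i l * (\<Sum>g\<in>S. co r' l g * x g j))"
            unfolding sum_distrib_left sum_distrib_right by (subst sum.swap) (simp add: mult.assoc)
          then show ?thesis by (simp add: right_diff_distrib sum_subtractf add_ac)
        qed
        ultimately have "(\<lambda>j. x i (j + (r + r')) - (\<Sum>g\<in>S. ?d g * x g j)) \<in> flat 1" by simp
        then have "red (co (r + r') i h) = red (?d h)"
          using True h co(1) by (intro unique) (auto intro!: sum_R mult_R)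
        also have "\<dots> = (\<Sum>l\<in>S. red (co r i l) * red (co r' l h))"
          using co(1) True by (subst red_sum) (auto simp: red_mult mult_R)
        finally show ?thesis using h True ih Sm by (auto simp: Mt_def intro!: sum.cong)
      qed
      finally show ?thesis .
    qed
    finally show "Mt (r + r') $$ (i, h) = (Mt r * Mt r') $$ (i, h)" by simp
  qed (auto simp: Mt_def)
  have periodic: "x i (j + k * n) = x i j" if "i \<in> S" for i j k
    using gen_periodic_mult[OF xg[OF that]] .
  have Mt_GL: "Mt r \<in> GL_mat m" for r
  proof -
    \<comment> \<open>The shift by \<open>(n - 1) r\<close> inverts the shift by \<open>r\<close>.\<close>
    have "r + (n - 1) * r = r * n" using n_pos by (cases n) auto
    then have "Mt r * Mt ((n - 1) * r) = 1\<^sub>m m" "Mt ((n - 1) * r) * Mt r = 1\<^sub>m m"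
      using Mt_id[of "r * n"] periodic by (auto simp: Mt_mult[symmetric] add.commute)
    then show ?thesis using Mt_carrier[of r] Mt_carrier[of "(n - 1) * r"]
      unfolding GL_mat_def invertible_mat_def inverts_mat_def by (auto simp: square_mat.simps)
  qed
  let ?c = "card (GL_mat m :: 'k mat set)"
  have "\<not> inj_on Mt {0..?c}"
  proof
    assume "inj_on Mt {0..?c}"
    moreover have "Mt ` {0..?c} \<subseteq> GL_mat m" using Mt_GL by auto
    ultimately have "card {0..?c} \<le> ?c" by (intro card_inj_on_le finite_GL_mat fin)
    then show False by simp
  qed
  then obtain r1 r2 where r: "r1 < r2" "r2 \<le> ?c" "Mt r1 = Mt r2"
    unfolding inj_on_def by (metis atLeastAtMost_iff linorder_neqE_nat)
  let ?r = "r2 - r1"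
  have xr: "(\<lambda>j. x i (j + ?r) - x i j) \<in> flat 1" if i: "i \<in> S" for i
  proof -
    have "co r2 i l - co r1 i l \<in> pw 1" if l: "l \<in> S" for l
    proof -
      have "Mt r1 $$ (i, l) = Mt r2 $$ (i, l)" using r by simp
      then have "red (co r2 i l) = red (co r1 i l)"
        using i l subsetD[OF Sm i] subsetD[OF Sm l] by (simp add: Mt_def)
      then show ?thesis using red_eq_iff co(1)[OF i] by blast
    qed
    then have "(\<lambda>j. (x i (j + r2) - (\<Sum>l\<in>S. co r2 i l * x l j)) -
      (x i (j + r1) - (\<Sum>l\<in>S. co r1 i l * x l j)) + (\<Sum>l\<in>S. (co r2 i l - co r1 i l) * x l j)) \<in> flat 1"
      by (intro add_flat diff_flat sum_flat pw_scale_flat co i xg) auto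
    then have "(\<lambda>j. x i (j + r2) - x i (j + r1)) \<in> flat 1"
      by (simp add: sum_subtractf algebra_simps)
    \<comment> \<open>A further shift by \<open>(n - 1) r1\<close> completes \<open>r1\<close> to a multiple of the period.\<close>
    from shift_flat1[OF this, of "(n - 1) * r1"]
    have "(\<lambda>j. x i (j + (n - 1) * r1 + r2) - x i (j + (n - 1) * r1 + r1)) \<in> flat 1" .
    moreover have "j + (n - 1) * r1 + r1 = j + r1 * n" "j + (n - 1) * r1 + r2 = j + ?r + r1 * n" for j
      using n_pos r(1) by (cases n; simp)+
    ultimately show ?thesis using periodic[OF i] by simp
  qed
  have "(\<lambda>j. u (j + ?r) - u j) \<in> flat 1" if "u \<in> gen" for u
  proof -
    obtain c where c: "\<And>i. c i \<in> R" "(\<lambda>j. u j - (\<Sum>i\<in>S. c i * x i j)) \<in> flat 1"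
      using S(2) \<open>u \<in> gen\<close> unfolding spans_def by blast
    have "(\<lambda>j. (u (j + ?r) - (\<Sum>i\<in>S. c i * x i (j + ?r))) - (u j - (\<Sum>i\<in>S. c i * x i j)) +
      (\<Sum>i\<in>S. c i * (x i (j + ?r) - x i j))) \<in> flat 1"
      using xr c(1)
      by (intro add_flat[OF diff_flat[OF shift_flat1[OF c(2), of ?r] c(2)]] sum_flat scale_flat) auto
    then show ?thesis by (simp add: sum_subtractf algebra_simps)
  qed
  then have "near_identity ?r 1 1" unfolding near_identity_def using gen_cong by auto
  moreover have "1 \<le> ?r" "?r \<le> ?c" using r by auto
  ultimately show thesis using that by blast
qed

theorem period_le:
  assumes fin: "finite (UNIV :: 'k set)" and m: "N < m"
    and separated: "\<And>q. \<not> n dvd q \<Longrightarrow> \<exists>i\<le>N. x i q \<noteq> x i 0"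
  obtains e where "n \<le> card (GL_mat m :: 'k mat set) * p ^ e"
    "e = 0 \<or> (p \<noteq> 2 \<and> 2 ^ (e - 1) \<le> v) \<or> (p = 2 \<and> fib e \<le> v)"
proof -
  obtain r where r: "1 \<le> r" "r \<le> card (GL_mat m :: 'k mat set)" "near_identity r 1 1"
    using cotangent_order[OF fin m] by metis
  have per: "u q = u 0" if "u \<in> gen" "n dvd q" for u q
    using that gen_periodic_mult[of u 0] by (auto elim!: dvdE simp: mult.commute)
  have sep: "\<exists>u\<in>gen. u q \<noteq> u 0" if "\<not> n dvd q" for q
    using separated[OF that] gen_coord by blast
  obtain e where e: "n dvd r * p ^ e" "e = 0 \<or> (p \<noteq> 2 \<and> 2 ^ (e - 1) \<le> v) \<or> (p = 2 \<and> fib e \<le> v)"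
    by (rule period_bound[OF n_pos per sep r(3)])
  have "n \<le> r * p ^ e" using e(1) r(1) prime_p by (intro dvd_imp_le) (auto simp: prime_gt_0_nat)
  also have "\<dots> \<le> card (GL_mat m :: 'k mat set) * p ^ e" using r(2) by simp
  finally show thesis using that e(2) by blast
qed

end

section \<open>The local ring at a prime of a number field\<close>

text \<open>Here \<open>n\<close> is the size of a spanning set, so that \<open>n + 1\<close> elements are dependent.\<close>
lemma rational_relation:
  assumes "number_field TYPE('a::field_char_0)"
  obtains n :: nat where "\<And>x :: nat \<Rightarrow> 'a. \<exists>q :: nat \<Rightarrow> rat. (\<exists>i\<le>n. q i \<noteq> 0) \<and> (\<Sum>i\<le>n. of_rat (q i) * x i) = 0"
proof -
  interpret V: vector_space "\<lambda>(q::rat) (x::'a). of_rat q * x"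
    by unfold_locales (auto simp: algebra_simps of_rat_add of_rat_mult)
  obtain B :: "'a set" where B: "finite B" "V.span B = UNIV"
    using assms unfolding number_field_def by blast
  have "\<exists>q :: nat \<Rightarrow> rat. (\<exists>i\<le>card B. q i \<noteq> 0) \<and> (\<Sum>i\<le>card B. of_rat (q i) * x i) = 0" for x :: "nat \<Rightarrow> 'a"
  proof (cases "inj_on x {..card B}")
    case True
    have "card (x ` {..card B}) = card B + 1" using card_image[OF True] by simp
    then have "V.dependent (x ` {..card B})"
      using V.independent_span_bound[OF B(1), of "x ` {..card B}"] B(2) by force
    then obtain t u where t: "finite t" "t \<subseteq> x ` {..card B}" "(\<Sum>w\<in>t. of_rat (u w) * w) = 0" "\<exists>w\<in>t. u w \<noteq> 0"
      unfolding V.dependent_explicit by blast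
    define q where "q i = (if x i \<in> t then u (x i) else 0)" for i
    obtain i where i: "i \<le> card B" "x i \<in> t" "u (x i) \<noteq> 0" using t(2,4) by blast
    have "(\<Sum>i\<le>card B. of_rat (q i) * x i) = (\<Sum>w\<in>x ` {..card B}. of_rat (if w \<in> t then u w else 0) * w)"
      by (subst sum.reindex[OF True]) (auto simp: q_def)
    also have "\<dots> = (\<Sum>w\<in>t. of_rat (u w) * w)"
      by (rule sum.mono_neutral_cong_right) (use t in auto)
    finally show ?thesis using t(3) i by (intro exI[of _ q]) (auto simp: q_def)
  next
    case False
    then obtain i l where il: "i \<le> card B" "l \<le> card B" "i \<noteq> l" "x i = x l" unfolding inj_on_def by auto
    define q :: "nat \<Rightarrow> rat" where "q h = (if h = i then 1 else 0) - (if h = l then 1 else 0)" for h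
    have "(\<Sum>h\<le>card B. of_rat (q h) * x h) =
       (\<Sum>h\<le>card B. if h = i then x h else 0) - (\<Sum>h\<le>card B. if h = l then x h else 0)"
      unfolding sum_subtractf[symmetric] by (intro sum.cong) (auto simp: q_def of_rat_diff)
    also have "\<dots> = 0" using il by (simp add: sum.delta)
    finally show ?thesis using il by (intro exI[of _ q]) (auto simp: q_def)
  qed
  then show thesis using that by blast
qed

lemma common_denominator:
  fixes q :: "nat \<Rightarrow> rat"
  shows "finite S \<Longrightarrow> \<exists>d::int. d \<noteq> 0 \<and> (\<forall>i\<in>S. q i * of_int d \<in> \<int>)"
proof (induction S rule: finite_induct)
  case (insert i S)
  then obtain d :: int where d: "d \<noteq> 0" "\<forall>i\<in>S. q i * of_int d \<in> \<int>" by blast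
  obtain a b where ab: "quotient_of (q i) = (a, b)" by (cases "quotient_of (q i)")
  have b: "b > 0" "q i = of_int a / of_int b" using ab quotient_of_denom_pos quotient_of_div by auto
  have "q l * of_int (d * b) = (q l * of_int d) * of_int b" for l by simp
  moreover have "q i * of_int (d * b) = of_int (a * d)" using b by simp
  ultimately have "\<forall>l\<in>insert i S. q l * of_int (d * b) \<in> \<int>"
    using d(2) by (metis Ints_mult Ints_of_int insert_iff)
  then show ?case using d b by (intro exI[of _ "d * b"]) auto
qed (auto intro: exI[of _ 1])

lemma remove_common_factor:
  fixes a :: "nat \<Rightarrow> int" and x :: "nat \<Rightarrow> 'a::field_char_0"
  assumes p: "prime p"
  shows "a l \<noteq> 0 \<Longrightarrow> l \<in> S \<Longrightarrow> (\<Sum>i\<in>S. of_int (a i) * x i) = 0 \<Longrightarrow>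
    \<exists>a. (\<exists>i\<in>S. \<not> int p dvd a i) \<and> (\<Sum>i\<in>S. of_int (a i) * x i) = 0"
proof (induction "nat \<bar>a l\<bar>" arbitrary: a rule: less_induct)
  case less
  show ?case
  proof (cases "\<exists>i\<in>S. \<not> int p dvd a i")
    case True then show ?thesis using less.prems by blast
  next
    case False
    define b where "b i = a i div int p" for i
    have ab: "a i = int p * b i" if "i \<in> S" for i using False that by (simp add: b_def)
    have "(\<Sum>i\<in>S. of_int (a i) * x i) = of_nat p * (\<Sum>i\<in>S. of_int (b i) * x i)"
      unfolding sum_distrib_left by (intro sum.cong) (auto simp: ab)
    then have "(\<Sum>i\<in>S. of_int (b i) * x i) = 0" using less.prems p by (auto simp: prime_gt_0_nat)
    moreover have "b l \<noteq> 0" using ab less.prems by auto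
    moreover have "nat \<bar>b l\<bar> < nat \<bar>a l\<bar>"
    proof -
      have "int p > 1" using p prime_gt_1_nat by auto
      then have "\<bar>b l\<bar> < int p * \<bar>b l\<bar>" using \<open>b l \<noteq> 0\<close> by simp
      then show ?thesis using ab[OF less.prems(2)] by (simp add: abs_mult)
    qed
    ultimately show ?thesis using less.hyps[of b] less.prems(2) by blast
  qed
qed

text \<open>All finiteness properties of primes of number fields that are needed (discreteness of the
  valuation, finiteness of the residue field, the valuation property) follow from these relations,
  whose coefficients do not all vanish modulo \<open>p\<close>.\<close>
lemma primitive_integer_relation:
  assumes "number_field TYPE('a::field_char_0)" and p: "prime p"
  obtains n :: nat where "\<And>x :: nat \<Rightarrow> 'a. \<exists>a :: nat \<Rightarrow> int.
    (\<exists>i\<le>n. \<not> int p dvd a i) \<and> (\<Sum>i\<le>n. of_int (a i) * x i) = 0"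
proof -
  obtain n :: nat where n: "\<And>x :: nat \<Rightarrow> 'a. \<exists>q :: nat \<Rightarrow> rat. (\<exists>i\<le>n. q i \<noteq> 0) \<and> (\<Sum>i\<le>n. of_rat (q i) * x i) = 0"
    using rational_relation[OF assms(1)] by blast
  have "\<exists>a :: nat \<Rightarrow> int. (\<exists>i\<le>n. \<not> int p dvd a i) \<and> (\<Sum>i\<le>n. of_int (a i) * x i) = 0" for x :: "nat \<Rightarrow> 'a"
  proof -
    obtain q l where q: "l \<le> n" "q l \<noteq> 0" "(\<Sum>i\<le>n. of_rat (q i) * x i) = 0" using n[of x] by blast
    obtain d :: int where d: "d \<noteq> 0" "\<forall>i\<in>{..n}. q i * of_int d \<in> \<int>"
      using common_denominator[of "{..n}" q] by auto
    then have "\<forall>i\<in>{..n}. \<exists>a. q i * of_int d = of_int a" by (auto elim: Ints_cases)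
    then obtain a where a: "\<And>i. i \<le> n \<Longrightarrow> q i * of_int d = of_int (a i)"
      unfolding bchoice_iff by auto
    have ai: "of_int (a i) = (of_rat (q i) * of_int d :: 'a)" if "i \<le> n" for i
      using a[OF that] by (metis of_rat_mult of_rat_of_int_eq)
    have "(\<Sum>i\<le>n. of_int (a i) * x i) = of_int d * (\<Sum>i\<le>n. of_rat (q i) * x i)"
      unfolding sum_distrib_left by (intro sum.cong) (auto simp: ai)
    then have "(\<Sum>i\<in>{..n}. of_int (a i) * x i) = 0" using q by simp
    moreover have "a l \<noteq> 0" using a[OF q(1)] q d by auto
    ultimately show ?thesis using remove_common_factor[OF p, of a l "{..n}" x] q(1) by auto
  qed
  then show thesis using that by blast
qed

text \<open>By Cayley-Hamilton: \<open>c\<close> is an eigenvalue of an integer matrix, hence a root of its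
  characteristic polynomial.\<close>
lemma algebraic_int_if_stable_lattice:
  fixes c :: "'a::field_char_0" and w :: "nat \<Rightarrow> 'a"
  assumes w: "l < n" "w l \<noteq> 0"
    and stable: "\<And>i. i < n \<Longrightarrow> \<exists>A :: nat \<Rightarrow> int. c * w i = (\<Sum>j<n. of_int (A j) * w j)"
  shows "algebraic_int c"
proof -
  obtain A :: "nat \<Rightarrow> nat \<Rightarrow> int" where A: "\<And>i. i < n \<Longrightarrow> c * w i = (\<Sum>j<n. of_int (A i j) * w j)"
    using stable by metis
  define M where "M = mat n n (\<lambda>(i, j). A i j)"
  have M: "M \<in> carrier_mat n n" by (simp add: M_def)
  let ?M = "map_mat of_int M :: 'a mat"
  have M': "?M \<in> carrier_mat n n" using M by simp
  have "?M *\<^sub>v vec n w = c \<cdot>\<^sub>v vec n w"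
    by (intro eq_vecI) (auto simp: M_def scalar_prod_def A lessThan_atLeast0)
  moreover have "vec n w \<noteq> 0\<^sub>v n" using w by (metis index_vec index_zero_vec(1))
  ultimately have "eigenvalue ?M c" unfolding eigenvalue_def eigenvector_def
    by (intro exI[of _ "vec n w"]) (use M in auto)
  then have root: "poly (char_poly ?M) c = 0" using eigenvalue_root_char_poly[OF M'] by blast
  have eq: "char_poly ?M = map_poly of_int (char_poly M)" using of_int_hom.char_poly_hom[OF M] .
  have "lead_coeff (char_poly ?M) = 1" using degree_monic_char_poly[OF M'] by simp
  moreover have "\<forall>i. coeff (char_poly ?M) i \<in> \<int>" unfolding eq by (simp add: coeff_map_poly)
  ultimately show ?thesis using root by (intro algebraic_int.intros)
qed

text \<open>The intermediate results of Horner's scheme at a root \<open>x\<close> are algebraic integers, since they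
  map the lattice generated by \<open>1, x, \<dots>, x\<^sup>n\<^sup>-\<^sup>1\<close> to itself: high powers of \<open>x\<close> are rewritten with the
  relation, which expresses \<open>x\<^sup>t\<close> times the sum by the lower coefficients.\<close>
lemma algebraic_int_Horner:
  fixes x :: "'a::field_char_0" and a :: "nat \<Rightarrow> int"
  assumes x: "x \<noteq> 0" and rel: "(\<Sum>i\<le>n. of_int (a i) * x ^ i) = 0" and t: "1 \<le> t" "t \<le> n"
  shows "algebraic_int (\<Sum>i\<in>{t..n}. of_int (a i) * x ^ (i - t))"
proof -
  define Sp where "Sp = {(\<Sum>j<n. of_int (A j) * x ^ j) | A :: nat \<Rightarrow> int. True}"
  have zero: "0 \<in> Sp" unfolding Sp_def by (auto intro: exI[of _ "\<lambda>_. 0"])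
  have add: "u + w \<in> Sp" if uw: "u \<in> Sp" "w \<in> Sp" for u w
  proof -
    obtain A B :: "nat \<Rightarrow> int" where "u = (\<Sum>j<n. of_int (A j) * x ^ j)" "w = (\<Sum>j<n. of_int (B j) * x ^ j)"
      using uw unfolding Sp_def by blast
    then have "u + w = (\<Sum>j<n. of_int (A j + B j) * x ^ j)" by (simp add: sum.distrib algebra_simps)
    then show ?thesis unfolding Sp_def by (intro CollectI exI[of _ "\<lambda>j. A j + B j"]) simp
  qed
  have sum: "(\<And>i. i \<in> S \<Longrightarrow> g i \<in> Sp) \<Longrightarrow> sum g S \<in> Sp" for g and S :: "nat set"
    by (induction S rule: infinite_finite_induct) (auto intro: zero add)
  have gen: "of_int b * x ^ g \<in> Sp" if "g < n" for b g
  proof -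
    have "(\<Sum>j<n. of_int (if j = g then b else 0) * x ^ j) = of_int b * x ^ g"
      using that by (simp add: if_distrib[of "\<lambda>t. of_int t * _"] sum.delta cong: if_cong)
    from this[symmetric] show ?thesis
      unfolding Sp_def by (intro CollectI exI[of _ "\<lambda>j. if j = g then b else 0"]) (rule conjI, assumption, rule TrueI)
  qed
  let ?b = "\<Sum>i\<in>{t..n}. of_int (a i) * x ^ (i - t)"
  have "?b * x ^ k \<in> Sp" if k: "k < n" for k
  proof (cases "k < t")
    case True
    have "?b * x ^ k = (\<Sum>i\<in>{t..n}. of_int (a i) * x ^ (i - t + k))"
      unfolding sum_distrib_right by (intro sum.cong) (auto simp: power_add[symmetric] mult.assoc)
    also have "\<dots> \<in> Sp" using True t by (intro sum gen) auto
    finally show ?thesis .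
  next
    case False
    have "?b * x ^ t = (\<Sum>i\<in>{t..n}. of_int (a i) * x ^ i)"
      unfolding sum_distrib_right by (intro sum.cong) (auto simp: mult.assoc power_add[symmetric])
    also have "\<dots> = - (\<Sum>i<t. of_int (a i) * x ^ i)"
    proof -
      have "{..n} = {..<t} \<union> {t..n}" using t by auto
      then have "(\<Sum>i\<le>n. of_int (a i) * x ^ i) = (\<Sum>i<t. of_int (a i) * x ^ i) + (\<Sum>i\<in>{t..n}. of_int (a i) * x ^ i)"
        by (simp only:) (rule sum.union_disjoint, auto)
      then show ?thesis using rel by (simp add: eq_neg_iff_add_eq_0 add.commute)
    qed
    finally have b: "?b * x ^ t = - (\<Sum>i<t. of_int (a i) * x ^ i)" .
    have "?b * x ^ k = (?b * x ^ t) * x ^ (k - t)" using False by (simp add: mult.assoc power_add[symmetric])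
    also have "\<dots> = (\<Sum>i<t. of_int (- a i) * x ^ (i + (k - t)))"
      unfolding b by (simp add: sum_distrib_right power_add mult.assoc sum_negf)
    also have "\<dots> \<in> Sp" using k False by (intro sum gen) auto
    finally show ?thesis .
  qed
  then have "\<exists>A :: nat \<Rightarrow> int. ?b * x ^ k = (\<Sum>j<n. of_int (A j) * x ^ j)" if "k < n" for k
    using that unfolding Sp_def by blast
  then show ?thesis using t by (intro algebraic_int_if_stable_lattice[of 0 n "\<lambda>i. x ^ i"]) auto
qed

lemma bezout_mod_prime:
  assumes "prime p" "\<not> int p dvd c"
  obtains e f :: int where "e * c + f * int p = 1"
proof -
  have "coprime (int p) c" using assms by (intro prime_imp_coprime) simp_all
  then show thesis using bezout_int[of c "int p"] that
    by (metis coprime_iff_gcd_eq_1 gcd.commute)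
qed

text \<open>In this context \<open>MR\<close> is the maximal ideal of the local ring \<open>R\<close>.\<close>
locale number_field_prime =
  fixes \<pp> :: "'a::field_char_0 set" and p :: nat
  assumes nf: "number_field TYPE('a)" and pp: "is_prime_of \<pp>"
    and prime_p: "prime p" and p_pp: "of_nat p \<in> \<pp>"
begin

abbreviation (input) \<O> :: "'a set" where "\<O> \<equiv> ring_of_integers"
abbreviation (input) R :: "'a set" where "R \<equiv> local_ring \<pp>"
abbreviation (input) MR :: "'a set" where "MR \<equiv> local_max_ideal \<pp>"

lemma primeideal_pp: "primeideal \<pp> (ring_on ring_of_integers)" using pp by (simp add: is_prime_of_def)
lemma ideal_pp: "ideal \<pp> (ring_on ring_of_integers)" using primeideal_pp by (simp add: primeideal_def)
lemma cring_OO: "cring (ring_on (ring_of_integers :: 'a set))" using primeideal_pp by (simp add: primeideal_def)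
lemma ring_OO: "ring (ring_on (ring_of_integers :: 'a set))" using cring_OO by (simp add: cring_def)

lemma OO_add: "x \<in> \<O> \<Longrightarrow> y \<in> \<O> \<Longrightarrow> x + y \<in> \<O>"
  using ring.ring_simprules(1)[OF ring_OO] by (simp add: ring_on_def)
lemma OO_mult: "x \<in> \<O> \<Longrightarrow> y \<in> \<O> \<Longrightarrow> x * y \<in> \<O>"
  using ring.ring_simprules(5)[OF ring_OO] by (simp add: ring_on_def)
lemma OO_int: "of_int a \<in> \<O>" by (simp add: ring_of_integers_def)
lemma OO_0: "0 \<in> \<O>" and OO_1: "1 \<in> \<O>" using OO_int[of 0] OO_int[of 1] by auto
lemma OO_uminus: "x \<in> \<O> \<Longrightarrow> - x \<in> \<O>" using OO_mult[OF OO_int[of "-1"], of x] by simp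
lemma OO_diff: "x \<in> \<O> \<Longrightarrow> y \<in> \<O> \<Longrightarrow> x - y \<in> \<O>" using OO_add[of x "-y"] OO_uminus by simp

lemma pp_OO: "x \<in> \<pp> \<Longrightarrow> x \<in> \<O>" using ideal.Icarr[OF ideal_pp] by (simp add: ring_on_def)
lemma pp_mult: "x \<in> \<pp> \<Longrightarrow> y \<in> \<O> \<Longrightarrow> x * y \<in> \<pp>"
  using ideal.I_r_closed[OF ideal_pp] by (simp add: ring_on_def)
lemma pp_mult_left: "x \<in> \<pp> \<Longrightarrow> y \<in> \<O> \<Longrightarrow> y * x \<in> \<pp>"
  using pp_mult by (simp add: mult.commute)
lemma pp_add: "x \<in> \<pp> \<Longrightarrow> y \<in> \<pp> \<Longrightarrow> x + y \<in> \<pp>"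
  using additive_subgroup.a_closed[OF ideal.axioms(1)[OF ideal_pp]] by (simp add: ring_on_def)
lemma pp_diff: "x \<in> \<pp> \<Longrightarrow> y \<in> \<pp> \<Longrightarrow> x - y \<in> \<pp>"
  using pp_add[of x "- y"] pp_mult[of y "-1"] OO_uminus[OF OO_1] by simp
lemma pp_prime: "x \<in> \<O> \<Longrightarrow> y \<in> \<O> \<Longrightarrow> x * y \<in> \<pp> \<Longrightarrow> x \<in> \<pp> \<or> y \<in> \<pp>"
  using primeideal.I_prime[OF primeideal_pp] by (simp add: ring_on_def)
lemma one_pp: "1 \<notin> \<pp>"
  using primeideal.I_notcarr[OF primeideal_pp] pp_mult_left[of 1] pp_OO by (auto simp: ring_on_def)
lemma zero_pp: "0 \<in> \<pp>" using pp_diff[OF p_pp p_pp] by simp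

lemma int_pp: "of_int a \<in> \<pp> \<Longrightarrow> int p dvd a"
proof (rule ccontr)
  assume a: "of_int a \<in> \<pp>" "\<not> int p dvd a"
  obtain e f :: int where "e * a + f * int p = 1" using bezout_mod_prime[OF prime_p a(2)] .
  then have "of_int e * of_int a + of_int f * of_nat p = (1::'a)"
    by (metis of_int_1 of_int_add of_int_mult of_int_of_nat_eq)
  moreover have "of_int e * of_int a + of_int f * of_nat p \<in> \<pp>"
    by (intro pp_add pp_mult_left a p_pp OO_int)
  ultimately show False using one_pp by simp
qed

lemma OO_R: "x \<in> \<O> \<Longrightarrow> x \<in> R"
  using OO_1 one_pp unfolding local_ring_def by (intro CollectI exI[of _ x] exI[of _ 1]) auto
lemma RE: assumes "x \<in> R" obtains a b where "a \<in> \<O>" "b \<in> \<O>" "b \<notin> \<pp>" "b \<noteq> 0" "x = a / b"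
  using assms zero_pp unfolding local_ring_def by force
lemma RI: "a \<in> \<O> \<Longrightarrow> b \<in> \<O> \<Longrightarrow> b \<notin> \<pp> \<Longrightarrow> a / b \<in> R" unfolding local_ring_def by blast
lemma ME: assumes "x \<in> MR" obtains a b where "a \<in> \<pp>" "b \<in> \<O>" "b \<notin> \<pp>" "b \<noteq> 0" "x = a / b"
  using assms zero_pp unfolding local_max_ideal_def by force
lemma MI: "a \<in> \<pp> \<Longrightarrow> b \<in> \<O> \<Longrightarrow> b \<notin> \<pp> \<Longrightarrow> a / b \<in> MR" unfolding local_max_ideal_def by blast
lemma pp_M: "x \<in> \<pp> \<Longrightarrow> x \<in> MR" using MI[of x 1] OO_1 one_pp by simp
lemma M_R: "x \<in> MR \<Longrightarrow> x \<in> R" using pp_OO by (auto elim!: ME intro!: RI)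

lemma R_diff: "x \<in> R \<Longrightarrow> y \<in> R \<Longrightarrow> x - y \<in> R"
proof -
  assume "x \<in> R" "y \<in> R"
  then obtain a b c d where *: "a \<in> \<O>" "b \<in> \<O>" "b \<notin> \<pp>" "b \<noteq> 0" "x = a / b"
    "c \<in> \<O>" "d \<in> \<O>" "d \<notin> \<pp>" "d \<noteq> 0" "y = c / d" by (meson RE)
  have "x - y = (a * d - c * b) / (b * d)" using * by (simp add: field_simps)
  also have "\<dots> \<in> R" using * pp_prime by (intro RI OO_diff OO_mult) auto
  finally show ?thesis .
qed
lemma R_mult: "x \<in> R \<Longrightarrow> y \<in> R \<Longrightarrow> x * y \<in> R"
proof -
  assume "x \<in> R" "y \<in> R"
  then obtain a b c d where *: "a \<in> \<O>" "b \<in> \<O>" "b \<notin> \<pp>" "b \<noteq> 0" "x = a / b"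
    "c \<in> \<O>" "d \<in> \<O>" "d \<notin> \<pp>" "d \<noteq> 0" "y = c / d" by (meson RE)
  have "x * y = (a * c) / (b * d)" using * by (simp add: field_simps)
  also have "\<dots> \<in> R" using * pp_prime by (intro RI OO_mult) auto
  finally show ?thesis .
qed
lemma M_mult: "x \<in> MR \<Longrightarrow> y \<in> R \<Longrightarrow> x * y \<in> MR"
proof -
  assume "x \<in> MR" "y \<in> R"
  then obtain a b c d where *: "a \<in> \<pp>" "b \<in> \<O>" "b \<notin> \<pp>" "b \<noteq> 0" "x = a / b"
    "c \<in> \<O>" "d \<in> \<O>" "d \<notin> \<pp>" "d \<noteq> 0" "y = c / d" by (meson RE ME)
  have "x * y = (a * c) / (b * d)" using * by (simp add: field_simps)
  also have "\<dots> \<in> MR" using * pp_prime by (intro MI OO_mult pp_mult) auto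
  finally show ?thesis .
qed
lemma M_mult_left: "x \<in> MR \<Longrightarrow> y \<in> R \<Longrightarrow> y * x \<in> MR" using M_mult by (simp add: mult.commute)
lemma M_diff: "x \<in> MR \<Longrightarrow> y \<in> MR \<Longrightarrow> x - y \<in> MR"
proof -
  assume "x \<in> MR" "y \<in> MR"
  then obtain a b c d where *: "a \<in> \<pp>" "b \<in> \<O>" "b \<notin> \<pp>" "b \<noteq> 0" "x = a / b"
    "c \<in> \<pp>" "d \<in> \<O>" "d \<notin> \<pp>" "d \<noteq> 0" "y = c / d" by (meson ME)
  have "x - y = (a * d - c * b) / (b * d)" using * by (simp add: field_simps)
  also have "\<dots> \<in> MR" using * pp_prime by (intro MI OO_mult pp_mult pp_diff) auto
  finally show ?thesis .
qed
lemma M_0: "0 \<in> MR" using pp_M zero_pp by blast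
lemma M_add: "x \<in> MR \<Longrightarrow> y \<in> MR \<Longrightarrow> x + y \<in> MR" using M_diff[of x "0 - y"] M_diff[OF M_0, of y] by simp
lemma M_sum: "(\<And>i. i \<in> S \<Longrightarrow> g i \<in> MR) \<Longrightarrow> sum g S \<in> MR"
  by (induction S rule: infinite_finite_induct) (auto intro: M_0 M_add)
lemma R_int: "of_int a \<in> R" using OO_int OO_R by blast
lemma R_1: "1 \<in> R" using R_int[of 1] by simp
lemma R_prod: "(\<And>i. i \<in> S \<Longrightarrow> g i \<in> R) \<Longrightarrow> prod g S \<in> R"
  by (induction S rule: infinite_finite_induct) (auto intro: R_1 R_mult)

lemma M_OO: "x \<in> MR \<Longrightarrow> x \<in> \<O> \<Longrightarrow> x \<in> \<pp>"
  using pp_prime by (elim ME) (metis nonzero_divide_eq_eq)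
lemma M_int: "of_int a \<in> MR \<Longrightarrow> int p dvd a" using M_OO OO_int int_pp by blast
lemma one_M: "1 \<notin> MR" using M_OO OO_1 one_pp by blast

lemma unit_iff: "x \<in> R \<Longrightarrow> inverse x \<in> R \<and> x \<noteq> 0 \<longleftrightarrow> x \<notin> MR"
proof
  assume x: "x \<in> R" "x \<notin> MR"
  then obtain a b where *: "a \<in> \<O>" "b \<in> \<O>" "b \<notin> \<pp>" "b \<noteq> 0" "x = a / b" by (meson RE)
  then have "a \<notin> \<pp>" using MI x by blast
  then show "inverse x \<in> R \<and> x \<noteq> 0" using * RI[of b a] zero_pp by auto
next
  assume "x \<in> R" "inverse x \<in> R \<and> x \<noteq> 0"
  then show "x \<notin> MR" using M_mult[of x "inverse x"] one_M by auto
qed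

text \<open>Take a primitive relation between the powers of \<open>x\<close>, with Horner sums \<open>b\<^sub>t\<close>. Both \<open>b\<^sub>t\<close> and \<open>x b\<^sub>t\<close>
  are integral and \<open>b\<^sub>t - x b\<^sub>t\<^sub>+\<^sub>1\<close> is the coefficient \<open>a\<^sub>t\<close>. As some \<open>a\<^sub>t\<close> is not in \<open>\<pp>\<close>, one of the
  numbers \<open>b\<^sub>t\<close> and \<open>x b\<^sub>t\<^sub>+\<^sub>1\<close> is not in \<open>\<pp>\<close>, and \<open>x\<close> or \<open>1/x\<close> is a fraction with this
  denominator.\<close>
lemma valuation_ring:
  obtains "x \<in> R" | "inverse x \<in> R"
proof (cases "x = 0")
  case True then show thesis using that OO_R OO_0 by blast
next
  case x: False
  obtain n :: nat and a :: "nat \<Rightarrow> int" where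
    a: "\<exists>i\<le>n. \<not> int p dvd a i" "(\<Sum>i\<le>n. of_int (a i) * x ^ i) = 0"
    using primitive_integer_relation[OF nf prime_p] by metis
  define b where "b t = (\<Sum>i\<in>{t..n}. of_int (a i) * x ^ (i - t))" for t
  have b0: "b 0 = 0" using a(2) by (simp add: b_def atLeast0AtMost)
  have b_OO: "b t \<in> \<O>" for t
  proof -
    consider "t = 0" | "n < t" | "1 \<le> t" "t \<le> n" by linarith
    then show ?thesis
    proof cases
      case 3
      then show ?thesis using algebraic_int_Horner[OF x a(2)] by (simp add: b_def ring_of_integers_def)
    next
      case 1 then show ?thesis using b0 OO_0 by simp
    qed (simp add: OO_0 b_def)
  qed
  have b_step: "b t = of_int (a t) + x * b (Suc t)" if t: "t \<le> n" for t
  proof -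
    have "b t = of_int (a t) + (\<Sum>i\<in>{Suc t..n}. of_int (a i) * x ^ (i - t))"
      unfolding b_def using t by (subst sum.atLeast_Suc_atMost) auto
    also have "(\<Sum>i\<in>{Suc t..n}. of_int (a i) * x ^ (i - t)) = x * b (Suc t)"
      unfolding b_def sum_distrib_left
    proof (intro sum.cong refl)
      fix i assume "i \<in> {Suc t..n}"
      \<comment> \<open>\<open>i > t\<close>, so the truncated subtraction is exact.\<close>
      then have "i - t = Suc (i - Suc t)" by auto
      then show "of_int (a i) * x ^ (i - t) = x * (of_int (a i) * x ^ (i - Suc t))" by simp
    qed
    finally show ?thesis .
  qed
  have xb_OO: "x * b (Suc t) \<in> \<O>" if "t \<le> n" for t
  proof -
    have "x * b (Suc t) = b t - of_int (a t)" using b_step[OF that] by simp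
    then show ?thesis using OO_diff[OF b_OO OO_int] by simp
  qed
  obtain t where t: "t \<le> n" "\<not> int p dvd a t" using a(1) by blast
  have "of_int (a t) = b t - x * b (Suc t)" using b_step[OF t(1)] by simp
  moreover have "(of_int (a t) :: 'a) \<notin> \<pp>" using t int_pp by blast
  ultimately have "b t \<notin> \<pp> \<or> x * b (Suc t) \<notin> \<pp>" using pp_diff by metis
  then show thesis
  proof
    assume bt: "b t \<notin> \<pp>"
    then have "t \<noteq> 0" using b0 zero_pp by metis
    then obtain s where s: "t = Suc s" using not0_implies_Suc by blast
    have "x = (x * b t) / b t" using bt zero_pp by auto
    also have "\<dots> \<in> R" using xb_OO[of s] s t b_OO bt by (intro RI) auto
    finally show thesis by (rule that(1))
  next
    assume bt: "x * b (Suc t) \<notin> \<pp>"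
    then have "b (Suc t) \<noteq> 0" using zero_pp by auto
    then have "inverse x = b (Suc t) / (x * b (Suc t))" using x by (simp add: field_simps)
    also have "\<dots> \<in> R" using xb_OO[OF t(1)] b_OO bt by (intro RI) auto
    finally show thesis by (rule that(2))
  qed
qed


text \<open>The partial products of such a factorisation of \<open>p\<close> have pairwise different valuations in
  \<open>[0, v(p))\<close>. In a primitive relation between them, the first term whose coefficient is prime to
  \<open>p\<close> has strictly smaller valuation than all others.\<close>
lemma no_long_chain:
  obtains n :: nat where "\<And>m y. (\<And>j. j \<le> n \<Longrightarrow> m j \<in> MR) \<Longrightarrow> y \<in> R \<Longrightarrow> of_nat p \<noteq> (\<Prod>j\<le>n. m j) * y"
proof -
  obtain n :: nat where n: "\<And>x :: nat \<Rightarrow> 'a. \<exists>a :: nat \<Rightarrow> int.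
    (\<exists>i\<le>n. \<not> int p dvd a i) \<and> (\<Sum>i\<le>n. of_int (a i) * x i) = 0"
    using primitive_integer_relation[OF nf prime_p] by metis
  have "of_nat p \<noteq> (\<Prod>j\<le>n. m j) * y" if m: "\<And>j. j \<le> n \<Longrightarrow> m j \<in> MR" and y: "y \<in> R" for m y
  proof
    assume eq: "of_nat p = (\<Prod>j\<le>n. m j) * y"
    have p0: "(of_nat p :: 'a) \<noteq> 0" using prime_p by (simp add: prime_gt_0_nat)
    then have m0: "m j \<noteq> 0" if "j \<le> n" for j using eq that by auto
    define x where "x i = (\<Prod>j<i. m j)" for i
    have x0: "x i \<noteq> 0" if "i \<le> n" for i unfolding x_def using that m0 by auto
    have xR: "x i \<in> R" if "i \<le> n" for i unfolding x_def using that m M_R by (intro R_prod) auto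
    obtain a :: "nat \<Rightarrow> int" where a: "\<exists>i\<le>n. \<not> int p dvd a i" "(\<Sum>i\<le>n. of_int (a i) * x i) = 0"
      using n by blast
    define i where "i = (LEAST i. i \<le> n \<and> \<not> int p dvd a i)"
    have i: "i \<le> n" "\<not> int p dvd a i" unfolding i_def using LeastI_ex[OF a(1)] by auto
    have below: "int p dvd a l" if "l < i" for l
      using not_less_Least[of l "\<lambda>i. i \<le> n \<and> \<not> int p dvd a i"] that i(1) unfolding i_def by auto
    have small: "of_int (a l) * x l / x i \<in> MR" if l: "l \<in> {..n} - {i}" for l
    proof (cases "l < i")
      case True
      obtain b where b: "a l = int p * b" using below[OF True] by (elim dvdE)
      have "of_nat p = x i * (\<Prod>j\<in>{i..n}. m j) * y"
      proof -
        have "(\<Prod>j\<le>n. m j) = x i * (\<Prod>j\<in>{i..n}. m j)"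
          unfolding x_def using i by (subst prod.union_disjoint[symmetric]) (auto intro!: prod.cong)
        then show ?thesis using eq by simp
      qed
      then have "of_int (a l) * x l / x i = (\<Prod>j\<in>{i..n}. m j) * (y * of_int b * x l)"
        using x0[OF i(1)] by (simp add: b field_simps)
      also have "(\<Prod>j\<in>{i..n}. m j) = m i * (\<Prod>j\<in>{Suc i..n}. m j)"
        using i by (subst prod.atLeast_Suc_atMost) auto
      finally have "of_int (a l) * x l / x i = m i * ((\<Prod>j\<in>{Suc i..n}. m j) * (y * of_int b * x l))"
        by (simp add: mult.assoc)
      also have "\<dots> \<in> MR" using i m M_R xR l y by (intro M_mult R_mult R_prod R_int) auto
      finally show ?thesis .
    next
      case False
      then have l: "i < l" "l \<le> n" using l by auto
      have "x l = x i * (\<Prod>j\<in>{i..<l}. m j)"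
        unfolding x_def using l by (subst prod.union_disjoint[symmetric]) (auto intro!: prod.cong)
      moreover have "(\<Prod>j\<in>{i..<l}. m j) = m i * (\<Prod>j\<in>{Suc i..<l}. m j)"
        using l by (subst prod.atLeast_Suc_lessThan) auto
      ultimately have "of_int (a l) * x l / x i = m i * ((\<Prod>j\<in>{Suc i..<l}. m j) * of_int (a l))"
        using x0[OF i(1)] by simp
      also have "\<dots> \<in> MR" using i m M_R l by (intro M_mult R_mult R_prod R_int) auto
      finally show ?thesis .
    qed
    have "(\<Sum>l\<le>n. of_int (a l) * x l) = of_int (a i) * x i + (\<Sum>l\<in>{..n} - {i}. of_int (a l) * x l)"
      using i by (subst sum.remove[of _ i]) auto
    then have "of_int (a i) * x i = - (\<Sum>l\<in>{..n} - {i}. of_int (a l) * x l)"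
      unfolding a(2) by (metis add.inverse_inverse minus_unique)
    then have "of_int (a i) = - (\<Sum>l\<in>{..n} - {i}. of_int (a l) * x l) / x i"
      using x0[OF i(1)] by (metis nonzero_mult_div_cancel_right)
    also have "\<dots> = 0 - (\<Sum>l\<in>{..n} - {i}. of_int (a l) * x l / x i)"
      by (simp add: sum_divide_distrib)
    also have "\<dots> \<in> MR" using small by (intro M_diff M_0 M_sum)
    finally show False using M_int i by blast
  qed
  then show thesis using that by blast
qed

text \<open>In a factorisation of \<open>p\<close> into the largest possible number of elements of the maximal ideal,
  every factor generates the maximal ideal: otherwise it could be factored further. Multiplying by
  its denominator moves the generator into \<open>\<pp>\<close>.\<close>
lemma obtain_uniformizer:
  obtains \<pi> where "\<pi> \<in> \<pp>" "\<pi> \<noteq> 0" "\<And>y. y \<in> MR \<Longrightarrow> y / \<pi> \<in> R"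
proof -
  obtain n :: nat where n: "\<And>m y. (\<And>j. j \<le> n \<Longrightarrow> m j \<in> MR) \<Longrightarrow> y \<in> R \<Longrightarrow> of_nat p \<noteq> (\<Prod>j\<le>n. m j) * y"
    using no_long_chain by blast
  define P where "P k \<longleftrightarrow> (\<exists>ms y. length ms = k \<and> set ms \<subseteq> MR \<and> y \<in> R \<and> of_nat p = prod_list ms * y)" for k
  have P1: "P 1" unfolding P_def
    by (intro exI[of _ "[of_nat p]"] exI[of _ 1]) (auto intro: pp_M p_pp R_1)
  have bound: "k \<le> n" if Pk: "P k" for k
  proof (rule ccontr)
    assume "\<not> k \<le> n"
    obtain ms y where ms: "length ms = k" "set ms \<subseteq> MR" "y \<in> R" "of_nat p = prod_list ms * y"
      using Pk unfolding P_def by blast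
    have "prod_list ms = (\<Prod>j<k. ms ! j)"
      using ms(1) prod.list_conv_set_nth[of ms] by (simp add: lessThan_atLeast0)
    also have "{..<k} = {..n} \<union> {Suc n..<k}" using \<open>\<not> k \<le> n\<close> by auto
    also have "(\<Prod>j\<in>\<dots>. ms ! j) = (\<Prod>j\<le>n. ms ! j) * (\<Prod>j\<in>{Suc n..<k}. ms ! j)"
      by (rule prod.union_disjoint) auto
    finally have "of_nat p = (\<Prod>j\<le>n. ms ! j) * ((\<Prod>j\<in>{Suc n..<k}. ms ! j) * y)"
      using ms(4) by (simp add: mult.assoc)
    moreover have "ms ! j \<in> MR" if "j < k" for j using ms that nth_mem by blast
    moreover have "(\<Prod>j\<in>{Suc n..<k}. ms ! j) * y \<in> R"
      using \<open>\<And>j. j < k \<Longrightarrow> ms ! j \<in> MR\<close> M_R ms(3) by (intro R_mult R_prod) auto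
    ultimately show False using n[of "\<lambda>j. ms ! j"] \<open>\<not> k \<le> n\<close> by auto
  qed
  define k where "k = (GREATEST k. P k)"
  have Pk: "P k" unfolding k_def using GreatestI_nat[of P 1 n] P1 bound by blast
  have notP: "\<not> P (Suc k)"
  proof
    assume "P (Suc k)"
    from Greatest_le_nat[of P, OF this bound] show False unfolding k_def by simp
  qed
  have "k \<noteq> 0" using notP P1 by (metis One_nat_def)
  obtain ms y where ms: "length ms = k" "set ms \<subseteq> MR" "y \<in> R" "of_nat p = prod_list ms * y"
    using Pk unfolding P_def by blast
  obtain m ms' where mm: "ms = m # ms'" using ms(1) \<open>k \<noteq> 0\<close> by (cases ms) auto
  have p0: "(of_nat p :: 'a) \<noteq> 0" using prime_p by (simp add: prime_gt_0_nat)
  then have m0: "m \<noteq> 0" using ms(4) mm by auto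
  have gen: "z / m \<in> R" if z: "z \<in> MR" for z
  proof (cases "z = 0")
    case True then show ?thesis using R_int[of 0] by simp
  next
    case z0: False
    show ?thesis
    proof (rule ccontr)
      assume zm: "z / m \<notin> R"
      have "inverse (z / m) \<in> R" using valuation_ring[of "z / m"] zm by blast
      then have "m / z \<in> R" by simp
      moreover have "inverse (m / z) \<notin> R" using zm by simp
      ultimately have "m / z \<in> MR" using unit_iff by blast
      moreover have "prod_list ms = z * ((m / z) * prod_list ms')" using mm z0 by simp
      ultimately have "P (Suc k)" unfolding P_def using ms mm z
        by (intro exI[of _ "z # (m / z) # ms'"] exI[of _ y]) auto
      then show False using notP by blast
    qed
  qed
  have "m \<in> MR" using ms mm by auto
  then obtain a b where ab: "a \<in> \<pp>" "b \<in> \<O>" "b \<notin> \<pp>" "b \<noteq> 0" "m = a / b" by (elim ME)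
  have "a \<noteq> 0" using ab m0 by auto
  moreover have "z / a \<in> R" if z: "z \<in> MR" for z
  proof -
    have "inverse b \<in> R" using RI[OF OO_1 ab(2,3)] by (simp add: divide_inverse)
    moreover have "z / a = (z / m) * inverse b" using ab \<open>a \<noteq> 0\<close> by (simp add: field_simps)
    ultimately show ?thesis using R_mult[OF gen[OF z], of "inverse b"] by simp
  qed
  ultimately show thesis using that ab(1) by blast
qed

lemma OO_poly: "(\<forall>i. coeff q i \<in> \<int>) \<Longrightarrow> a \<in> \<O> \<Longrightarrow> poly q a \<in> \<O>"
proof (induction q)
  case (pCons c q)
  then have "coeff q i \<in> \<int>" for i using pCons.prems(1)[rule_format, of "Suc i"] by simp
  moreover have "c \<in> \<O>" using pCons.prems(1)[rule_format, of 0] OO_int by (auto elim: Ints_cases)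
  ultimately show ?case using pCons by (auto intro!: OO_add OO_mult)
qed (simp add: OO_0)

text \<open>An algebraic integer divides the lowest nonzero coefficient of its equation.\<close>
lemma divides_integer:
  fixes q :: "'a poly"
  shows "(\<forall>i. coeff q i \<in> \<int>) \<Longrightarrow> q \<noteq> 0 \<Longrightarrow> poly q a = 0 \<Longrightarrow> a \<noteq> 0 \<Longrightarrow> a \<in> \<O> \<Longrightarrow>
    \<exists>c::int. c \<noteq> 0 \<and> (\<exists>b\<in>\<O>. a * b = of_int c)"
proof (induction q)
  case (pCons c q)
  have co: "coeff q i \<in> \<int>" for i using pCons.prems(1)[rule_format, of "Suc i"] by simp
  obtain d where d: "c = of_int d" using pCons.prems(1)[rule_format, of 0] by (auto elim: Ints_cases)
  show ?case
  proof (cases "c = 0")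
    case True
    then show ?thesis using pCons co by auto
  next
    case False
    have "poly q a \<in> \<O>" using OO_poly co pCons.prems(5) by blast
    moreover have "a * (- poly q a) = of_int d" using pCons.prems(3) d by (simp add: neg_eq_iff_add_eq_0 add.commute)
    ultimately show ?thesis using False d OO_uminus
      by (intro exI[of _ d] conjI bexI[of _ "- poly q a"]) auto
  qed
qed simp

text \<open>Elements of \<open>\<O> - \<pp>\<close> are invertible modulo \<open>\<pp>\<close>, that is, \<open>\<pp>\<close> is maximal: after cancelling powers
  of \<open>b\<close>, the equation of \<open>b\<close> modulo \<open>\<pp>\<close> has a constant term prime to \<open>p\<close>.\<close>
lemma inverse_mod_pp:
  assumes b: "b \<in> \<O>" "b \<notin> \<pp>"
  shows "(\<forall>i. coeff q i \<in> \<int>) \<Longrightarrow> (\<exists>i. coeff q i \<notin> \<pp>) \<Longrightarrow> poly q b \<in> \<pp> \<Longrightarrow> \<exists>y\<in>\<O>. 1 - b * y \<in> \<pp>"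
proof (induction q)
  case 0 then show ?case using zero_pp by auto
next
  case (pCons c q)
  have co: "coeff q i \<in> \<int>" for i using pCons.prems(1)[rule_format, of "Suc i"] by simp
  obtain d where d: "c = of_int d" using pCons.prems(1)[rule_format, of 0] by (auto elim: Ints_cases)
  have q_OO: "poly q b \<in> \<O>" using OO_poly co b(1) by blast
  have sum: "of_int d + b * poly q b \<in> \<pp>" using pCons.prems(3) d by simp
  show ?case
  proof (cases "int p dvd d")
    case False
    obtain e f :: int where ef: "e * d + f * int p = 1" using bezout_mod_prime[OF prime_p False] .
    then have "(1::'a) = of_int e * of_int d + of_int f * of_nat p"
      by (metis of_int_1 of_int_add of_int_mult of_int_of_nat_eq)
    then have "1 - b * (- (of_int e * poly q b)) = of_int e * (of_int d + b * poly q b) + of_int f * of_nat p"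
      by (simp add: algebra_simps)
    also have "\<dots> \<in> \<pp>" by (intro pp_add pp_mult_left sum p_pp OO_int)
    finally show ?thesis using q_OO by (intro bexI[of _ "- (of_int e * poly q b)"]) (auto intro: OO_uminus OO_mult OO_int)
  next
    case True
    then obtain g where "d = int p * g" by (elim dvdE)
    then have dpp: "of_int d \<in> \<pp>" using pp_mult[OF p_pp OO_int[of g]] by simp
    then have "b * poly q b \<in> \<pp>" using pp_diff[OF sum dpp] by simp
    then have "poly q b \<in> \<pp>" using pp_prime[OF b(1) q_OO] b(2) by blast
    moreover have "\<exists>i. coeff q i \<notin> \<pp>"
    proof -
      obtain i where i: "coeff (pCons c q) i \<notin> \<pp>" using pCons.prems(2) by blast
      then have "i \<noteq> 0" using dpp d by (metis coeff_pCons_0)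
      then show ?thesis using i by (cases i) auto
    qed
    ultimately show ?thesis using pCons.IH co by blast
  qed
qed

definition ppow :: "nat \<Rightarrow> 'a set" where
  "ppow n = \<pp> [^]\<^bsub>ideals_set (ring_on \<O>)\<^esub> n"

lemma ppow_0: "ppow 0 = \<O>"
  by (simp add: ppow_def nat_pow_def ideals_set_def ring_on_def)
lemma ppow_Suc: "ppow (Suc n) = ideal_prod (ring_on \<O>) (ppow n) \<pp>"
  by (simp add: ppow_def nat_pow_def ideals_set_def)

lemma ppow_ideal: "ideal (ppow n) (ring_on \<O>)"
proof (induction n)
  case 0
  have "ideal (carrier (ring_on \<O>)) (ring_on \<O>)" using ring.oneideal[OF ring_OO] .
  then show ?case by (simp add: ppow_0 ring_on_def)
next
  case (Suc n)
  show ?case unfolding ppow_Suc by (rule ring.ideal_prod_is_ideal[OF ring_OO Suc ideal_pp])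
qed
lemma ppow_add: "x \<in> ppow n \<Longrightarrow> y \<in> ppow n \<Longrightarrow> x + y \<in> ppow n"
  using additive_subgroup.a_closed[OF ideal.axioms(1)[OF ppow_ideal]] by (simp add: ring_on_def)
lemma ppow_mult_left: "x \<in> ppow n \<Longrightarrow> y \<in> \<O> \<Longrightarrow> y * x \<in> ppow n"
  using ideal.I_l_closed[OF ppow_ideal] by (simp add: ring_on_def)
lemma ppow_Suc_mult: "x \<in> ppow n \<Longrightarrow> y \<in> \<pp> \<Longrightarrow> x * y \<in> ppow (Suc n)"
  unfolding ppow_Suc using ideal_prod.prod[of x "ppow n" y \<pp> "ring_on \<O>"] by (simp add: ring_on_def)

end

locale number_field_prime_residue = number_field_prime \<pp> p
  for \<pp> :: "'a::field_char_0 set" and p +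
  fixes red :: "'a \<Rightarrow> 'k::field"
  assumes residue: "residue_field_map \<pp> red"
begin

lemma red_hom: "x \<in> R \<Longrightarrow> y \<in> R \<Longrightarrow> red (x + y) = red x + red y"
   "x \<in> R \<Longrightarrow> y \<in> R \<Longrightarrow> red (x * y) = red x * red y" "red 1 = 1"
  and red_surj: "red ` R = UNIV" and red_kernel: "x \<in> R \<Longrightarrow> red x = 0 \<longleftrightarrow> x \<in> MR"
  using residue unfolding residue_field_map_def
  by (auto simp: Ring.ring_hom_def ring_on_def)

lemma R_add: "x \<in> R \<Longrightarrow> y \<in> R \<Longrightarrow> x + y \<in> R"
  using R_diff[of x "0 - y"] R_diff[of 0 y] R_int[of 0] by simp
lemma R_sum: "(\<And>i. i \<in> S \<Longrightarrow> g i \<in> R) \<Longrightarrow> sum g S \<in> R"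
  by (induction S rule: infinite_finite_induct) (use R_int[of 0] in \<open>auto intro: R_add\<close>)

lemma red_eq: "x \<in> R \<Longrightarrow> y \<in> R \<Longrightarrow> x - y \<in> MR \<Longrightarrow> red x = red y"
  using red_hom(1)[of "x - y" y] red_kernel[OF R_diff, of x y] R_diff by simp

text \<open>A family in \<open>R\<close> that is independent modulo \<open>\<pp>\<close> over the integers modulo \<open>p\<close> admits no primitive
  relation, so it is bounded in length. A family of greatest length spans the residue field.\<close>
lemma finite_residue_field: "finite (UNIV :: 'k set)"
proof -
  obtain n :: nat where n: "\<And>x :: nat \<Rightarrow> 'a. \<exists>a :: nat \<Rightarrow> int.
    (\<exists>i\<le>n. \<not> int p dvd a i) \<and> (\<Sum>i\<le>n. of_int (a i) * x i) = 0"
    using primitive_integer_relation[OF nf prime_p] by metis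
  define Q where "Q k x \<longleftrightarrow> (\<forall>i<k. x i \<in> R) \<and>
    (\<forall>a::nat \<Rightarrow> int. (\<Sum>i<k. of_int (a i) * x i) \<in> MR \<longrightarrow> (\<forall>i<k. int p dvd a i))" for k and x :: "nat \<Rightarrow> 'a"
  have bound: "k \<le> n" if ex: "\<exists>x. Q k x" for k
  proof (rule ccontr)
    assume "\<not> k \<le> n"
    obtain x where Q: "Q k x" using ex by blast
    obtain a l where a: "l \<le> n" "\<not> int p dvd a l" "(\<Sum>i\<le>n. of_int (a i) * x i) = 0" using n[of x] by blast
    let ?a = "\<lambda>i. if i \<le> n then a i else 0"
    have "(\<Sum>i<k. of_int (?a i) * x i) = (\<Sum>i\<le>n. of_int (a i) * x i)"
      by (rule sum.mono_neutral_cong_right) (use \<open>\<not> k \<le> n\<close> in auto)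
    then have "(\<Sum>i<k. of_int (?a i) * x i) \<in> MR" using a(3) M_0 by simp
    then have "\<forall>i<k. int p dvd ?a i" using Q[unfolded Q_def, THEN conjunct2, rule_format, of ?a] by blast
    then show False using a \<open>\<not> k \<le> n\<close> by (auto dest: spec[of _ l])
  qed
  have Q0: "\<exists>x. Q 0 x" by (simp add: Q_def)
  define k where "k = (GREATEST k. \<exists>x. Q k x)"
  have "\<exists>x. Q k x" unfolding k_def using GreatestI_nat[of "\<lambda>k. \<exists>x. Q k x" 0 n] Q0 bound by blast
  then obtain x where Q: "Q k x" by blast
  have notQ: "\<not> Q (Suc k) x'" for x'
  proof
    assume "Q (Suc k) x'"
    then have "\<exists>x. Q (Suc k) x" by blast
    from Greatest_le_nat[of "\<lambda>k. \<exists>x. Q k x", OF this bound] show False unfolding k_def by simp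
  qed
  have xR: "x i \<in> R" if "i < k" for i using Q that by (simp add: Q_def)
  have "UNIV \<subseteq> (\<lambda>c. red (\<Sum>i<k. of_int (c i) * x i)) ` (({..<k}) \<rightarrow>\<^sub>E {0..<int p})"
  proof
    fix z :: 'k
    obtain y where y: "y \<in> R" "red y = z" using red_surj by (metis UNIV_I imageE)
    let ?x = "x(k := y)"
    have "\<forall>i<Suc k. ?x i \<in> R" using xR y by auto
    then obtain a l where a: "(\<Sum>i<Suc k. of_int (a i) * ?x i) \<in> MR" "l < Suc k" "\<not> int p dvd a l"
      using notQ[of ?x] unfolding Q_def by blast
    let ?s = "\<Sum>i<k. of_int (a i) * x i"
    have s: "?s + of_int (a k) * y \<in> MR" using a(1) by simp
    have ndvd: "\<not> int p dvd a k"
    proof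
      assume d: "int p dvd a k"
      then obtain g where "a k = int p * g" by (elim dvdE)
      then have "of_int (a k) \<in> MR" using pp_M[OF pp_mult[OF p_pp OO_int[of g]]] by simp
      then have "?s \<in> MR" using M_diff[OF s M_mult, of "of_int (a k)" y] y by simp
      then have "\<forall>i<k. int p dvd a i" using Q unfolding Q_def by blast
      then show False using a d by (cases "l = k") auto
    qed
    obtain e f :: int where ef: "e * a k + f * int p = 1" using bezout_mod_prime[OF prime_p ndvd] .
    then have one: "(1::'a) = of_int e * of_int (a k) + of_int f * of_nat p"
      by (metis of_int_1 of_int_add of_int_mult of_int_of_nat_eq)
    \<comment> \<open>Solving the relation for \<open>y\<close>, with \<open>e\<close> the inverse of \<open>a k\<close> modulo \<open>p\<close>.\<close>
    define c where "c = restrict (\<lambda>i. (- e * a i) mod int p) {..<k}"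
    have c: "c \<in> {..<k} \<rightarrow>\<^sub>E {0..<int p}" using prime_p by (auto simp: c_def prime_gt_0_nat)
    have cmod: "of_int (- e * a i) - of_int (c i) \<in> MR" if "i < k" for i
    proof -
      have "int p dvd (- e * a i - c i)" using that by (simp add: c_def mod_eq_dvd_iff[symmetric] del: mult_minus_left)
      then obtain g where g: "- e * a i - c i = int p * g" by (elim dvdE)
      have "of_int (- e * a i) - of_int (c i) = (of_int (- e * a i - c i) :: 'a)" by simp
      also have "\<dots> = of_nat p * of_int g" unfolding g by simp
      finally show ?thesis using pp_M[OF pp_mult[OF p_pp OO_int[of g]]] by simp
    qed
    have "y - (\<Sum>i<k. of_int (c i) * x i) = (of_int e * (?s + of_int (a k) * y) + of_nat p * (of_int f * y))
        + (\<Sum>i<k. (of_int (- e * a i) - of_int (c i)) * x i)"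
    proof -
      have "y = (of_int e * of_int (a k) + of_int f * of_nat p) * y" using one by simp
      moreover have "(\<Sum>i<k. (of_int (- e * a i) - of_int (c i)) * x i) = - (of_int e * ?s) - (\<Sum>i<k. of_int (c i) * x i)"
        by (simp add: left_diff_distrib sum_subtractf sum_distrib_left sum_negf mult.assoc)
      moreover have "y = (A + B) * y \<Longrightarrow> u = - (E * s) - t \<Longrightarrow> A = E * g \<Longrightarrow> B = F * P \<Longrightarrow>
        y - t = (E * (s + g * y) + P * (F * y)) + u" for A B u E s t g F P :: 'a
      proof -
        assume a: "y = (A + B) * y" "u = - (E * s) - t" "A = E * g" "B = F * P"
        have "(E * (s + g * y) + P * (F * y)) + u = (A + B) * y - t"
          unfolding a(2-4) by (simp add: algebra_simps)
        then show ?thesis using a(1) by simp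
      qed
      ultimately show ?thesis by blast
    qed
    also have "\<dots> \<in> MR"
      using s y xR cmod by (intro M_add M_sum M_mult_left[OF s] M_mult[OF pp_M[OF p_pp]] R_mult R_int M_mult) auto
    finally have "z = red (\<Sum>i<k. of_int (c i) * x i)"
      using red_eq[of y "\<Sum>i<k. of_int (c i) * x i"] y xR by (auto intro!: R_sum R_mult R_int)
    then show "z \<in> (\<lambda>c. red (\<Sum>i<k. of_int (c i) * x i)) ` (({..<k}) \<rightarrow>\<^sub>E {0..<int p})"
      using c by (rule image_eqI)
  qed
  then show ?thesis by (meson finite_PiE finite_lessThan finite_atLeastLessThan_int finite_imageI finite_subset)
qed

text \<open>Every nonzero element of \<open>R\<close> divides, up to a unit, a nonzero integer, hence a power of \<open>p\<close>, so
  it is a power of \<open>\<pi>\<close> times a unit. The number \<open>p\<close> lies in the same powers of \<open>\<pp>\<close>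
  as of the maximal ideal of \<open>R\<close>, because denominators are invertible modulo powers of \<open>\<pp>\<close>.\<close>
theorem local_ring_uniformized:
  obtains \<pi> where "residue_map R \<pi> p (prime_valuation \<pp> (of_nat p)) red"
    "uniformized.pw R \<pi> 1 = MR"
proof -
  obtain \<pi> where pi: "\<pi> \<in> \<pp>" "\<pi> \<noteq> 0" and gen: "\<And>y. y \<in> MR \<Longrightarrow> y / \<pi> \<in> R"
    using obtain_uniformizer by blast
  have piM: "\<pi> \<in> MR" and piR: "\<pi> \<in> R" using pi pp_M M_R by auto
  have unit_mult: "inverse x \<in> R" if "x \<in> R" "x * y \<in> R" "inverse (x * y) \<in> R" "y \<in> R" "y \<noteq> 0" for x y
    using R_mult[OF that(4) that(3)] that(5) by (simp add: field_simps)
  have split: "\<exists>y\<in>R. x = \<pi> * y" if "x \<in> MR" for x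
    using gen[OF that] pi(2) by (intro bexI[of _ "x / \<pi>"]) auto
  obtain v w where vw: "w \<in> R" "inverse w \<in> R" "w \<noteq> 0" "of_nat p = \<pi> ^ v * w"
  proof -
    obtain n :: nat where n: "\<And>m y. (\<And>j. j \<le> n \<Longrightarrow> m j \<in> MR) \<Longrightarrow> y \<in> R \<Longrightarrow> of_nat p \<noteq> (\<Prod>j\<le>n. m j) * y"
      using no_long_chain by blast
    let ?P = "\<lambda>k. \<exists>y\<in>R. of_nat p = \<pi> ^ k * y"
    have bound: "k \<le> n" if k: "?P k" for k
    proof (rule ccontr)
      assume "\<not> k \<le> n"
      obtain y where y: "y \<in> R" "of_nat p = \<pi> ^ k * y" using k by blast
      have "\<pi> ^ k = \<pi> ^ Suc n * \<pi> ^ (k - Suc n)"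
        using \<open>\<not> k \<le> n\<close> by (simp add: power_add[symmetric] del: power_Suc)
      then have "of_nat p = (\<Prod>j\<le>n. \<pi>) * (\<pi> ^ (k - Suc n) * y)" using y by (simp add: mult.assoc)
      moreover have "\<pi> ^ i \<in> R" for i by (induction i) (auto intro: R_1 R_mult piR)
      ultimately show False using n[of "\<lambda>_. \<pi>"] piM y R_mult by blast
    qed
    have "?P 0" using OO_R[OF pp_OO[OF p_pp]] by simp
    define v where "v = (GREATEST k. ?P k)"
    have "?P v" unfolding v_def using GreatestI_nat[of ?P 0 n] \<open>?P 0\<close> bound by blast
    then obtain y where y: "y \<in> R" "of_nat p = \<pi> ^ v * y" by blast
    have "y \<notin> MR"
    proof
      assume "y \<in> MR"
      then obtain z where "z \<in> R" "y = \<pi> * z" using split by blast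
      then have "?P (Suc v)" using y by auto
      then show False using Greatest_le_nat[of ?P "Suc v" n, OF _ bound] unfolding v_def by simp
    qed
    then show thesis using that y unit_iff by blast
  qed
  have reduce: "x * z = \<pi> ^ j * u \<Longrightarrow> x \<in> R \<Longrightarrow> z \<in> R \<Longrightarrow> u \<in> R \<Longrightarrow> inverse u \<in> R \<Longrightarrow> u \<noteq> 0 \<Longrightarrow>
    \<exists>k. \<exists>w\<in>R. inverse w \<in> R \<and> x = \<pi> ^ k * w" for x z j u
  proof (induction j arbitrary: x)
    case 0
    then have "inverse x \<in> R" using unit_mult[of x z] by auto
    then show ?case using 0 by (intro exI[of _ 0]) auto
  next
    case (Suc j)
    show ?case
    proof (cases "x \<in> MR")
      case True
      then obtain y where y: "y \<in> R" "x = \<pi> * y" using split by blast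
      then have "y * z = \<pi> ^ j * u" using Suc.prems pi(2) by (simp add: mult.assoc)
      then obtain k w where "w \<in> R" "inverse w \<in> R" "y = \<pi> ^ k * w" using Suc.IH[OF _ y(1)] Suc.prems by blast
      then show ?thesis using y by (intro exI[of _ "Suc k"] bexI[of _ w]) auto
    next
      case False
      then show ?thesis using unit_iff Suc.prems by (intro exI[of _ 0]) auto
    qed
  qed
  have v1: "v \<ge> 1"
  proof (rule ccontr)
    assume "\<not> v \<ge> 1"
    then have "v = 0" by simp
    then have "of_nat p = w" using vw by simp
    then show False using unit_iff[OF vw(1)] vw pp_M p_pp by auto
  qed
  have invpi: "inverse \<pi> \<notin> R" using unit_iff[OF piR] piM pi by blast
  have factor: "\<exists>k. \<exists>w\<in>R. inverse w \<in> R \<and> x = \<pi> ^ k * w" if x: "x \<in> R" "x \<noteq> 0" for x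
  proof -
    obtain a b where ab: "a \<in> \<O>" "b \<in> \<O>" "b \<notin> \<pp>" "b \<noteq> 0" "x = a / b" using x(1) by (elim RE)
    have a0: "a \<noteq> 0" using ab x by auto
    obtain q :: "'a poly" where q: "lead_coeff q = 1" "\<forall>i. coeff q i \<in> \<int>" "poly q a = 0"
      using ab(1) unfolding ring_of_integers_def by (auto elim: algebraic_int.cases)
    then obtain c :: int and a' where c: "c \<noteq> 0" "a' \<in> \<O>" "a * a' = of_int c"
      using divides_integer[of q a] a0 ab(1) by fastforce
    have "int p \<noteq> 0" "\<not> is_unit (int p)" using prime_p by auto
    then obtain m c' where m: "c = int p ^ m * c'" "\<not> int p dvd c'"
      using multiplicity_decompose'[of c "int p"] c(1) by metis
    have c'u: "inverse (of_int c') \<in> R" "(of_int c' :: 'a) \<noteq> 0"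
      using unit_iff[OF R_int] M_int m(2) by blast+
    have wk: "w ^ m \<in> R" "inverse w ^ m \<in> R"
      by (induction m) (auto intro: R_1 R_mult vw)
    have binv: "inverse b \<in> R" using RI[OF OO_1 ab(2,3)] by (simp add: divide_inverse)
    have "x * (b * a') = of_int c" using ab c by simp
    also have "\<dots> = \<pi> ^ (v * m) * (w ^ m * of_int c')"
      unfolding m(1) using vw(4) by (simp add: power_mult_distrib power_mult)
    finally show ?thesis
      using reduce[of x "b * a'" "v * m" "w ^ m * of_int c'"] x(1) ab c c'u wk vw(3) R_int[of c']
      by (auto intro: R_mult OO_R simp: inverse_mult_distrib power_inverse)
  qed
  have U: "uniformized R \<pi> p v"
  proof
    show "\<exists>w\<in>R. inverse w \<in> R \<and> of_nat p = \<pi> ^ v * w" using vw by blast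
  qed (use R_1 R_diff R_mult piR pi invpi factor prime_p v1 in auto)
  interpret U: uniformized R \<pi> p v by (rule U)
  have M_eq: "U.pw 1 = MR"
    using split M_mult[OF piM] by (auto simp: U.pw_def)
  have ppow_pw: "x \<in> ppow n \<Longrightarrow> x \<in> U.pw n" for x n
  proof (induction n arbitrary: x)
    case 0 then show ?case by (simp add: U.pw_0 ppow_0 OO_R)
  next
    case (Suc n)
    from Suc.prems show ?case unfolding ppow_Suc
    proof (induction rule: ideal_prod.induct)
      case (prod i j)
      then show ?case using Suc.IH[of i] U.mult_pw[of i n j 1] pp_M M_eq by (simp add: ring_on_def One_nat_def)
    next
      case (sum s t) then show ?case using U.add_pw by (simp add: ring_on_def)
    qed
  qed
  have pi_pow: "\<pi> ^ n \<in> ppow n" for n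
  proof (induction n)
    case (Suc n)
    then show ?case using ppow_Suc_mult[OF Suc pi(1)] by (simp add: mult.commute)
  qed (simp add: ppow_0 OO_1)
  have p_ppow: "of_nat p \<in> ppow v"
  proof -
    obtain a b where ab: "a \<in> \<O>" "b \<in> \<O>" "b \<notin> \<pp>" "b \<noteq> 0" "w = a / b" using vw(1) by (elim RE)
    have pb: "of_nat p * b \<in> ppow v"
    proof -
      have "of_nat p * b = a * \<pi> ^ v" using vw(4) ab by simp
      then show ?thesis using ppow_mult_left[OF pi_pow ab(1)] by simp
    qed
    obtain q :: "'a poly" where q: "lead_coeff q = 1" "\<forall>i. coeff q i \<in> \<int>" "poly q b = 0"
      using ab(2) unfolding ring_of_integers_def by (auto elim: algebraic_int.cases)
    have "\<exists>i. coeff q i \<notin> \<pp>" using q(1) one_pp by metis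
    then obtain y1 where y1: "y1 \<in> \<O>" "1 - b * y1 \<in> \<pp>"
      using inverse_mod_pp[OF ab(2,3) q(2)] q(3) zero_pp by auto
    have "\<exists>y\<in>\<O>. 1 - b * y \<in> ppow j" for j
    proof (induction j)
      case 0 then show ?case using OO_1 OO_0 by (intro bexI[of _ 0]) (auto simp: ppow_0)
    next
      case (Suc j)
      then obtain y where y: "y \<in> \<O>" "1 - b * y \<in> ppow j" by blast
      have "1 - b * (y + y1 - b * y * y1) = (1 - b * y) * (1 - b * y1)" by (simp add: algebra_simps)
      also have "\<dots> \<in> ppow (Suc j)" using y y1 by (intro ppow_Suc_mult)
      finally show ?case using y y1 ab
        by (intro bexI[of _ "y + y1 - b * y * y1"]) (auto intro!: OO_diff OO_add OO_mult)
    qed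
    then obtain y where y: "y \<in> \<O>" "1 - b * y \<in> ppow v" by blast
    have "of_nat p = of_nat p * (1 - b * y) + y * (of_nat p * b)" by (simp add: algebra_simps)
    also have "\<dots> \<in> ppow v"
      by (rule ppow_add[OF ppow_mult_left[OF y(2) pp_OO[OF p_pp]] ppow_mult_left[OF pb y(1)]])
    finally show ?thesis .
  qed
  have "prime_valuation \<pp> (of_nat p) = v"
    unfolding prime_valuation_def ppow_def[symmetric]
  proof (rule Greatest_equality)
    show "of_nat p \<in> ppow v" by (rule p_ppow)
    fix n assume "of_nat p \<in> ppow n"
    then have "of_nat p \<in> U.pw n" by (rule ppow_pw)
    then show "n \<le> v" using U.p_notin U.pw_mono not_less_eq_eq by blast
  qed
  moreover have "residue_map R \<pi> p v red"
    by unfold_locales (simp_all add: red_hom M_eq red_kernel del: One_nat_def)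
  ultimately show thesis using that M_eq by simp
qed

end

section \<open>Polynomials and points of projective space\<close>

abbreviation "plook \<equiv> Poly_Mapping.lookup"
abbreviation "pkeys \<equiv> Poly_Mapping.keys"
abbreviation "psingle \<equiv> Poly_Mapping.single"

definition mpow :: "(nat \<Rightarrow> 'b::comm_semiring_1) \<Rightarrow> (nat \<Rightarrow>\<^sub>0 nat) \<Rightarrow> 'b" where
  "mpow b m = (\<Prod>i\<in>pkeys m. b i ^ plook m i)"

definition mdeg :: "(nat \<Rightarrow>\<^sub>0 nat) \<Rightarrow> nat" where
  "mdeg m = (\<Sum>i\<in>pkeys m. plook m i)"

lemma mpeval_mpow: "mpeval h b F = (\<Sum>m\<in>pkeys F. h (plook F m) * mpow b m)"
  by (simp add: mpeval_def mpow_def)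

lemma mpow_superset: "finite S \<Longrightarrow> pkeys m \<subseteq> S \<Longrightarrow> mpow b m = (\<Prod>i\<in>S. b i ^ plook m i)"
  unfolding mpow_def by (rule prod.mono_neutral_left) (auto simp: in_keys_iff)

lemma mdeg_superset: "finite S \<Longrightarrow> pkeys m \<subseteq> S \<Longrightarrow> mdeg m = (\<Sum>i\<in>S. plook m i)"
  unfolding mdeg_def by (rule sum.mono_neutral_left) (auto simp: in_keys_iff)

lemma mpow_add: "mpow b (m + m') = mpow b m * mpow b m'"
proof -
  let ?S = "pkeys m \<union> pkeys m'"
  have "pkeys (m + m') \<subseteq> ?S" by (rule Poly_Mapping.keys_add)
  then show ?thesis
    by (simp add: mpow_superset[of ?S] lookup_add power_add prod.distrib)
qed

lemma mpow_0 [simp]: "mpow b 0 = 1" by (simp add: mpow_def)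

lemma mpow_single [simp]: "mpow b (psingle i k) = b i ^ k"
  by (cases "k = 0") (auto simp: mpow_def)

lemma mpow_scale: "mpow (\<lambda>i. c * b i) m = c ^ mdeg m * mpow b m"
  by (simp add: mpow_def mdeg_def power_mult_distrib prod.distrib power_sum)

lemma mpow_cong: "pkeys m \<subseteq> {..N} \<Longrightarrow> (\<And>i. i \<le> N \<Longrightarrow> b i = b' i) \<Longrightarrow> mpow b m = mpow b' m"
  unfolding mpow_def by (intro prod.cong) auto

lemma mpeval_superset:
  "finite S \<Longrightarrow> pkeys F \<subseteq> S \<Longrightarrow> h 0 = 0 \<Longrightarrow> mpeval h b F = (\<Sum>m\<in>S. h (plook F m) * mpow b m)"
  unfolding mpeval_mpow by (rule sum.mono_neutral_left) (auto simp: in_keys_iff)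

lemma homogeneous_mdeg: "homogeneous e F \<longleftrightarrow> (\<forall>m\<in>pkeys F. mdeg m = e)"
  by (simp add: homogeneous_def mdeg_def)

lemma mpeval_scale:
  "homogeneous e F \<Longrightarrow> mpeval h (\<lambda>i. c * b i) F = c ^ e * mpeval h b F"
  unfolding mpeval_mpow sum_distrib_left
  by (intro sum.cong) (auto simp: mpow_scale homogeneous_mdeg mult_ac)

lemma mpeval_vars_cong:
  "F \<in> mpolys A N \<Longrightarrow> (\<And>i. i \<le> N \<Longrightarrow> b i = b' i) \<Longrightarrow> mpeval h b F = mpeval h b' F"
  unfolding mpeval_mpow
  by (intro sum.cong refl arg_cong2[where f = "(*)"] mpow_cong[of _ N]) (auto simp: mpolys_def)

lemma mpoly_expand: "(\<Sum>m\<in>pkeys F. psingle m (plook F m)) = F"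
  by (rule poly_mapping_eqI) (simp add: lookup_sum lookup_single when_def in_keys_iff)

lemma mpeval_single: "h 0 = 0 \<Longrightarrow> mpeval h b (psingle m c) = h c * mpow b m"
  by (cases "c = 0") (auto simp: mpeval_mpow)

lemma mpeval_mvar: "h 1 = 1 \<Longrightarrow> h 0 = 0 \<Longrightarrow> mpeval h b (mvar i :: 'a::zero_neq_one mpoly) = b i"
  unfolding mvar_def by (simp add: mpeval_single)

lemma mpoly_mult_expand:
  "F * G = (\<Sum>m\<in>pkeys F. \<Sum>m'\<in>pkeys G. psingle (m + m') (plook F m * plook G m'))"
  by (subst mpoly_expand[of F, symmetric], subst mpoly_expand[of G, symmetric])
    (simp add: sum_product mult_single)

text \<open>A ring homomorphism that is given on the subring \<open>A\<close> only, such as the reduction map of a local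
  ring.\<close>
locale partial_hom =
  fixes A :: "'a::comm_ring_1 set" and h :: "'a \<Rightarrow> 'b::comm_ring_1"
  assumes one_A: "1 \<in> A" and diff_A: "x \<in> A \<Longrightarrow> y \<in> A \<Longrightarrow> x - y \<in> A"
    and mult_A: "x \<in> A \<Longrightarrow> y \<in> A \<Longrightarrow> x * y \<in> A"
    and h_add: "x \<in> A \<Longrightarrow> y \<in> A \<Longrightarrow> h (x + y) = h x + h y"
    and h_mult: "x \<in> A \<Longrightarrow> y \<in> A \<Longrightarrow> h (x * y) = h x * h y"
    and h_one: "h 1 = 1"
begin

lemma zero_A: "0 \<in> A" using diff_A[OF one_A one_A] by simp
lemma add_A: "x \<in> A \<Longrightarrow> y \<in> A \<Longrightarrow> x + y \<in> A"
  using diff_A[of x "0 - y"] diff_A[OF zero_A, of y] by simp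
lemma sum_A: "(\<And>i. i \<in> S \<Longrightarrow> g i \<in> A) \<Longrightarrow> sum g S \<in> A"
  by (induction S rule: infinite_finite_induct) (auto intro: zero_A add_A)
lemma prod_A: "(\<And>i. i \<in> S \<Longrightarrow> g i \<in> A) \<Longrightarrow> prod g S \<in> A"
  by (induction S rule: infinite_finite_induct) (auto intro: one_A mult_A)
lemma power_A: "x \<in> A \<Longrightarrow> x ^ k \<in> A" by (induction k) (auto intro: one_A mult_A)
lemma h_zero: "h 0 = 0" using h_add[OF zero_A zero_A] by simp
lemma h_sum: "(\<And>i. i \<in> S \<Longrightarrow> g i \<in> A) \<Longrightarrow> h (sum g S) = (\<Sum>i\<in>S. h (g i))"
  by (induction S rule: infinite_finite_induct) (auto simp: h_zero h_add sum_A)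
lemma h_prod: "(\<And>i. i \<in> S \<Longrightarrow> g i \<in> A) \<Longrightarrow> h (prod g S) = (\<Prod>i\<in>S. h (g i))"
  by (induction S rule: infinite_finite_induct) (auto simp: h_one h_mult prod_A)
lemma h_power: "x \<in> A \<Longrightarrow> h (x ^ k) = h x ^ k"
  by (induction k) (auto simp: h_one h_mult power_A)

definition over :: "'a mpoly \<Rightarrow> bool" where "over F \<longleftrightarrow> (\<forall>m. plook F m \<in> A)"

lemma over_0: "over 0" by (simp add: over_def zero_A)
lemma over_single: "c \<in> A \<Longrightarrow> over (psingle m c)"
  by (auto simp: over_def lookup_single when_def zero_A)
lemma over_add: "over F \<Longrightarrow> over G \<Longrightarrow> over (F + G)"
  by (auto simp: over_def lookup_add add_A)
lemma over_diff: "over F \<Longrightarrow> over G \<Longrightarrow> over (F - G)"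
  by (auto simp: over_def lookup_minus diff_A)
lemma over_sum: "(\<And>i. i \<in> S \<Longrightarrow> over (g i)) \<Longrightarrow> over (sum g S)"
  by (induction S rule: infinite_finite_induct) (auto intro: over_0 over_add)
lemma over_mult: "over F \<Longrightarrow> over G \<Longrightarrow> over (F * G)"
  unfolding mpoly_mult_expand
  by (intro over_sum over_single mult_A) (auto simp: over_def)
lemma over_1: "over 1" using over_single[OF one_A, of 0] by simp
lemma over_mpolys: "F \<in> mpolys A N \<Longrightarrow> over F" by (simp add: mpolys_def over_def)

lemma mpolys_0: "0 \<in> mpolys A N" by (simp add: mpolys_def zero_A)
lemma mpolys_diff: "F \<in> mpolys A N \<Longrightarrow> G \<in> mpolys A N \<Longrightarrow> F - G \<in> mpolys A N"
  using keys_diff[of F G] by (auto simp: mpolys_def lookup_minus diff_A) blast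
lemma mpolys_add: "F \<in> mpolys A N \<Longrightarrow> G \<in> mpolys A N \<Longrightarrow> F + G \<in> mpolys A N"
  using mpolys_diff[of F N "0 - G"] mpolys_diff[OF mpolys_0, of G N] by simp
lemma mpolys_mult: "F \<in> mpolys A N \<Longrightarrow> G \<in> mpolys A N \<Longrightarrow> F * G \<in> mpolys A N"
proof -
  assume F: "F \<in> mpolys A N" and G: "G \<in> mpolys A N"
  have "pkeys m \<subseteq> {..N}" if m: "m \<in> pkeys (F * G)" for m
  proof -
    obtain a b where "m = a + b" "a \<in> pkeys F" "b \<in> pkeys G" using keys_mult m by blast
    then show ?thesis using F G Poly_Mapping.keys_add[of a b] by (fastforce simp: mpolys_def)
  qed
  then show ?thesis using over_mult[OF over_mpolys[OF F] over_mpolys[OF G]]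
    by (simp add: mpolys_def over_def)
qed
lemma mpolys_single: "c \<in> A \<Longrightarrow> pkeys m \<subseteq> {..N} \<Longrightarrow> psingle m c \<in> mpolys A N"
  by (auto simp: mpolys_def lookup_single when_def zero_A split: if_splits)
lemma mpolys_1: "1 \<in> mpolys A N" using mpolys_single[OF one_A, of 0 N] by simp
lemma mpolys_mconst: "c \<in> A \<Longrightarrow> mconst c \<in> mpolys A N"
  unfolding mconst_def by (rule mpolys_single) auto
lemma mpolys_mvar: "i \<le> N \<Longrightarrow> mvar i \<in> mpolys A N"
  unfolding mvar_def by (rule mpolys_single) (auto simp: one_A)
lemma mpolys_power: "F \<in> mpolys A N \<Longrightarrow> F ^ k \<in> mpolys A N"
  by (induction k) (auto intro: mpolys_1 mpolys_mult)
lemma mpolys_prod: "(\<And>i. i \<in> S \<Longrightarrow> g i \<in> mpolys A N) \<Longrightarrow> prod g S \<in> mpolys A N"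
  by (induction S rule: infinite_finite_induct) (auto intro: mpolys_1 mpolys_mult)
lemma mpolys_sum: "(\<And>i. i \<in> S \<Longrightarrow> g i \<in> mpolys A N) \<Longrightarrow> sum g S \<in> mpolys A N"
  by (induction S rule: infinite_finite_induct) (auto intro: mpolys_0 mpolys_add)

lemma mpeval_add: "over F \<Longrightarrow> over G \<Longrightarrow> mpeval h b (F + G) = mpeval h b F + mpeval h b G"
proof -
  assume F: "over F" and G: "over G"
  let ?S = "pkeys F \<union> pkeys G"
  have "pkeys (F + G) \<subseteq> ?S" by (rule Poly_Mapping.keys_add)
  then show ?thesis using F G
    by (simp add: mpeval_superset[of ?S] h_zero lookup_add over_def h_add distrib_right sum.distrib)
qed
lemma mpeval_0: "mpeval h b 0 = 0" by (simp add: mpeval_def)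
lemma mpeval_sum: "(\<And>i. i \<in> S \<Longrightarrow> over (g i)) \<Longrightarrow> mpeval h b (sum g S) = (\<Sum>i\<in>S. mpeval h b (g i))"
  by (induction S rule: infinite_finite_induct) (auto simp: mpeval_0 mpeval_add over_sum)
lemma mpeval_mult: "over F \<Longrightarrow> over G \<Longrightarrow> mpeval h b (F * G) = mpeval h b F * mpeval h b G"
proof -
  assume F: "over F" and G: "over G"
  have "mpeval h b (F * G) = (\<Sum>m\<in>pkeys F. \<Sum>m'\<in>pkeys G. mpeval h b (psingle (m + m') (plook F m * plook G m')))"
  proof -
    have t: "over (psingle (m + m') (plook F m * plook G m'))" for m m'
      using F G by (intro over_single mult_A) (auto simp: over_def)
    have "mpeval h b (F * G) = (\<Sum>m\<in>pkeys F. mpeval h b (\<Sum>m'\<in>pkeys G. psingle (m + m') (plook F m * plook G m')))"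
      unfolding mpoly_mult_expand by (rule mpeval_sum) (rule over_sum, rule t)
    then show ?thesis by (simp add: mpeval_sum t)
  qed
  also have "\<dots> = mpeval h b F * mpeval h b G"
    using F G unfolding sum_product mpeval_mpow[of h b F] mpeval_mpow[of h b G]
    by (intro sum.cong) (auto simp: mpeval_single h_zero h_mult over_def mpow_add mult_ac)
  finally show ?thesis .
qed
lemma mpeval_diff: "over F \<Longrightarrow> over G \<Longrightarrow> mpeval h b (F - G) = mpeval h b F - mpeval h b G"
  using mpeval_add[of "F - G" G b] over_diff[of F G] by (simp add: algebra_simps)
lemma mpeval_1: "mpeval h b 1 = 1"
  using mpeval_single[of h b 0 1, OF h_zero] h_one by simp
lemma mpeval_power: "over F \<Longrightarrow> mpeval h b (F ^ k) = mpeval h b F ^ k"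
proof -
  assume F: "over F"
  have "over (F ^ k)" for k by (induction k) (auto intro: over_1 over_mult F)
  then show ?thesis by (induction k) (auto simp: mpeval_1 mpeval_mult F)
qed
lemma over_prod: "(\<And>i. i \<in> S \<Longrightarrow> over (g i)) \<Longrightarrow> over (prod g S)"
  by (induction S rule: infinite_finite_induct) (auto intro: over_1 over_mult)
lemma mpeval_prod: "(\<And>i. i \<in> S \<Longrightarrow> over (g i)) \<Longrightarrow> mpeval h b (prod g S) = (\<Prod>i\<in>S. mpeval h b (g i))"
  by (induction S rule: infinite_finite_induct) (auto simp: mpeval_1 mpeval_mult over_prod)

lemma mpeval_id_A: "over F \<Longrightarrow> (\<And>i. i \<le> N \<Longrightarrow> a i \<in> A) \<Longrightarrow> F \<in> mpolys B N \<Longrightarrow> mpeval id a F \<in> A"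
  unfolding mpeval_mpow mpow_def
  by (intro sum_A mult_A prod_A power_A) (auto simp: over_def mpolys_def, blast)
lemma h_mpeval_id: "(\<And>i. i \<le> N \<Longrightarrow> a i \<in> A) \<Longrightarrow> F \<in> mpolys A N \<Longrightarrow>
    h (mpeval id a F) = mpeval h (\<lambda>i. h (a i)) F"
proof -
  assume a: "\<And>i. i \<le> N \<Longrightarrow> a i \<in> A" and F: "F \<in> mpolys A N"
  have ai: "a i \<in> A" if "m \<in> pkeys F" "i \<in> pkeys m" for m i using a F that by (auto simp: mpolys_def)
  have F': "plook F m \<in> A" for m using F by (simp add: mpolys_def)
  have "h (mpeval id a F) = (\<Sum>m\<in>pkeys F. h (plook F m * (\<Prod>i\<in>pkeys m. a i ^ plook m i)))"
    unfolding mpeval_def id_apply using ai F' by (intro h_sum mult_A prod_A power_A) auto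
  also have "\<dots> = mpeval h (\<lambda>i. h (a i)) F"
    unfolding mpeval_def using ai F'
    by (intro sum.cong refl) (simp add: h_mult h_prod h_power prod_A power_A)
  finally show ?thesis .
qed

end

lemma partial_hom_id: "partial_hom UNIV (id :: 'a::comm_ring_1 \<Rightarrow> 'a)"
  by unfold_locales auto

lemma mpeval_mpsubst:
  fixes a :: "nat \<Rightarrow> 'a::comm_ring_1"
  shows "mpeval id a (mpsubst \<psi> G) = mpeval id (\<lambda>i. mpeval id a (\<psi> i)) G"
proof -
  interpret partial_hom UNIV "id :: 'a \<Rightarrow> 'a" by (rule partial_hom_id)
  have [simp]: "over F" for F by (simp add: over_def)
  have "mpeval id a (mpsubst \<psi> G) =
     (\<Sum>m\<in>pkeys G. mpeval id a (mconst (plook G m)) * (\<Prod>i\<in>pkeys m. mpeval id a (\<psi> i) ^ plook m i))"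
    unfolding mpeval_def[of mconst] by (simp add: mpeval_sum mpeval_mult mpeval_prod mpeval_power)
  also have "\<dots> = mpeval id (\<lambda>i. mpeval id a (\<psi> i)) G"
    unfolding mpeval_def[of id _ G] by (intro sum.cong) (auto simp: mconst_def mpeval_single)
  finally show ?thesis .
qed

text \<open>The homogeneous component of degree \<open>e\<close>.\<close>
definition hcomp :: "nat \<Rightarrow> 'a::comm_monoid_add mpoly \<Rightarrow> 'a mpoly" where
  "hcomp e F = (\<Sum>m\<in>{m \<in> pkeys F. mdeg m = e}. psingle m (plook F m))"

lemma lookup_hcomp: "plook (hcomp e F) m = (if mdeg m = e then plook F m else 0)"
  unfolding hcomp_def by (auto simp: lookup_sum lookup_single when_def in_keys_iff)

lemma keys_hcomp: "pkeys (hcomp e F) = {m \<in> pkeys F. mdeg m = e}"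
  by (auto simp: in_keys_iff lookup_hcomp split: if_splits)

lemma homogeneous_hcomp: "homogeneous e (hcomp e F)"
  by (simp add: homogeneous_mdeg keys_hcomp)

lemma hcomp_homogeneous: "homogeneous e F \<Longrightarrow> hcomp e' F = (if e' = e then F else 0)"
  by (rule poly_mapping_eqI) (auto simp: lookup_hcomp homogeneous_mdeg in_keys_iff)

lemma hcomp_mpolys: "0 \<in> A \<Longrightarrow> F \<in> mpolys A N \<Longrightarrow> hcomp e F \<in> mpolys A N"
  by (auto simp: mpolys_def lookup_hcomp keys_hcomp)

lemma hcomp_decomposition: "(\<Sum>e\<in>mdeg ` pkeys F. hcomp e F) = F"
  by (rule poly_mapping_eqI) (auto simp: lookup_sum lookup_hcomp in_keys_iff sum.delta)

lemma hcomp_eq_0: "e \<notin> mdeg ` pkeys F \<Longrightarrow> hcomp e F = 0"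
  by (rule poly_mapping_eqI) (auto simp: lookup_hcomp in_keys_iff)

context partial_hom begin

lemma mpeval_decomposition:
  "over F \<Longrightarrow> mpeval h (\<lambda>i. c * b i) F = (\<Sum>e\<in>mdeg ` pkeys F. c ^ e * mpeval h b (hcomp e F))"
proof -
  assume F: "over F"
  have "over (hcomp e F)" for e using F by (auto simp: over_def lookup_hcomp zero_A)
  then have "mpeval h (\<lambda>i. c * b i) F = (\<Sum>e\<in>mdeg ` pkeys F. mpeval h (\<lambda>i. c * b i) (hcomp e F))"
    using mpeval_sum[of "mdeg ` pkeys F" "\<lambda>e. hcomp e F"] by (simp add: hcomp_decomposition)
  then show ?thesis by (simp add: mpeval_scale[OF homogeneous_hcomp])
qed

text \<open>The homogeneous ideal of polynomials over \<open>A\<close> that vanish, after applying \<open>h\<close>, at the point with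
  coordinates \<open>b\<close>.\<close>
definition cone_ideal :: "nat \<Rightarrow> (nat \<Rightarrow> 'b) \<Rightarrow> 'a mpoly set" where
  "cone_ideal N b = {F \<in> mpolys A N. \<forall>e. mpeval h b (hcomp e F) = 0}"

end

lemma mpeval_const_poly: "mpeval (\<lambda>c. [:h c:]) (\<lambda>i. [:b i:]) F = [:mpeval h b F:]"
proof -
  have p: "(\<Prod>i\<in>S. [:g i:]) = [:\<Prod>i\<in>S. g i:]" for S and g :: "nat \<Rightarrow> 'a::comm_semiring_1"
    by (induction S rule: infinite_finite_induct) (auto simp: one_pCons mult.commute)
  have w: "[:x:] ^ k = [:x ^ k:]" for x :: 'a and k
    by (induction k) (auto simp: one_pCons mult.commute)
  have s: "(\<Sum>i\<in>S. [:g i:]) = [:\<Sum>i\<in>S. g i:]" for S and g :: "(nat \<Rightarrow>\<^sub>0 nat) \<Rightarrow> 'a"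
    by (induction S rule: infinite_finite_induct) auto
  show ?thesis unfolding mpeval_def by (simp add: p w s mult.commute)
qed

locale partial_hom_idom = partial_hom A h for A :: "'a::comm_ring_1 set" and h :: "'a \<Rightarrow> 'b::idom"
begin

lemma poly_hom: "partial_hom A (\<lambda>c. [:h c:])"
  by unfold_locales (auto simp: one_A diff_A mult_A h_add h_mult h_one one_pCons)

text \<open>Evaluation at the generic point \<open>(b\<^sub>i t)\<^sub>i\<close> of the line through \<open>b\<close>; its coefficients are the
  values of the homogeneous components.\<close>
definition cone_eval :: "(nat \<Rightarrow> 'b) \<Rightarrow> 'a mpoly \<Rightarrow> 'b poly" where
  "cone_eval b F = mpeval (\<lambda>c. [:h c:]) (\<lambda>i. [:0, 1:] * [:b i:]) F"

lemma coeff_cone_eval: "over F \<Longrightarrow> coeff (cone_eval b F) e = mpeval h b (hcomp e F)"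
proof -
  assume F: "over F"
  have "cone_eval b F = (\<Sum>e\<in>mdeg ` pkeys F. [:0, 1:] ^ e * [:mpeval h b (hcomp e F):])"
    unfolding cone_eval_def using partial_hom.mpeval_decomposition[OF poly_hom, of F "[:0, 1:]" "\<lambda>i. [:b i:]"] F
    by (simp add: mpeval_const_poly partial_hom.over_def[OF poly_hom] over_def)
  also have "\<dots> = (\<Sum>e\<in>mdeg ` pkeys F. monom (mpeval h b (hcomp e F)) e)"
    by (simp add: monom_altdef)
  finally have "coeff (cone_eval b F) e = (\<Sum>e'\<in>mdeg ` pkeys F. if e' = e then mpeval h b (hcomp e F) else 0)"
    by (simp add: coeff_sum cong: if_cong)
  also have "\<dots> = mpeval h b (hcomp e F)"
    using hcomp_eq_0[of e F] by (auto simp: mpeval_0)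
  finally show ?thesis .
qed

lemma cone_ideal_iff: "F \<in> mpolys A N \<Longrightarrow> F \<in> cone_ideal N b \<longleftrightarrow> cone_eval b F = 0"
  using coeff_cone_eval[OF over_mpolys] unfolding cone_ideal_def by (auto simp: poly_eq_iff)

end

lemma cring_ring_on:
  fixes S :: "'a::comm_ring_1 set"
  assumes "1 \<in> S" "\<And>x y. x \<in> S \<Longrightarrow> y \<in> S \<Longrightarrow> x - y \<in> S" "\<And>x y. x \<in> S \<Longrightarrow> y \<in> S \<Longrightarrow> x * y \<in> S"
  shows "cring (ring_on S)"
proof -
  have z: "0 \<in> S" using assms(2)[OF assms(1,1)] by simp
  have n: "- x \<in> S" if "x \<in> S" for x using assms(2)[OF z that] by simp
  have a: "x + y \<in> S" if "x \<in> S" "y \<in> S" for x y using assms(2)[OF that(1) n[OF that(2)]] by simp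
  show ?thesis
  proof (rule cringI)
    show "abelian_group (ring_on S)"
      by (rule abelian_groupI) (auto simp: ring_on_def z a algebra_simps intro!: bexI[OF _ n])
    show "comm_monoid (ring_on S)"
      by (rule comm_monoidI) (auto simp: ring_on_def assms algebra_simps)
  qed (auto simp: ring_on_def algebra_simps)
qed

lemma ideal_ring_onI:
  fixes S :: "'a::comm_ring_1 set"
  assumes cr: "cring (ring_on S)" and J: "J \<subseteq> S" "0 \<in> J" "\<And>x y. x \<in> J \<Longrightarrow> y \<in> J \<Longrightarrow> x + y \<in> J"
    "\<And>x y. x \<in> J \<Longrightarrow> y \<in> S \<Longrightarrow> y * x \<in> J"
  shows "ideal J (ring_on S)"
proof (rule idealI)
  interpret cring "ring_on S" by (rule cr)
  show "ring (ring_on S)" by (rule ring_axioms)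
  have m1: "- 1 \<in> S"
  proof -
    obtain y where y: "y \<in> S" "y + 1 = 0"
      using add.l_inv_ex[of "\<one>\<^bsub>ring_on S\<^esub>"] one_closed by (auto simp: ring_on_def)
    then show ?thesis by (metis add_eq_0_iff2)
  qed
  have neg: "- x \<in> J" if "x \<in> J" for x using J(4)[OF that m1] by simp
  show "subgroup J (add_monoid (ring_on S))"
  proof (rule add.subgroupI)
    fix a assume a: "a \<in> J"
    have "\<ominus>\<^bsub>ring_on S\<^esub> a = - a"
      using a J(1) neg by (intro minus_equality) (auto simp: ring_on_def)
    then show "\<ominus>\<^bsub>ring_on S\<^esub> a \<in> J" using neg[OF a] by simp
  qed (use J in \<open>auto simp: ring_on_def\<close>)
qed (use J in \<open>auto simp: ring_on_def mult.commute\<close>)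

lemma ideal_ring_onD:
  assumes "ideal J (ring_on S)"
  shows "J \<subseteq> S" "0 \<in> J" "x \<in> J \<Longrightarrow> y \<in> J \<Longrightarrow> x + y \<in> J" "x \<in> J \<Longrightarrow> y \<in> S \<Longrightarrow> y * x \<in> J"
    "x \<in> J \<Longrightarrow> y \<in> S \<Longrightarrow> x * y \<in> J"
proof -
  interpret ideal J "ring_on S" by (rule assms)
  show "J \<subseteq> S" "0 \<in> J" "x \<in> J \<Longrightarrow> y \<in> J \<Longrightarrow> x + y \<in> J" "x \<in> J \<Longrightarrow> y \<in> S \<Longrightarrow> y * x \<in> J"
    "x \<in> J \<Longrightarrow> y \<in> S \<Longrightarrow> x * y \<in> J"
    using Icarr additive_subgroup.zero_closed[OF additive_subgroup_axioms]
      additive_subgroup.a_closed[OF additive_subgroup_axioms] I_l_closed I_r_closed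
    by (auto simp: ring_on_def)
qed

lemma ideal_ring_on_sum:
  assumes J: "ideal J (ring_on S)" and g: "\<And>i. g i \<in> J"
  shows "sum g T \<in> J"
  by (induction T rule: infinite_finite_induct) (simp_all add: ideal_ring_onD(2,3)[OF J] g)

context partial_hom begin
lemma cring_mpolys: "cring (mpoly_ring A N)"
  by (rule cring_ring_on) (auto intro: mpolys_1 mpolys_diff mpolys_mult)
end

context partial_hom_idom begin

text \<open>The ideal is prime as the kernel of \<open>cone_eval\<close>, whose values lie in a domain. Using a variable
  \<open>t\<close> instead of all scalars matters because the residue field is finite.\<close>
lemma proj_point_cone_ideal:
  assumes i: "i \<le> N" "b i \<noteq> 0"
  shows "proj_point A N (cone_ideal N b)"
  unfolding proj_point_def
proof (intro conjI)
  have sub: "cone_ideal N b \<subseteq> mpolys A N" by (auto simp: cone_ideal_def)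
  have ev_add: "cone_eval b (F + G) = cone_eval b F + cone_eval b G"
    and ev_mult: "cone_eval b (F * G) = cone_eval b F * cone_eval b G"
    if "F \<in> mpolys A N" "G \<in> mpolys A N" for F G
    using that partial_hom.mpeval_add[OF poly_hom] partial_hom.mpeval_mult[OF poly_hom]
      partial_hom.over_mpolys[OF poly_hom] unfolding cone_eval_def by blast+
  have id: "ideal (cone_ideal N b) (mpoly_ring A N)"
  proof (rule ideal_ring_onI[OF cring_mpolys sub])
    show "0 \<in> cone_ideal N b" using cone_ideal_iff[OF mpolys_0, of N b]
      by (simp add: cone_eval_def mpeval_def)
  next
    fix F G assume FG: "F \<in> cone_ideal N b" "G \<in> cone_ideal N b"
    then have m: "F \<in> mpolys A N" "G \<in> mpolys A N" using sub by auto
    then have "cone_eval b (F + G) = 0" using FG by (simp add: ev_add cone_ideal_iff)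
    then show "F + G \<in> cone_ideal N b" by (simp only: cone_ideal_iff[OF mpolys_add[OF m]])
  next
    fix F G assume FG: "F \<in> cone_ideal N b" "G \<in> mpolys A N"
    then have m: "F \<in> mpolys A N" using sub by auto
    then have "cone_eval b (G * F) = 0" using FG by (simp add: ev_mult cone_ideal_iff)
    then show "G * F \<in> cone_ideal N b" by (simp only: cone_ideal_iff[OF mpolys_mult[OF FG(2) m]])
  qed
  show pr: "primeideal (cone_ideal N b) (mpoly_ring A N)"
  proof (rule primeidealI[OF id cring_mpolys])
    have "cone_eval b 1 = 1" unfolding cone_eval_def by (rule partial_hom.mpeval_1[OF poly_hom])
    then have "1 \<notin> cone_ideal N b" using cone_ideal_iff[OF mpolys_1] by simp
    then show "carrier (mpoly_ring A N) \<noteq> cone_ideal N b" using mpolys_1 by (auto simp: ring_on_def)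
  next
    fix F G assume "F \<in> carrier (mpoly_ring A N)" "G \<in> carrier (mpoly_ring A N)"
      "F \<otimes>\<^bsub>mpoly_ring A N\<^esub> G \<in> cone_ideal N b"
    then have FG: "F \<in> mpolys A N" "G \<in> mpolys A N" "F * G \<in> cone_ideal N b" by (auto simp: ring_on_def)
    then have "cone_eval b F * cone_eval b G = 0"
      using cone_ideal_iff[OF mpolys_mult[OF FG(1,2)]] ev_mult by simp
    then show "F \<in> cone_ideal N b \<or> G \<in> cone_ideal N b" using FG cone_ideal_iff by auto
  qed
  let ?H = "{F \<in> cone_ideal N b. \<exists>e. homogeneous e F}"
  interpret C: cring "mpoly_ring A N" by (rule cring_mpolys)
  have "?H \<subseteq> carrier (mpoly_ring A N)" using sub by (auto simp: ring_on_def)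
  then have idH: "ideal (Idl\<^bsub>mpoly_ring A N\<^esub> ?H) (mpoly_ring A N)" and HI: "?H \<subseteq> Idl\<^bsub>mpoly_ring A N\<^esub> ?H"
    by (rule C.genideal_ideal, rule C.genideal_self)
  show "cone_ideal N b = Idl\<^bsub>mpoly_ring A N\<^esub> ?H"
  proof
    show "Idl\<^bsub>mpoly_ring A N\<^esub> ?H \<subseteq> cone_ideal N b" by (rule C.genideal_minimal[OF id]) auto
    show "cone_ideal N b \<subseteq> Idl\<^bsub>mpoly_ring A N\<^esub> ?H"
    proof
      fix F assume F: "F \<in> cone_ideal N b"
      have "hcomp e F \<in> ?H" for e
      proof -
        have "hcomp e F \<in> mpolys A N" using F hcomp_mpolys zero_A by (auto simp: cone_ideal_def)
        moreover have "mpeval h b (hcomp e' (hcomp e F)) = 0" for e'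
          using F hcomp_homogeneous[OF homogeneous_hcomp, of e' e F] mpeval_0
          by (auto simp: cone_ideal_def)
        ultimately show ?thesis using homogeneous_hcomp by (auto simp: cone_ideal_def)
      qed
      then have *: "hcomp e F \<in> Idl\<^bsub>mpoly_ring A N\<^esub> ?H" for e using HI by blast
      have "sum (\<lambda>e. hcomp e F) S \<in> Idl\<^bsub>mpoly_ring A N\<^esub> ?H" for S
        by (rule ideal_ring_on_sum[OF idH *])
      from this[of "mdeg ` pkeys F"] show "F \<in> Idl\<^bsub>mpoly_ring A N\<^esub> ?H"
        by (simp only: hcomp_decomposition)
    qed
  qed
  have "homogeneous 1 (mvar i :: 'a mpoly)"
    unfolding homogeneous_mdeg mvar_def by (auto simp: mdeg_def split: if_splits)
  then have "hcomp 1 (mvar i :: 'a mpoly) = mvar i" using hcomp_homogeneous by metis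
  then have "mpeval h b (hcomp 1 (mvar i)) \<noteq> 0" using i(2) mpeval_mvar[OF h_one h_zero] by metis
  then have "mvar i \<notin> cone_ideal N b" unfolding cone_ideal_def by blast
  then show "\<exists>i\<le>N. mvar i \<notin> cone_ideal N b" using i(1) by blast
qed

end

text \<open>The value at \<open>c a\<close> is a polynomial in \<open>c\<close> whose coefficients are the values of the homogeneous
  components at \<open>a\<close>, and an infinite field has enough scalars \<open>c\<close>.\<close>
lemma vanishing_components:
  fixes G :: "'a::field_char_0 mpoly"
  assumes "\<And>c. c \<noteq> 0 \<Longrightarrow> mpeval id (\<lambda>i. c * a i) G = 0"
  shows "mpeval id a (hcomp e G) = 0"
proof -
  interpret partial_hom_idom UNIV "id :: 'a \<Rightarrow> 'a" by unfold_locales auto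
  have ov: "over F" for F by (simp add: over_def)
  let ?q = "\<Sum>e\<in>mdeg ` pkeys G. monom (mpeval id a (hcomp e G)) e"
  have "poly ?q c = 0" if "c \<noteq> 0" for c
    using mpeval_decomposition[OF ov, of c a G] assms[OF that] by (simp add: poly_sum poly_monom mult.commute)
  then have "UNIV - {0} \<subseteq> {c. poly ?q c = 0}" by auto
  moreover have "infinite (UNIV - {0} :: 'a set)" using infinite_UNIV_char_0 by simp
  ultimately have "?q = 0" using poly_roots_finite finite_subset by blast
  then have "coeff ?q e = 0" by simp
  moreover have "coeff ?q e = (\<Sum>e'\<in>mdeg ` pkeys G. if e' = e then mpeval id a (hcomp e G) else 0)"
    by (simp add: coeff_sum cong: if_cong)
  ultimately show ?thesis using hcomp_eq_0[of e G] by (auto simp: mpeval_0 split: if_splits)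
qed

section \<open>Positivity of the degree\<close>

lemma finite_monomials_of_degree: "finite {m. pkeys m \<subseteq> {..N} \<and> mdeg m = t}" (is "finite ?M")
proof -
  let ?r = "\<lambda>m. restrict (plook m) {..N}"
  have "inj_on ?r ?M"
  proof (rule inj_onI)
    fix m m' assume m: "m \<in> ?M" "m' \<in> ?M" and eq: "?r m = ?r m'"
    show "m = m'"
    proof (rule poly_mapping_eqI)
      fix i
      show "plook m i = plook m' i"
      proof (cases "i \<le> N")
        case True then show ?thesis using fun_cong[OF eq, of i] by simp
      next
        case False
        then have "i \<notin> pkeys m" "i \<notin> pkeys m'" using m by auto
        then show ?thesis by (simp add: in_keys_iff)
      qed
    qed
  qed
  moreover have "?r ` ?M \<subseteq> {..N} \<rightarrow>\<^sub>E {..t}"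
  proof (intro image_subsetI PiE_I)
    fix m i assume m: "m \<in> ?M" and i: "i \<in> {..N}"
    have "plook m i \<le> (\<Sum>i\<le>N. plook m i)" using i by (intro member_le_sum) auto
    then show "?r m i \<in> {..t}" using m i mdeg_superset[of "{..N}" m] by auto
  qed auto
  moreover have "finite ({..N} \<rightarrow>\<^sub>E {..t})" by (intro finite_PiE) auto
  ultimately show ?thesis by (meson finite_imageD finite_subset)
qed

lemma mvar_power: "mvar i ^ t = psingle (psingle i t) (1::'a::comm_ring_1)"
proof (induction t)
  case (Suc t)
  have "psingle i 1 + psingle i t = psingle i (Suc t)"
    by (simp add: single_add[symmetric] One_nat_def)
  then show ?case unfolding power_Suc Suc by (simp add: mvar_def mult_single)
qed simp

text \<open>The power of a variable outside the ideal is a form of degree \<open>t\<close> outside the ideal.\<close>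
lemma hilbert_function_pos:
  fixes I :: "'a::field mpoly set"
  assumes "proj_variety N I"
  shows "hilbert_function N I t \<ge> 1"
proof -
  interpret U: partial_hom UNIV "id :: 'a \<Rightarrow> 'a" by (rule partial_hom_id)
  interpret V: vector_space "\<lambda>(c::'a) F. mconst c * (F :: 'a mpoly)"
    by unfold_locales
      (simp_all add: algebra_simps mconst_def single_add mult_single flip: mult.assoc)
  have pr: "primeideal I (mpoly_ring UNIV N)" and "\<exists>i\<le>N. mvar i \<notin> I"
    using assms by (auto simp: proj_point_def)
  then obtain i where i: "i \<le> N" "mvar i \<notin> I" by blast
  have id: "ideal I (mpoly_ring UNIV N)" using pr by (simp add: primeideal_def)
  let ?S = "{F :: 'a mpoly. F \<in> mpolys UNIV N \<and> homogeneous t F}" and ?I = "{F \<in> I. homogeneous t F}"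
  let ?M = "{m. pkeys m \<subseteq> {..N} \<and> mdeg m = t}"
  have S_span: "?S \<subseteq> V.span ((\<lambda>m. psingle m 1) ` ?M)"
  proof
    fix F assume F: "F \<in> ?S"
    have "F = (\<Sum>m\<in>pkeys F. mconst (plook F m) * psingle m 1)"
      using mpoly_expand[of F] by (simp add: mconst_def mult_single)
    also have "\<dots> \<in> V.span ((\<lambda>m. psingle m 1) ` ?M)"
      using F by (intro V.span_sum V.span_scale V.span_base imageI)
        (auto simp: mpolys_def homogeneous_mdeg)
    finally show "F \<in> V.span ((\<lambda>m. psingle m 1) ` ?M)" .
  qed
  have finM: "finite ((\<lambda>m. psingle m (1::'a)) ` ?M)" using finite_monomials_of_degree by (rule finite_imageI)
  obtain C where C: "C \<subseteq> ?S" "V.independent C" "?S \<subseteq> V.span C" "card C = V.dim ?S"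
    using V.basis_exists by blast
  have finC: "finite C" using V.independent_span_bound[OF finM C(2)] C(1) S_span by blast
  obtain B where B: "B \<subseteq> ?I" "V.independent B" "?I \<subseteq> V.span B" "card B = V.dim ?I"
    using V.basis_exists by blast
  have "V.subspace ?I"
  proof (rule V.subspaceI)
    show "0 \<in> ?I" using ideal_ring_onD(2)[OF id] by (simp add: homogeneous_mdeg)
  next
    fix F G assume FG: "F \<in> ?I" "G \<in> ?I"
    then have "F + G \<in> I" using ideal_ring_onD(3)[OF id] by blast
    then show "F + G \<in> ?I" using FG Poly_Mapping.keys_add[of F G] by (auto simp: homogeneous_mdeg)
  next
    fix c F assume F: "F \<in> ?I"
    then have "mconst c * F \<in> I" using ideal_ring_onD(4)[OF id, of F "mconst c"] U.mpolys_mconst by blast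
    moreover have "pkeys (mconst c * F) \<subseteq> pkeys F"
      using keys_mult[of "mconst c" F] by (auto simp: mconst_def split: if_splits)
    ultimately show "mconst c * F \<in> ?I" using F by (auto simp: homogeneous_mdeg)
  qed
  then have spanB: "V.span B \<subseteq> ?I" using B(1) V.span_minimal by blast
  let ?x = "mvar i ^ t :: 'a mpoly"
  have x_mp: "?x \<in> mpolys UNIV N" using i(1) by (intro U.mpolys_power U.mpolys_mvar)
  have "homogeneous t ?x"
    by (auto simp: homogeneous_mdeg mvar_power mdeg_def)
  then have xS: "?x \<in> ?S" using x_mp by simp
  have "mvar i ^ k \<notin> I" for k
  proof (induction k)
    case 0
    show ?case
    proof
      assume "mvar i ^ 0 \<in> I"
      then have "1 \<in> I" by simp
      then have "mvar i \<in> I" using ideal_ring_onD(4)[OF id, of 1 "mvar i"] U.mpolys_mvar[OF i(1)] by simp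
      then show False using i by simp
    qed
  next
    case (Suc k)
    then show ?case using primeideal.I_prime[OF pr, of "mvar i" "mvar i ^ k"] i
        U.mpolys_mvar[OF i(1)] U.mpolys_power by (auto simp: ring_on_def)
  qed
  then have "?x \<notin> V.span B" using spanB by auto
  then have ind: "V.independent (insert ?x B)" and "?x \<notin> B"
    using B(2) V.independent_insertI V.span_base by blast+
  have "B \<subseteq> ?S" using B(1) ideal_ring_onD(1)[OF id] by auto
  then have "insert ?x B \<subseteq> V.span C" using xS C(3) by blast
  then have "finite (insert ?x B)" "card (insert ?x B) \<le> card C"
    using V.independent_span_bound[OF finC ind] by auto
  then have "V.dim ?I + 1 \<le> V.dim ?S" using B(4) C(4) \<open>?x \<notin> B\<close> by simp
  then show ?thesis unfolding hilbert_function_def by linarith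
qed

text \<open>The Hilbert polynomial takes positive values, so it has a nonzero leading coefficient.\<close>
lemma degree_pos:
  fixes I :: "'a::field mpoly set"
  assumes "proj_variety N I" and "has_degree N I D"
  shows "D \<ge> 1"
proof -
  obtain h :: "rat poly" where h: "\<forall>\<^sub>F t in sequentially. poly h (of_nat t) = of_int (hilbert_function N I t)"
    "of_nat D = fact (degree h) * lead_coeff h" using assms(2) by (auto simp: has_degree_def)
  have "h \<noteq> 0"
  proof
    assume "h = 0"
    with h(1) obtain t where "(0::rat) = of_int (hilbert_function N I t)"
      by (auto simp: eventually_sequentially)
    then show False using hilbert_function_pos[OF assms(1), of t] by auto
  qed
  then have "(of_nat D :: rat) \<noteq> 0" unfolding h(2) by simp
  then show ?thesis by (cases D) auto
qed

lemma N_less_choose: "D \<ge> 1 \<Longrightarrow> N < ((N + D) choose N) - 1 + 1"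
proof -
  assume "D \<ge> 1"
  then have "(N + 1) choose N \<le> (N + D) choose N" by (intro binomial_right_mono) simp
  then show ?thesis by (simp add: One_nat_def)
qed

section \<open>Self-maps and their values at rational points\<close>

locale proj_ideal =
  fixes N :: nat and I :: "'a::field_char_0 mpoly set"
  assumes variety: "proj_variety N I"
begin

sublocale K: partial_hom_idom UNIV "id :: 'a \<Rightarrow> 'a" by unfold_locales auto

lemma over_UNIV [simp]: "K.over F" by (simp add: K.over_def)

lemma I_prime: "primeideal I (mpoly_ring UNIV N)" using variety by (simp add: proj_point_def)
lemma I_ideal: "ideal I (mpoly_ring UNIV N)" using I_prime by (simp add: primeideal_def)
lemmas I_sub = ideal_ring_onD(1)[OF I_ideal]
lemmas I_zero = ideal_ring_onD(2)[OF I_ideal]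
lemmas I_add = ideal_ring_onD(3)[OF I_ideal]
lemmas I_mult = ideal_ring_onD(4)[OF I_ideal]
lemmas I_mult_right = ideal_ring_onD(5)[OF I_ideal]

lemma I_uminus: "F \<in> I \<Longrightarrow> - F \<in> I"
  using I_mult[of F "0 - 1"] K.mpolys_diff[OF K.mpolys_0 K.mpolys_1] by simp
lemma I_primeD: "F \<in> mpolys UNIV N \<Longrightarrow> G \<in> mpolys UNIV N \<Longrightarrow> F * G \<in> I \<Longrightarrow> F \<in> I \<or> G \<in> I"
  using primeideal.I_prime[OF I_prime] by (simp add: ring_on_def)
lemma one_notin_I: "1 \<notin> I"
  using primeideal.I_notcarr[OF I_prime] I_mult[of 1] I_sub by (auto simp: ring_on_def)
lemma I_prime_power: "F \<in> mpolys UNIV N \<Longrightarrow> F ^ k \<in> I \<Longrightarrow> F \<in> I"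
proof (induction k)
  case 0 then show ?case using one_notin_I by simp
next
  case (Suc k)
  then show ?case using I_primeD[of F "F ^ k"] K.mpolys_power by auto
qed

text \<open>Congruence of polynomials modulo the ideal of the variety.\<close>
definition cg :: "'a mpoly \<Rightarrow> 'a mpoly \<Rightarrow> bool" where
  "cg F G \<longleftrightarrow> F \<in> mpolys UNIV N \<and> G \<in> mpolys UNIV N \<and> F - G \<in> I"

lemma cg_refl: "F \<in> mpolys UNIV N \<Longrightarrow> cg F F" by (simp add: cg_def I_zero)
lemma cg_add: "cg F G \<Longrightarrow> cg F' G' \<Longrightarrow> cg (F + F') (G + G')"
  using I_add[of "F - G" "F' - G'"] by (auto simp: cg_def K.mpolys_add algebra_simps)
lemma cg_mult: "cg F G \<Longrightarrow> cg F' G' \<Longrightarrow> cg (F * F') (G * G')"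
proof -
  assume a: "cg F G" "cg F' G'"
  have "F * F' - G * G' = (F - G) * F' + G * (F' - G')" by (simp add: algebra_simps)
  also have "\<dots> \<in> I" using a by (intro I_add I_mult I_mult_right) (auto simp: cg_def)
  finally show ?thesis using a by (simp add: cg_def K.mpolys_mult)
qed
lemma cg_power: "cg F G \<Longrightarrow> cg (F ^ k) (G ^ k)"
  by (induction k) (auto intro: cg_mult cg_refl K.mpolys_1)
lemma cg_prod: "(\<And>i. i \<in> S \<Longrightarrow> cg (g i) (g' i)) \<Longrightarrow> cg (prod g S) (prod g' S)"
  by (induction S rule: infinite_finite_induct) (auto intro: cg_mult cg_refl K.mpolys_1)
lemma cg_sum: "(\<And>i. i \<in> S \<Longrightarrow> cg (g i) (g' i)) \<Longrightarrow> cg (sum g S) (sum g' S)"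
  by (induction S rule: infinite_finite_induct) (auto intro: cg_add cg_refl K.mpolys_0)

lemma cg_mpsubst:
  assumes "\<And>i. i \<le> N \<Longrightarrow> cg (u i) (w i)" and G: "G \<in> mpolys UNIV N"
  shows "cg (mpsubst u G) (mpsubst w G)"
  unfolding mpeval_def
proof (intro cg_sum cg_mult cg_prod cg_power)
  fix m i assume "m \<in> pkeys G" "i \<in> pkeys m"
  then show "cg (u i) (w i)" using assms by (auto simp: mpolys_def)
qed (simp add: cg_refl K.mpolys_mconst)

lemma same_rational_map_sym: "same_rational_map N I g k \<Longrightarrow> same_rational_map N I k g"
  unfolding same_rational_map_def
proof (intro allI impI)
  fix i j assume h: "\<forall>i\<le>N. \<forall>j\<le>N. g i * k j - g j * k i \<in> I" and ij: "i \<le> N" "j \<le> N"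
  have "k i * g j - k j * g i = - (g i * k j - g j * k i)" by (simp add: algebra_simps)
  then show "k i * g j - k j * g i \<in> I" using h ij I_uminus by presburger
qed

lemma same_rational_map_trans:
  assumes fg: "same_rational_map N I f g" and gk: "same_rational_map N I g k"
    and mp: "\<And>i. i \<le> N \<Longrightarrow> f i \<in> mpolys UNIV N" "\<And>i. i \<le> N \<Longrightarrow> g i \<in> mpolys UNIV N"
      "\<And>i. i \<le> N \<Longrightarrow> k i \<in> mpolys UNIV N"
    and l: "l \<le> N" "g l \<notin> I"
  shows "same_rational_map N I f k"
  unfolding same_rational_map_def
proof (intro allI impI)
  fix i j assume ij: "i \<le> N" "j \<le> N"
  have "g l * (f i * k j - f j * k i) =
      k j * (f i * g l - f l * g i) + f l * (g i * k j - g j * k i) + k i * (f l * g j - f j * g l)"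
    by (simp add: algebra_simps)
  also have "\<dots> \<in> I"
    using fg gk ij l mp unfolding same_rational_map_def by (intro I_add I_mult) auto
  finally have gl: "g l * (f i * k j - f j * k i) \<in> I" .
  have "f i * k j - f j * k i \<in> mpolys UNIV N" using mp ij by (intro K.mpolys_diff K.mpolys_mult)
  then show "f i * k j - f j * k i \<in> I"
    using I_primeD[OF mp(2)[OF l(1)] _ gl] l(2) by blast
qed

lemma proj_class_scale: "c \<noteq> 0 \<Longrightarrow> proj_class (\<lambda>i. c * a i) = proj_class a"
  for a :: "nat \<Rightarrow> 'b::field"
proof -
  assume c: "c \<noteq> 0"
  show ?thesis unfolding proj_class_def
  proof (intro Collect_cong iffI; elim exE conjE)
    fix x d assume "x = (\<lambda>i. d * (c * a i))" "d \<noteq> 0"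
    then show "\<exists>d. x = (\<lambda>i. d * a i) \<and> d \<noteq> 0" using c by (intro exI[of _ "d * c"]) auto
  next
    fix x d assume "x = (\<lambda>i. d * a i)" "d \<noteq> 0"
    then show "\<exists>d. x = (\<lambda>i. d * (c * a i)) \<and> d \<noteq> 0" using c by (intro exI[of _ "d / c"]) auto
  qed
qed

lemma proj_class_self: "a \<in> proj_class a" for a :: "nat \<Rightarrow> 'b::field"
  unfolding proj_class_def by (auto intro: exI[of _ 1])

lemma proj_class_eq: "a \<in> proj_class b \<Longrightarrow> proj_class a = proj_class b" for a :: "nat \<Rightarrow> 'b::field"
  by (subst (asm) proj_class_def) (auto simp: proj_class_scale)

lemma proj_space_class: "P \<in> proj_space N \<Longrightarrow> a \<in> P \<Longrightarrow>
    P = proj_class a \<and> (\<exists>i\<le>N. a i \<noteq> 0) \<and> (\<forall>i>N. a i = 0)" for a :: "nat \<Rightarrow> 'b::field"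
proof -
  assume "P \<in> proj_space N" and a: "a \<in> P"
  then obtain b where b: "P = proj_class b" "\<exists>i\<le>N. b i \<noteq> 0" "\<forall>i>N. b i = 0"
    unfolding proj_space_def by blast
  obtain c where "c \<noteq> 0" "a = (\<lambda>i. c * b i)" using a b(1) unfolding proj_class_def by blast
  then show ?thesis using b proj_class_eq[of a b] a by auto
qed

definition tuple_point :: "(nat \<Rightarrow> 'a mpoly) \<Rightarrow> (nat \<Rightarrow> 'a) \<Rightarrow> (nat \<Rightarrow> 'a)" where
  "tuple_point \<psi> a = (\<lambda>i. if i \<le> N then mpeval id a (\<psi> i) else 0)"

lemma same_rational_map_eval:
  assumes P: "P \<in> zero_points id N I" "a \<in> P" and "same_rational_map N I g k" "i \<le> N" "j \<le> N"
  shows "mpeval id a (g i) * mpeval id a (k j) = mpeval id a (g j) * mpeval id a (k i)"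
proof -
  have "g i * k j - g j * k i \<in> I" using assms by (auto simp: same_rational_map_def)
  then have "mpeval id a (g i * k j - g j * k i) = 0" using P by (auto simp: zero_points_def)
  then show ?thesis by (simp add: K.mpeval_diff K.mpeval_mult)
qed

end

locale proj_self_map = proj_ideal N I for N and I :: "'a::field_char_0 mpoly set" +
  fixes f :: "nat \<Rightarrow> 'a mpoly"
  assumes self: "self_morphism UNIV N I f"
begin

abbreviation X :: "(nat \<Rightarrow> 'a) set set" where "X \<equiv> zero_points id N I"

lemma f_mpolys: "i \<le> N \<Longrightarrow> f i \<in> mpolys UNIV N"
  using self unfolding self_morphism_def homogeneous_tuple_def by blast
lemma f_nonzero: obtains l where "l \<le> N" "f l \<notin> I"
  using self unfolding self_morphism_def by blast
lemma f_subst: "G \<in> I \<Longrightarrow> mpsubst f G \<in> I"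
  using self unfolding self_morphism_def by blast

lemma tuple_mpolys: "homogeneous_tuple UNIV N \<psi> \<Longrightarrow> i \<le> N \<Longrightarrow> \<psi> i \<in> mpolys UNIV N"
  unfolding homogeneous_tuple_def by blast

lemma representatives_agree:
  assumes "homogeneous_tuple UNIV N \<psi>" "same_rational_map N I f \<psi>"
    "homogeneous_tuple UNIV N \<psi>'" "same_rational_map N I f \<psi>'"
  shows "same_rational_map N I \<psi> \<psi>'"
  using f_nonzero same_rational_map_trans[OF same_rational_map_sym[OF assms(2)] assms(4)]
    tuple_mpolys assms(1,3) f_mpolys by metis

text \<open>Any two tuples for the map are proportional modulo the ideal, hence at the given point.\<close>
lemma morphism_apply_eq:
  assumes \<psi>: "homogeneous_tuple UNIV N \<psi>" "same_rational_map N I f \<psi>"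
    and P: "P \<in> X" "a \<in> P" and nz: "i0 \<le> N" "mpeval id a (\<psi> i0) \<noteq> 0"
  shows "morphism_apply N I f P = proj_class (tuple_point \<psi> a)"
  unfolding morphism_apply_def
proof (rule the_equality)
  show "\<exists>\<psi>'. \<exists>a'\<in>P. homogeneous_tuple UNIV N \<psi>' \<and> same_rational_map N I f \<psi>' \<and>
      (\<exists>i\<le>N. mpeval id a' (\<psi>' i) \<noteq> 0) \<and>
      proj_class (tuple_point \<psi> a) = proj_class (\<lambda>i. if i \<le> N then mpeval id a' (\<psi>' i) else 0)"
    using assms unfolding tuple_point_def by blast
next
  fix R assume "\<exists>\<psi>'. \<exists>a'\<in>P. homogeneous_tuple UNIV N \<psi>' \<and> same_rational_map N I f \<psi>' \<and>
      (\<exists>i\<le>N. mpeval id a' (\<psi>' i) \<noteq> 0) \<and>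
      R = proj_class (\<lambda>i. if i \<le> N then mpeval id a' (\<psi>' i) else 0)"
  then obtain \<psi>' a' i1 where \<psi>': "homogeneous_tuple UNIV N \<psi>'" "same_rational_map N I f \<psi>'"
    and a': "a' \<in> P" and i1: "i1 \<le> N" "mpeval id a' (\<psi>' i1) \<noteq> 0"
    and R: "R = proj_class (tuple_point \<psi>' a')" unfolding tuple_point_def by blast
  have "P = proj_class a" using proj_space_class[of P a] P by (auto simp: zero_points_def)
  then obtain c where c: "c \<noteq> 0" "a' = (\<lambda>i. c * a i)" using a' unfolding proj_class_def by blast
  obtain e where e: "\<And>i. i \<le> N \<Longrightarrow> homogeneous e (\<psi>' i)"
    using \<psi>'(1) unfolding homogeneous_tuple_def by blast
  have sc: "mpeval id a' (\<psi>' i) = c ^ e * mpeval id a (\<psi>' i)" if "i \<le> N" for i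
    unfolding c(2) by (rule mpeval_scale[OF e[OF that]])
  have sm: "mpeval id a (\<psi> i) * mpeval id a (\<psi>' j) = mpeval id a (\<psi> j) * mpeval id a (\<psi>' i)"
    if "i \<le> N" "j \<le> N" for i j
    using same_rational_map_eval[OF P representatives_agree[OF \<psi> \<psi>'] that] .
  define d where "d = mpeval id a (\<psi>' i0) / mpeval id a (\<psi> i0)"
  have d: "mpeval id a (\<psi>' i) = d * mpeval id a (\<psi> i)" if "i \<le> N" for i
    using sm[OF that nz(1)] nz(2) by (simp add: d_def field_simps)
  have "d \<noteq> 0" using d[OF i1(1)] sc[OF i1(1)] i1(2) by auto
  have "tuple_point \<psi>' a' = (\<lambda>i. (c ^ e * d) * tuple_point \<psi> a i)"
    by (auto simp: tuple_point_def sc d fun_eq_iff)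
  then show "R = proj_class (tuple_point \<psi> a)"
    using R c(1) \<open>d \<noteq> 0\<close> proj_class_scale[of "c ^ e * d" "tuple_point \<psi> a"] by simp
qed

text \<open>The ideal is mapped to itself by the tuple \<open>f\<close>. For another tuple \<open>\<psi>\<close> of the same map,
  \<open>f\<^sub>l \<psi> \<equiv> \<psi>\<^sub>l f\<close>, so \<open>f\<^sub>l\<^sup>g G(\<psi>) \<equiv> \<psi>\<^sub>l\<^sup>g G(f)\<close> for \<open>G\<close> of degree \<open>g\<close>, and \<open>f\<^sub>l\<close> can be cancelled. The
  argument modulo the ideal is needed since \<open>f\<close> may vanish at the point where \<open>\<psi>\<close> is used.\<close>
lemma mpsubst_in_I:
  assumes \<psi>: "homogeneous_tuple UNIV N \<psi>" "same_rational_map N I f \<psi>"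
    and G: "G \<in> I" "homogeneous g G"
  shows "mpsubst \<psi> G \<in> I"
proof -
  obtain l where l: "l \<le> N" "f l \<notin> I" by (rule f_nonzero)
  have G': "G \<in> mpolys UNIV N" using G I_sub by auto
  have mpsubst_mp: "mpsubst \<psi> G \<in> mpolys UNIV N"
    unfolding mpeval_def using G' tuple_mpolys[OF \<psi>(1)]
    by (intro K.mpolys_sum K.mpolys_mult K.mpolys_prod K.mpolys_power K.mpolys_mconst)
      (auto simp: mpolys_def)
  have "cg (f l * \<psi> i) (\<psi> l * f i)" if "i \<le> N" for i
    using \<psi>(2) that l f_mpolys tuple_mpolys[OF \<psi>(1)]
    by (auto simp: cg_def same_rational_map_def K.mpolys_mult mult.commute)
  then have "cg (mpsubst (\<lambda>i. f l * \<psi> i) G) (mpsubst (\<lambda>i. \<psi> l * f i) G)"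
    by (rule cg_mpsubst[OF _ G'])
  then have "f l ^ g * mpsubst \<psi> G - \<psi> l ^ g * mpsubst f G \<in> I"
    by (simp add: cg_def mpeval_scale[OF G(2)])
  moreover have "\<psi> l ^ g * mpsubst f G \<in> I"
    using f_subst[OF G(1)] tuple_mpolys[OF \<psi>(1) l(1)] by (intro I_mult K.mpolys_power)
  ultimately have "f l ^ g * mpsubst \<psi> G \<in> I" using I_add by fastforce
  then have "f l ^ g \<in> I \<or> mpsubst \<psi> G \<in> I"
    using I_primeD K.mpolys_power[OF f_mpolys[OF l(1)]] mpsubst_mp by blast
  then show ?thesis using I_prime_power[OF f_mpolys[OF l(1)]] l(2) by blast
qed

text \<open>Vanishing of all multiples at a point defines an ideal, so it suffices to check homogeneous
  generators.\<close>
lemma tuple_point_in_X: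
  assumes \<psi>: "homogeneous_tuple UNIV N \<psi>" "same_rational_map N I f \<psi>"
    and P: "P \<in> X" "a \<in> P" and nz: "i0 \<le> N" "mpeval id a (\<psi> i0) \<noteq> 0"
  shows "proj_class (tuple_point \<psi> a) \<in> X"
proof -
  let ?b = "tuple_point \<psi> a"
  have ps: "proj_class ?b \<in> proj_space N"
    unfolding proj_space_def using nz by (auto simp: tuple_point_def intro!: exI[of _ ?b])
  define Z where "Z = {G \<in> mpolys UNIV N. \<forall>c. mpeval id (\<lambda>i. c * ?b i) G = 0}"
  interpret C: cring "mpoly_ring (UNIV :: 'a set) N" by (rule K.cring_mpolys)
  have Z: "ideal Z (mpoly_ring UNIV N)"
    by (rule ideal_ring_onI[OF K.cring_mpolys])
      (auto simp: Z_def K.mpolys_0 K.mpeval_0 K.mpolys_add K.mpeval_add K.mpolys_mult K.mpeval_mult)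
  have "{F \<in> I. \<exists>e. homogeneous e F} \<subseteq> Z"
  proof
    fix G assume "G \<in> {F \<in> I. \<exists>e. homogeneous e F}"
    then obtain g where G: "G \<in> I" "homogeneous g G" by blast
    have G': "G \<in> mpolys UNIV N" using G I_sub by auto
    have "mpeval id ?b G = mpeval id (\<lambda>i. mpeval id a (\<psi> i)) G"
      by (rule mpeval_vars_cong[OF G']) (simp add: tuple_point_def)
    also have "\<dots> = mpeval id a (mpsubst \<psi> G)" by (simp add: mpeval_mpsubst)
    also have "\<dots> = 0" using mpsubst_in_I[OF \<psi> G] P by (auto simp: zero_points_def)
    finally show "G \<in> Z" using G' by (simp add: Z_def mpeval_scale[OF G(2)])
  qed
  then have "Idl\<^bsub>mpoly_ring UNIV N\<^esub> {F \<in> I. \<exists>e. homogeneous e F} \<subseteq> Z"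
    by (rule C.genideal_minimal[OF Z])
  moreover have "I = Idl\<^bsub>mpoly_ring UNIV N\<^esub> {F \<in> I. \<exists>e. homogeneous e F}"
    using variety unfolding proj_point_def by (elim conjE)
  ultimately have "I \<subseteq> Z" by simp
  then have "mpeval id x F = 0" if "F \<in> I" "x \<in> proj_class ?b" for F x
    using that unfolding Z_def proj_class_def by blast
  then show ?thesis using ps by (simp add: zero_points_def)
qed

end

section \<open>Orbits under a map with good reduction\<close>

locale good_reduction_map = proj_self_map N I f + residue_map R \<pi> p v red
  for N and I :: "'a::field_char_0 mpoly set" and f and R \<pi> p v and red :: "'a \<Rightarrow> 'k::field" +
  fixes \<psi>\<^sub>0 :: "nat \<Rightarrow> 'a mpoly"
  assumes val: "x \<notin> R \<Longrightarrow> inverse x \<in> R"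
    and self_R: "self_morphism R N (closure_ideal R N I) \<psi>\<^sub>0"
    and same_\<psi>\<^sub>0: "same_rational_map N I f \<psi>\<^sub>0"
begin

sublocale k: partial_hom_idom R red
  by unfold_locales (auto simp: one_R diff_R mult_R red_add red_mult red_one)

text \<open>Coordinates of a point over the local ring whose first unit coordinate is \<open>1\<close>. They are
  determined by the point, and their reduction is determined by the reduction of the point.\<close>
definition normal :: "(nat \<Rightarrow> 'a) \<Rightarrow> bool" where
  "normal a \<longleftrightarrow> (\<forall>i. a i \<in> R) \<and> (\<exists>i0\<le>N. a i0 = 1 \<and> (\<forall>i<i0. a i \<in> pw 1))"

lemma one_notin_pw1: "1 \<notin> pw 1" using unit_notin_pw1[of 1] one_R by simp

text \<open>In a valuation ring divisibility is a total preorder, so one of finitely many elements divides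
  the others.\<close>
lemma dividing_coordinate:
  fixes a :: "nat \<Rightarrow> 'a"
  assumes "i \<le> n" "a i \<noteq> 0"
  shows "\<exists>l\<le>n. a l \<noteq> 0 \<and> (\<forall>i\<le>n. a i / a l \<in> R)"
  using assms
proof (induction n arbitrary: i)
  case 0 then show ?case using one_R by (intro exI[of _ 0]) auto
next
  case (Suc n)
  show ?case
  proof (cases "\<exists>i\<le>n. a i \<noteq> 0")
    case False
    then have "a (Suc n) \<noteq> 0" using Suc.prems by (metis le_SucE)
    then show ?thesis using False one_R zero_R
      by (intro exI[of _ "Suc n"]) (auto simp: le_Suc_eq)
  next
    case True
    then obtain l where l: "l \<le> n" "a l \<noteq> 0" "\<forall>i\<le>n. a i / a l \<in> R" using Suc.IH by blast
    show ?thesis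
    proof (cases "a (Suc n) / a l \<in> R")
      case True
      then show ?thesis using l by (intro exI[of _ l]) (auto simp: le_Suc_eq)
    next
      case False
      then have inv: "a l / a (Suc n) \<in> R" using val[OF False] by simp
      have nz: "a (Suc n) \<noteq> 0" using False zero_R by auto
      have "a i / a (Suc n) \<in> R" if "i \<le> n" for i
        using mult_R[OF l(3)[rule_format, OF that] inv] l(2) by simp
      then show ?thesis using nz one_R by (intro exI[of _ "Suc n"]) (auto simp: le_Suc_eq)
    qed
  qed
qed

lemma normal_exists:
  assumes P: "P \<in> proj_space N"
  shows "\<exists>a\<in>P. normal a"
proof -
  obtain a where a: "P = proj_class a" "\<exists>i\<le>N. a i \<noteq> 0" "\<forall>i>N. a i = 0"
    using P unfolding proj_space_def by blast
  obtain l where l: "l \<le> N" "a l \<noteq> 0" "\<forall>i\<le>N. a i / a l \<in> R" using dividing_coordinate a(2) by blast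
  have "\<exists>i. i \<le> N \<and> a i / a l \<notin> pw 1" using l one_notin_pw1 by (intro exI[of _ l]) auto
  define i0 where "i0 = (LEAST i. i \<le> N \<and> a i / a l \<notin> pw 1)"
  have i0: "i0 \<le> N" "a i0 / a l \<notin> pw 1"
    unfolding i0_def using LeastI_ex[OF \<open>\<exists>i. i \<le> N \<and> a i / a l \<notin> pw 1\<close>] by auto
  have below: "a i / a l \<in> pw 1" if "i < i0" for i
    using not_less_Least[of i "\<lambda>i. i \<le> N \<and> a i / a l \<notin> pw 1"] that i0(1) unfolding i0_def by auto
  have inv: "inverse (a i0 / a l) \<in> R" using unit_if_notin_pw1 l(3) i0 by blast
  have nz: "a i0 \<noteq> 0" using i0 zero_pw by auto
  define b where "b = (\<lambda>i. (1 / a i0) * a i)"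
  have b: "b i = (a i / a l) * inverse (a i0 / a l)" for i using l(2) nz by (simp add: b_def field_simps)
  have "b \<in> P" unfolding a(1) proj_class_def b_def using nz by (auto intro!: exI[of _ "1 / a i0"])
  moreover have "normal b"
    unfolding normal_def
  proof (intro conjI allI exI[of _ i0])
    fix i show "b i \<in> R"
    proof (cases "i \<le> N")
      case True then show ?thesis unfolding b using l(3) inv by (intro mult_R) auto
    next
      case False then show ?thesis using a(3) zero_R by (simp add: b_def)
    qed
  next
    show "b i0 = 1" using nz by (simp add: b_def)
    fix i show "i < i0 \<longrightarrow> b i \<in> pw 1" unfolding b using below inv mult_pw_right by blast
  qed (rule i0(1))
  ultimately show ?thesis by blast
qed

lemma normal_unique:
  assumes a: "normal a" and b: "normal b" and ab: "a \<in> proj_class b"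
  shows "a = b"
proof -
  obtain c where c: "c \<noteq> 0" "a = (\<lambda>i. c * b i)" using ab unfolding proj_class_def by blast
  obtain i where i: "a i = 1" "\<forall>l<i. a l \<in> pw 1" using a unfolding normal_def by blast
  obtain j where j: "b j = 1" "\<forall>l<j. b l \<in> pw 1" using b unfolding normal_def by blast
  have R: "a l \<in> R" "b l \<in> R" for l using a b by (auto simp: normal_def)
  have ab1: "b i * a j = 1" using c i(1) j(1) by (metis mult.commute mult.right_neutral)
  have "\<not> i < j" using j(2) mult_pw_right[of "b i" 1 "a j"] R ab1 one_notin_pw1 by auto
  moreover have "\<not> j < i" using i(2) mult_pw_left[of "b i" "a j" 1] R ab1 one_notin_pw1 by auto
  ultimately have "i = j" by simp
  then have "c = 1" using c i j by simp
  then show ?thesis using c by simp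
qed

definition rep :: "(nat \<Rightarrow> 'a) set \<Rightarrow> nat \<Rightarrow> 'a" where "rep P = (SOME a. a \<in> P \<and> normal a)"

lemma X_proj_space: "P \<in> X \<Longrightarrow> P \<in> proj_space N" by (simp add: zero_points_def)

lemma rep: "P \<in> X \<Longrightarrow> rep P \<in> P" "P \<in> X \<Longrightarrow> normal (rep P)"
  using someI_ex[of "\<lambda>a. a \<in> P \<and> normal a"] normal_exists[OF X_proj_space] unfolding rep_def by blast+

lemma rep_class: "P \<in> X \<Longrightarrow> P = proj_class (rep P)"
  using proj_space_class[OF X_proj_space rep(1)] by blast

lemma rep_outside: "P \<in> X \<Longrightarrow> i > N \<Longrightarrow> rep P i = 0"
  using proj_space_class[OF X_proj_space rep(1)] by blast

lemma rep_eqI: "P \<in> X \<Longrightarrow> a \<in> P \<Longrightarrow> normal a \<Longrightarrow> rep P = a"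
  using normal_unique[OF rep(2)] rep_class proj_class_eq rep(1) proj_space_class[OF X_proj_space] by metis

definition redrep :: "(nat \<Rightarrow> 'a) set \<Rightarrow> nat \<Rightarrow> 'k" where "redrep P i = red (rep P i)"

lemma rep_R: "P \<in> X \<Longrightarrow> rep P i \<in> R" using rep(2) by (auto simp: normal_def)

lemma red_mpeval: "P \<in> X \<Longrightarrow> F \<in> mpolys R N \<Longrightarrow>
    mpeval id (rep P) F \<in> R \<and> red (mpeval id (rep P) F) = mpeval red (redrep P) F"
  using k.mpeval_id_A[OF k.over_mpolys, of F N N "rep P" R] k.h_mpeval_id[of N "rep P" F] rep_R
  by (simp add: redrep_def[abs_def])

text \<open>Reductions of points of the variety lie on the special fibre of its closure, componentwise
  because the ideal of the closure contains inhomogeneous polynomials.\<close>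
lemma closure_ideal_vanishes:
  assumes P: "P \<in> X" and G: "G \<in> closure_ideal R N I"
  shows "mpeval red (redrep P) (hcomp e G) = 0"
proof -
  have G': "G \<in> I" "G \<in> mpolys R N" using G by (auto simp: closure_ideal_def)
  have "mpeval id (\<lambda>i. c * rep P i) G = 0" if "c \<noteq> 0" for c
  proof -
    have "(\<lambda>i. c * rep P i) \<in> P"
      by (subst rep_class[OF P]) (use that in \<open>auto simp: proj_class_def\<close>)
    then show ?thesis using P G'(1) by (auto simp: zero_points_def)
  qed
  then have "mpeval id (rep P) (hcomp e G) = 0" by (rule vanishing_components)
  moreover have "hcomp e G \<in> mpolys R N" using hcomp_mpolys[OF zero_R G'(2)] .
  ultimately show ?thesis using red_mpeval[OF P] red_zero by metis
qed

lemma redrep_normal: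
  assumes "P \<in> X"
  obtains i0 where "i0 \<le> N" "redrep P i0 = 1" "\<And>i. i < i0 \<Longrightarrow> redrep P i = 0"
proof -
  obtain i0 where i0: "i0 \<le> N" "rep P i0 = 1" "\<forall>i<i0. rep P i \<in> pw 1"
    using rep(2)[OF assms] unfolding normal_def by blast
  have "redrep P i = 0" if "i < i0" for i
    unfolding redrep_def using i0(3) that red_eq_0_iff[OF rep_R[OF assms]] by blast
  moreover have "redrep P i0 = 1" using i0(2) red_one by (simp add: redrep_def)
  ultimately show thesis using that i0(1) by blast
qed

text \<open>The tuple \<open>\<psi>\<close> over the local ring computes the map at all points with normalised reduction \<open>b\<close>,
  and \<open>i1\<close> is the index of the first unit coordinate of the image.\<close>
definition represents :: "(nat \<Rightarrow> 'a mpoly) \<Rightarrow> nat \<Rightarrow> (nat \<Rightarrow> 'k) \<Rightarrow> bool" where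
  "represents \<psi> i1 b \<longleftrightarrow> i1 \<le> N \<and> (\<forall>i\<le>N. \<psi> i \<in> mpolys R N) \<and>
     (\<forall>P\<in>X. redrep P = b \<longrightarrow> morphism_apply N I f P \<in> X \<and> mpeval id (rep P) (\<psi> i1) \<notin> pw 1 \<and>
        (\<forall>i\<le>N. rep (morphism_apply N I f P) i = mpeval id (rep P) (\<psi> i) / mpeval id (rep P) (\<psi> i1)))"

lemma representsD:
  assumes "represents \<psi> i1 b"
  shows "\<And>i. i \<le> N \<Longrightarrow> \<psi> i \<in> mpolys R N" "i1 \<le> N"
    "\<And>P. P \<in> X \<Longrightarrow> redrep P = b \<Longrightarrow> morphism_apply N I f P \<in> X"
    "\<And>P. P \<in> X \<Longrightarrow> redrep P = b \<Longrightarrow> mpeval id (rep P) (\<psi> i1) \<notin> pw 1"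
    "\<And>P i. P \<in> X \<Longrightarrow> redrep P = b \<Longrightarrow> i \<le> N \<Longrightarrow>
       rep (morphism_apply N I f P) i = mpeval id (rep P) (\<psi> i) / mpeval id (rep P) (\<psi> i1)"
  using assms unfolding represents_def by blast+

text \<open>The reduction of \<open>P\<^sub>0\<close> defines a point of the closure of the variety over \<open>R\<close>, the ideal
  \<open>cone_ideal\<close>. The extended map is given near it by a tuple \<open>\<psi>\<close> that does not vanish there. The
  values of \<open>\<psi>\<close> at points with this reduction have reductions that depend on the reduction only, so
  the first unit among them has the same index for all these points.\<close>
lemma local_representative:
  assumes P0: "P\<^sub>0 \<in> X"
  shows "\<exists>\<psi> i1. represents \<psi> i1 (redrep P\<^sub>0)"
proof -
  let ?b = "redrep P\<^sub>0" and ?J = "closure_ideal R N I"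
  obtain i0 where i0: "i0 \<le> N" "?b i0 = 1" using redrep_normal[OF P0] by metis
  have "proj_point R N (k.cone_ideal N ?b)" using i0 by (intro k.proj_point_cone_ideal) auto
  moreover have "?J \<subseteq> k.cone_ideal N ?b"
    using closure_ideal_vanishes[OF P0] by (auto simp: k.cone_ideal_def closure_ideal_def)
  ultimately have "k.cone_ideal N ?b \<in> scheme_points R N ?J" by (simp add: scheme_points_def)
  then obtain \<psi> where \<psi>: "\<psi> \<in> local_reps R N ?J \<psi>\<^sub>0 (k.cone_ideal N ?b)"
    using self_R unfolding self_morphism_def by blast
  obtain e where e: "\<And>i. i \<le> N \<Longrightarrow> \<psi> i \<in> mpolys R N" "\<And>i. i \<le> N \<Longrightarrow> homogeneous e (\<psi> i)"
    using \<psi> unfolding local_reps_def homogeneous_tuple_def by blast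
  have RU: "F \<in> mpolys R N \<Longrightarrow> F \<in> mpolys UNIV N" for F by (simp add: mpolys_def)
  have ht: "homogeneous_tuple UNIV N \<psi>" using e RU unfolding homogeneous_tuple_def by blast
  obtain i where i: "i \<le> N" "\<psi> i \<notin> k.cone_ideal N ?b" using \<psi> unfolding local_reps_def by blast
  then obtain e' where "mpeval red ?b (hcomp e' (\<psi> i)) \<noteq> 0" using e(1) by (auto simp: k.cone_ideal_def)
  then have "mpeval red ?b (\<psi> i) \<noteq> 0"
    using hcomp_homogeneous[OF e(2)[OF i(1)], of e'] k.mpeval_0 by (metis)
  then have ex: "\<exists>i. i \<le> N \<and> mpeval red ?b (\<psi> i) \<noteq> 0" using i by blast
  define i1 where "i1 = (LEAST i. i \<le> N \<and> mpeval red ?b (\<psi> i) \<noteq> 0)"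
  have i1: "i1 \<le> N" "mpeval red ?b (\<psi> i1) \<noteq> 0" unfolding i1_def using LeastI_ex[OF ex] by auto
  have below: "mpeval red ?b (\<psi> i) = 0" if "i < i1" for i
    using not_less_Least[of i "\<lambda>i. i \<le> N \<and> mpeval red ?b (\<psi> i) \<noteq> 0"] that i1(1) unfolding i1_def by auto
  obtain l where l: "l \<le> N" "\<psi>\<^sub>0 l \<notin> ?J" using self_R unfolding self_morphism_def by blast
  have \<psi>0: "\<And>i. i \<le> N \<Longrightarrow> \<psi>\<^sub>0 i \<in> mpolys R N"
    using self_R unfolding self_morphism_def homogeneous_tuple_def by blast
  have "\<psi>\<^sub>0 l \<notin> I" using l \<psi>0 by (auto simp: closure_ideal_def)
  moreover have "same_rational_map N I \<psi>\<^sub>0 \<psi>"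
    using \<psi> unfolding local_reps_def same_rational_map_def closure_ideal_def by blast
  ultimately have same: "same_rational_map N I f \<psi>"
    using same_rational_map_trans[OF same_\<psi>\<^sub>0 _ f_mpolys _ _ l(1)] \<psi>0 e(1) RU by blast
  have main: "morphism_apply N I f P \<in> X \<and> mpeval id (rep P) (\<psi> i1) \<notin> pw 1 \<and>
      (\<forall>i\<le>N. rep (morphism_apply N I f P) i = mpeval id (rep P) (\<psi> i) / mpeval id (rep P) (\<psi> i1))"
    if P: "P \<in> X" and eq: "redrep P = ?b" for P
  proof -
    let ?e = "\<lambda>i. mpeval id (rep P) (\<psi> i)"
    have eR: "?e i \<in> R" and red_e: "red (?e i) = mpeval red ?b (\<psi> i)" if "i \<le> N" for i
      using red_mpeval[OF P e(1)[OF that]] eq by auto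
    have unit: "?e i1 \<notin> pw 1" using red_eq_0_iff[OF eR[OF i1(1)]] red_e[OF i1(1)] i1(2) by simp
    then have nz: "?e i1 \<noteq> 0" using zero_pw by auto
    have inv: "inverse (?e i1) \<in> R" using unit_if_notin_pw1[OF eR[OF i1(1)] unit] .
    have app: "morphism_apply N I f P = proj_class (tuple_point \<psi> (rep P))"
      by (rule morphism_apply_eq[OF ht same P rep(1)[OF P] i1(1) nz])
    have inX: "morphism_apply N I f P \<in> X"
      unfolding app by (rule tuple_point_in_X[OF ht same P rep(1)[OF P] i1(1) nz])
    define b where "b = (\<lambda>i. inverse (?e i1) * tuple_point \<psi> (rep P) i)"
    have "b \<in> morphism_apply N I f P"
      unfolding app b_def proj_class_def using nz by (auto intro!: exI[of _ "inverse (?e i1)"])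
    moreover have "normal b"
      unfolding normal_def
    proof (intro conjI allI exI[of _ i1])
      fix i show "b i \<in> R" using inv eR mult_R zero_R by (auto simp: b_def tuple_point_def)
    next
      show "b i1 = 1" using nz i1 by (simp add: b_def tuple_point_def)
      fix i show "i < i1 \<longrightarrow> b i \<in> pw 1"
      proof
        assume "i < i1"
        then have iN: "i \<le> N" using i1(1) by simp
        have "?e i \<in> pw 1" using red_eq_0_iff[OF eR[OF iN]] red_e[OF iN] below[OF \<open>i < i1\<close>] by simp
        then show "b i \<in> pw 1" using inv iN by (simp add: b_def tuple_point_def mult_pw_left)
      qed
    qed (rule i1(1))
    ultimately have "rep (morphism_apply N I f P) = b" using rep_eqI[OF inX] by blast
    then show ?thesis using inX unit by (simp add: b_def tuple_point_def divide_inverse mult.commute)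
  qed
  then have "represents \<psi> i1 ?b" using e(1) i1(1) unfolding represents_def by blast
  then show ?thesis by blast
qed

lemma morphism_apply_X: "P \<in> X \<Longrightarrow> morphism_apply N I f P \<in> X"
  using local_representative[of P] representsD(3) by blast

lemma redrep_outside: "P \<in> X \<Longrightarrow> i > N \<Longrightarrow> redrep P i = 0"
  using rep_outside red_zero by (simp add: redrep_def)

text \<open>The map that the morphism induces on the reductions of rational points is well defined.\<close>
lemma redrep_morphism_apply:
  assumes P: "P \<in> X" and P': "P' \<in> X" and eq: "redrep P = redrep P'"
  shows "redrep (morphism_apply N I f P) = redrep (morphism_apply N I f P')"
proof -
  obtain \<psi> i1 where "represents \<psi> i1 (redrep P')" using local_representative[OF P'] by blast
  note \<psi> = representsD[OF this]
  have val: "redrep (morphism_apply N I f Q) i * mpeval red (redrep P') (\<psi> i1) = mpeval red (redrep P') (\<psi> i) \<and>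
      mpeval red (redrep P') (\<psi> i1) \<noteq> 0"
    if Q: "Q \<in> X" "redrep Q = redrep P'" and i: "i \<le> N" for Q i
  proof -
    let ?e = "\<lambda>i. mpeval id (rep Q) (\<psi> i)"
    have e: "?e i \<in> R \<and> red (?e i) = mpeval red (redrep P') (\<psi> i)" if "i \<le> N" for i
      using red_mpeval[OF Q(1) \<psi>(1)[OF that]] Q(2) by simp
    have nz: "?e i1 \<noteq> 0" using \<psi>(4)[OF Q] zero_pw by auto
    have "rep (morphism_apply N I f Q) i * ?e i1 = ?e i" using \<psi>(5)[OF Q i] nz by simp
    then have "redrep (morphism_apply N I f Q) i * red (?e i1) = red (?e i)"
      unfolding redrep_def using red_mult rep_R[OF morphism_apply_X[OF Q(1)]] e[OF \<psi>(2)] by metis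
    moreover have "red (?e i1) \<noteq> 0" using red_eq_0_iff e[OF \<psi>(2)] \<psi>(4)[OF Q] by blast
    ultimately show ?thesis using e i \<psi>(2) by metis
  qed
  show ?thesis
  proof
    fix i
    show "redrep (morphism_apply N I f P) i = redrep (morphism_apply N I f P') i"
    proof (cases "i \<le> N")
      case True
      then show ?thesis using val[OF P eq True] val[OF P' refl True] by (metis mult_right_cancel)
    next
      case False
      then show ?thesis using redrep_outside morphism_apply_X P P' by simp
    qed
  qed
qed

lemma redrep_zero_points: "P \<in> X \<Longrightarrow> proj_class (redrep P) \<in> zero_points red N (closure_ideal R N I)"
proof -
  assume P: "P \<in> X"
  obtain i0 where "i0 \<le> N" "redrep P i0 = 1" using redrep_normal[OF P] by metis
  then have ps: "proj_class (redrep P) \<in> proj_space N"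
    unfolding proj_space_def using redrep_outside[OF P] by (auto intro!: exI[of _ "redrep P"] exI[of _ i0])
  have "mpeval red a F = 0" if F: "F \<in> closure_ideal R N I" and a: "a \<in> proj_class (redrep P)" for F a
  proof -
    obtain c where a': "a = (\<lambda>i. c * redrep P i)" using a unfolding proj_class_def by blast
    have "k.over F" using F k.over_mpolys by (auto simp: closure_ideal_def)
    from k.mpeval_decomposition[OF this] show ?thesis
      unfolding a' using closure_ideal_vanishes[OF P F] by simp
  qed
  then show ?thesis using ps by (simp add: zero_points_def)
qed

lemma redrep_class_inj:
  assumes P: "P \<in> X" and P': "P' \<in> X" and eq: "proj_class (redrep P) = proj_class (redrep P')"
  shows "redrep P = redrep P'"
proof -
  obtain c where c: "c \<noteq> 0" "redrep P = (\<lambda>i. c * redrep P' i)"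
    using proj_class_self[of "redrep P"] unfolding eq unfolding proj_class_def by blast
  obtain i where i: "redrep P i = 1" "\<And>l. l < i \<Longrightarrow> redrep P l = 0" using redrep_normal[OF P] by metis
  obtain j where j: "redrep P' j = 1" "\<And>l. l < j \<Longrightarrow> redrep P' l = 0" using redrep_normal[OF P'] by metis
  have "\<not> i < j" using c i(1) j(2)[of i] by auto
  moreover have "\<not> j < i" using c i(2)[of j] j(1) by auto
  ultimately have "c = 1" using c(2) i(1) j(1) by (metis linorder_neqE_nat mult.right_neutral)
  then show ?thesis using c by simp
qed

end

lemma finite_proj_space:
  assumes "finite (UNIV :: 'k::field set)"
  shows "finite (proj_space N :: (nat \<Rightarrow> 'k) set set)"
proof -
  let ?ext = "\<lambda>a :: nat \<Rightarrow> 'k. \<lambda>i. if i \<le> N then a i else 0"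
  have "(proj_space N :: (nat \<Rightarrow> 'k) set set) \<subseteq> (\<lambda>a. proj_class (?ext a)) ` ({..N} \<rightarrow>\<^sub>E UNIV)"
  proof
    fix P :: "(nat \<Rightarrow> 'k) set" assume "P \<in> proj_space N"
    then obtain a where a: "P = proj_class a" "\<forall>i>N. a i = 0" unfolding proj_space_def by blast
    have "?ext (restrict a {..N}) = a" using a(2) by (auto simp: fun_eq_iff)
    then have "P = proj_class (?ext (restrict a {..N}))" using a(1) by simp
    moreover have "restrict a {..N} \<in> {..N} \<rightarrow>\<^sub>E UNIV" by simp
    ultimately show "P \<in> (\<lambda>a. proj_class (?ext a)) ` ({..N} \<rightarrow>\<^sub>E UNIV)" by (rule image_eqI)
  qed
  moreover have "finite ({..N} \<rightarrow>\<^sub>E (UNIV :: 'k set))" using assms by (intro finite_PiE) auto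
  ultimately show ?thesis by (meson finite_imageI finite_subset)
qed

context coordinate_sequences begin

lemma mpeval_gen:
  assumes F: "F \<in> mpolys R N"
  shows "(\<lambda>j. mpeval id (\<lambda>i. x i j) F) \<in> gen"
  unfolding mpeval_def
proof (intro gen_sum gen_mult gen_prod gen_power)
  fix m assume "m \<in> pkeys F"
  show "(\<lambda>j. id (plook F m)) \<in> gen" using F by (intro gen_const) (auto simp: mpolys_def)
  fix i assume "i \<in> pkeys m"
  then show "x i \<in> gen" using F \<open>m \<in> pkeys F\<close> by (intro gen_coord) (auto simp: mpolys_def)
qed

text \<open>In both rings the sequences that are inverted are those whose value at \<open>0\<close> is a unit, so it
  suffices to compare the coordinates.\<close>
lemma gen_subset:
  assumes "coordinate_sequences R \<pi> p v x' N" and "\<And>i. i \<le> N \<Longrightarrow> x' i \<in> gen"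
  shows "coordinate_sequences.gen R \<pi> x' N \<subseteq> gen"
proof
  interpret C: coordinate_sequences R \<pi> p v x' N by (rule assms(1))
  fix u assume "u \<in> C.gen"
  then show "u \<in> gen" by (induction rule: C.gen.induct) (auto intro: gen.intros assms(2))
qed

end

context good_reduction_map begin

text \<open>The reductions of the orbit form a cycle of length \<open>m\<close>. For each \<open>t\<close>, the points with index
  \<open>t + m j\<close> lie in one residue class, and the local representative there shows that the functions
  regular at the class of \<open>t + 1\<close> pull back to functions regular at the class of \<open>t\<close>. After \<open>m\<close>
  such steps, the ring attached to the class of \<open>0\<close> is invariant under the shift by \<open>m\<close>, and
  \<open>period_le\<close> bounds \<open>n / m\<close>.\<close>
theorem periodic_point_bound:
  assumes P: "P \<in> X" and per: "primitive_period (morphism_apply N I f) P n"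
    and fin: "finite (UNIV :: 'k set)" and m: "N < h"
  obtains e where "n \<le> card (zero_points red N (closure_ideal R N I)) * card (GL_mat h :: 'k mat set) * p ^ e"
    "e = 0 \<or> (p \<noteq> 2 \<and> 2 ^ (e - 1) \<le> v) \<or> (p = 2 \<and> fib e \<le> v)"
proof -
  let ?f = "morphism_apply N I f"
  define Pt where "Pt j = (?f ^^ j) P" for j
  have Pt_Suc: "Pt (Suc j) = ?f (Pt j)" for j by (simp add: Pt_def)
  have PtX: "Pt j \<in> X" for j
  proof (induction j)
    case 0
    have "Pt 0 = P" by (simp add: Pt_def)
    then show ?case using P by (simp only:)
  next
    case (Suc j)
    then show ?case unfolding Pt_Suc by (rule morphism_apply_X)
  qed
  have n1: "n \<ge> 1" and Ptn: "Pt n = P" and minimal: "\<And>m. 1 \<le> m \<Longrightarrow> m < n \<Longrightarrow> Pt m \<noteq> P"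
    using per by (auto simp: primitive_period_def Pt_def)
  have Pt_n: "Pt (j + n) = Pt j" for j
    using Ptn by (simp add: Pt_def funpow_add)
  have Pt_mult: "Pt (j + k * n) = Pt j" for j k
    by (induction k) (simp_all add: Pt_n add.assoc[symmetric] add.commute[of n])
  have Pt_eq: "n dvd j" if "Pt j = P" for j
  proof -
    have "Pt (j mod n) = Pt (j mod n + (j div n) * n)" by (simp only: Pt_mult)
    also have "\<dots> = P" using that by simp
    finally have "Pt (j mod n) = P" .
    then have "j mod n = 0" using minimal[of "j mod n"] n1 by (cases "j mod n = 0") (auto simp: Suc_le_eq One_nat_def)
    then show ?thesis by (simp add: mod_eq_0_iff_dvd)
  qed
  define b where "b j = redrep (Pt j)" for j
  have det: "b i = b j \<Longrightarrow> b (i + t) = b (j + t)" for i j t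
    by (induction t) (auto simp: b_def Pt_Suc intro: redrep_morphism_apply PtX)
  define m where "m = (LEAST m. m \<ge> 1 \<and> b m = b 0)"
  have "n \<ge> 1 \<and> b n = b 0" using n1 Ptn by (simp add: b_def Pt_def)
  then have m1: "m \<ge> 1" and bm: "b m = b 0"
    unfolding m_def using LeastI[of "\<lambda>m. m \<ge> 1 \<and> b m = b 0" n] by auto
  have least: "b i \<noteq> b 0" if "1 \<le> i" "i < m" for i
    using not_less_Least[of i "\<lambda>m. m \<ge> 1 \<and> b m = b 0"] that unfolding m_def by auto
  have b_m: "b (j + m) = b j" for j using det[OF bm, of j] by (simp add: add.commute)
  have b_mult: "b (j + m * k) = b j" for j k
    by (induction k) (simp_all add: b_m add.assoc[symmetric] add.commute[of m])
  have "m dvd n"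
  proof -
    have "b (n mod m) = b (n mod m + m * (n div m))" by (simp only: b_mult)
    also have "\<dots> = b 0" using Ptn by (simp add: b_def Pt_def)
    finally have "n mod m = 0" using least[of "n mod m"] m1
      by (cases "n mod m = 0") (auto simp: Suc_le_eq One_nat_def)
    then show ?thesis by (simp add: mod_eq_0_iff_dvd)
  qed
  then obtain n' where n': "n = m * n'" by (elim dvdE)
  have n'1: "n' \<ge> 1" using n1 n' by (cases n') (auto simp: One_nat_def)
  let ?Z = "zero_points red N (closure_ideal R N I)"
  have finZ: "finite ?Z" using finite_proj_space[OF fin] by (simp add: zero_points_def)
  have inj: "inj_on (\<lambda>j. proj_class (b j)) {..<m}"
  proof -
    have False if ij: "i < j" "j < m" and eq: "proj_class (b i) = proj_class (b j)" for i j
    proof -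
      have "b i = b j" using redrep_class_inj[OF PtX PtX] eq by (simp add: b_def)
      from det[OF this, of "m - j"] have "b (i + (m - j)) = b 0" using ij bm by simp
      moreover have "1 \<le> i + (m - j)" "i + (m - j) < m" using ij by linarith+
      ultimately show False using least by blast
    qed
    then show ?thesis unfolding inj_on_def by (metis lessThan_iff linorder_neqE_nat)
  qed
  have "m \<le> card ?Z"
    using card_inj_on_le[OF inj _ finZ] redrep_zero_points[OF PtX] by (auto simp: b_def)
  define a where "a j = rep (Pt j)" for j
  have aR: "a j i \<in> R" for i j using rep_R[OF PtX] by (simp add: a_def)
  define x where "x t i j = a (t + m * j) i" for t i j
  have coords: "coordinate_sequences R \<pi> p v (x t) N" for t
  proof unfold_locales
    fix i j
    show "x t i j \<in> R" by (simp add: x_def aR)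
    have "red (x t i j) = red (x t i 0)"
      using b_mult[of t j] by (simp add: x_def a_def b_def redrep_def fun_eq_iff)
    then show "x t i j - x t i 0 \<in> pw 1" using red_eq_iff aR by (simp add: x_def)
  qed
  define G where "G t = coordinate_sequences.gen R \<pi> (x t) N" for t
  have G_step: "G (Suc t) \<subseteq> G t" for t
  proof -
    interpret C: coordinate_sequences R \<pi> p v "x t" N by (rule coords)
    obtain \<psi> i1 where "represents \<psi> i1 (redrep (Pt t))" using local_representative[OF PtX] by blast
    note \<psi> = representsD[OF this]
    have bt: "redrep (Pt (t + m * j)) = redrep (Pt t)" for j using b_mult[of t j] by (simp add: b_def)
    have xa: "(\<lambda>i. x t i j) = rep (Pt (t + m * j))" for j by (simp add: x_def a_def)
    have "x (Suc t) i \<in> C.gen" if i: "i \<le> N" for i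
    proof -
      have "x (Suc t) i = (\<lambda>j. mpeval id (\<lambda>i. x t i j) (\<psi> i) * inverse (mpeval id (\<lambda>i. x t i j) (\<psi> i1)))"
        unfolding xa using \<psi>(5)[OF PtX bt i] by (simp add: fun_eq_iff x_def a_def Pt_Suc divide_inverse)
      also have "\<dots> \<in> C.gen"
        using \<psi>(4)[OF PtX bt, of 0] xa[of 0]
        by (intro C.gen_mult C.gen_inverse C.mpeval_gen \<psi>(1,2) i) auto
      finally show ?thesis .
    qed
    from C.gen_subset[OF coords this] show ?thesis unfolding G_def .
  qed
  have G_0: "G t \<subseteq> G 0" for t by (induction t) (use G_step in blast)+
  interpret C: coordinate_sequences R \<pi> p v "x 0" N by (rule coords)
  have shift: "(\<lambda>j. u (Suc j)) \<in> C.gen" if u: "u \<in> C.gen" for u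
  proof -
    interpret D: coordinate_sequences R \<pi> p v "x m" N by (rule coords)
    have "(\<lambda>j. u (Suc j)) \<in> D.gen" using u
    proof (induction rule: C.gen.induct)
      case (gen_coord i)
      have "(\<lambda>j. x 0 i (Suc j)) = x m i" by (rule ext) (simp add: x_def)
      then show ?case using D.gen_coord[OF gen_coord] by simp
    next
      case (gen_inverse u)
      have "u (Suc 0) \<notin> pw 1" using C.notin_pw1_cong C.gen_cong gen_inverse by blast
      then show ?case using D.gen_inverse[OF gen_inverse.IH] by simp
    qed (auto intro: D.gen_const D.gen_add D.gen_mult)
    then show ?thesis using G_0[of m] by (auto simp: G_def)
  qed
  interpret S: shifted_coordinates_residue R \<pi> p v "x 0" N n' red
  proof unfold_locales
    fix i j
    have "0 + m * (j + n') = m * j + n" using n' by (simp add: algebra_simps)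
    then show "x 0 i (j + n') = x 0 i j" unfolding x_def a_def by (simp add: Pt_n)
  qed (auto intro: shift n'1)
  have sep: "\<exists>i\<le>N. x 0 i q \<noteq> x 0 i 0" if q: "\<not> n' dvd q" for q
  proof (rule ccontr)
    assume "\<not> ?thesis"
    then have eq: "a (m * q) i = a 0 i" if "i \<le> N" for i using that by (simp add: x_def)
    have "a (m * q) = a 0"
    proof
      fix i show "a (m * q) i = a 0 i"
        using eq rep_outside[OF PtX] by (cases "i \<le> N") (auto simp: a_def)
    qed
    then have "Pt (m * q) = Pt 0" using rep_class[OF PtX] by (metis a_def)
    then have "n dvd m * q" using Pt_eq by (simp add: Pt_def)
    then show False using q n' m1 by auto
  qed
  obtain e where e: "n' \<le> card (GL_mat h :: 'k mat set) * p ^ e"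
    "e = 0 \<or> (p \<noteq> 2 \<and> 2 ^ (e - 1) \<le> v) \<or> (p = 2 \<and> fib e \<le> v)"
    by (rule S.period_le[OF fin m sep])
  have "n \<le> card ?Z * (card (GL_mat h :: 'k mat set) * p ^ e)"
    unfolding n' using \<open>m \<le> card ?Z\<close> e(1) by (rule mult_le_mono)
  then show thesis using that[of e] e(2) by (simp add: mult.assoc)
qed

end

section \<open>The bound for the period\<close>

text \<open>By Binet's formula \<open>\<phi>\<^sup>k - \<phi>\<^sup>-\<^sup>k \<le> \<surd>5 F\<^sub>k\<close>, and solving the quadratic inequality for \<open>\<phi>\<^sup>k\<close> gives the
  stated logarithm, here with \<open>k = e - 1\<close>.\<close>
lemma log_fib_bound:
  fixes v e :: nat
  assumes "fib e \<le> v"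
  shows "real e \<le> 1 + log ((1 + sqrt 5) / 2) ((sqrt 5 * real v + sqrt (5 * (real v)\<^sup>2 + 4)) / 2)"
proof -
  define \<phi> :: real where "\<phi> = (1 + sqrt 5) / 2"
  define k where "k = e - 1"
  define y where "y = \<phi> ^ k"
  define s where "s = sqrt 5 * real v"
  have \<phi>: "\<phi> > 1" by (simp add: \<phi>_def)
  have y: "y \<ge> 1" using \<phi> by (simp add: y_def)
  have "(1 - sqrt 5) / 2 * \<phi> = - 1" by (simp add: \<phi>_def algebra_simps)
  then have "(1 - sqrt 5) / 2 = - (1 / \<phi>)" using \<phi> by (simp add: field_simps)
  then have "\<bar>((1 - sqrt 5) / 2) ^ k\<bar> = 1 / y"
    using \<phi> by (simp add: y_def power_abs power_one_over abs_minus_cancel)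
  then have conj: "((1 - sqrt 5) / 2) ^ k \<le> 1 / y" by linarith
  have "fib k \<le> fib e" by (rule fib_mono) (simp add: k_def)
  then have "real (fib k) \<le> real v" using assms by simp
  moreover have "real (fib k) = (\<phi> ^ k - ((1 - sqrt 5) / 2) ^ k) / sqrt 5"
    using fib_closed_form[of k] by (simp add: \<phi>_def Let_def)
  ultimately have "\<phi> ^ k - ((1 - sqrt 5) / 2) ^ k \<le> s"
    by (simp add: s_def field_simps)
  then have "y - 1 / y \<le> s" using conj by (simp add: y_def)
  then have "y * (y - 1 / y) \<le> y * s" using y by (intro mult_left_mono) auto
  then have "y\<^sup>2 - s * y \<le> 1" using y by (simp add: power2_eq_square algebra_simps)
  then have "(2 * y - s)\<^sup>2 \<le> s\<^sup>2 + 4" by (simp add: power2_eq_square algebra_simps)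
  then have "2 * y - s \<le> sqrt (s\<^sup>2 + 4)" by (rule real_le_rsqrt)
  then have yb: "y \<le> (s + sqrt (s\<^sup>2 + 4)) / 2" by simp
  have "real k = log \<phi> y" using \<phi> by (simp add: y_def log_nat_power)
  also have "\<dots> \<le> log \<phi> ((s + sqrt (s\<^sup>2 + 4)) / 2)" using \<phi> y yb by simp
  finally have "real e \<le> 1 + log \<phi> ((s + sqrt (s\<^sup>2 + 4)) / 2)" by (simp add: k_def)
  then show ?thesis by (simp add: \<phi>_def s_def power_mult_distrib)
qed

theorem theorem3p7:
  fixes I :: "'a::field_char_0 mpoly set" and f :: "nat \<Rightarrow> 'a mpoly"
    and \<pp> :: "'a set" and red :: "'a \<Rightarrow> 'k::field"
    and P :: "(nat \<Rightarrow> 'a) set"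
    and N D d p n M :: nat
  assumes "number_field TYPE('a)"
    and "proj_variety N I" and "has_degree N I D"
    and "self_morphism UNIV N I f"
    and "d \<ge> 2"
    and "bundle_iso N I (bundle_pullback N I f (hyperplane_bundle N I))
                        (bundle_power N I (hyperplane_bundle N I) d)"
    and "is_prime_of \<pp>" and "prime p" and "of_nat p \<in> \<pp>"
    and "residue_field_map \<pp> red"
    and "good_reduction N I f \<pp>"
    and "P \<in> zero_points id N I"
    and "primitive_period (morphism_apply N I f) P n"
    and "M = ((N + D) choose N) - 1"
  shows "\<exists>e::nat.
           real e \<le> (if p \<noteq> 2 then 1 + log 2 (real (prime_valuation \<pp> (of_nat p)))
                     else 1 + log ((1 + sqrt 5) / 2)
                       ((sqrt 5 * real (prime_valuation \<pp> 2) +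
                         sqrt (5 * (real (prime_valuation \<pp> 2))\<^sup>2 + 4)) / 2)) \<and>
           n \<le> card (zero_points red N (closure_ideal (local_ring \<pp>) N I)) *
                card (GL_mat (M + 1) :: 'k mat set) * p ^ e \<and>
           card (zero_points red N (closure_ideal (local_ring \<pp>) N I)) *
                card (GL_mat (M + 1) :: 'k mat set) * p ^ e
             \<le> card (proj_space N :: (nat \<Rightarrow> 'k) set set) *
                card (GL_mat (M + 1) :: 'k mat set) * p ^ e"
proof -
  interpret F: number_field_prime_residue \<pp> p red
    using assms by unfold_locales
  define v where "v = prime_valuation \<pp> (of_nat p)"
  obtain \<pi> where "residue_map (local_ring \<pp>) \<pi> p v red"
    using F.local_ring_uniformized unfolding v_def by metis
  then interpret A: residue_map "local_ring \<pp>" \<pi> p v red .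
  obtain \<psi> where \<psi>: "self_morphism (local_ring \<pp>) N (closure_ideal (local_ring \<pp>) N I) \<psi>"
    "same_rational_map N I f \<psi>"
    using assms(11) unfolding good_reduction_def by blast
  interpret B: good_reduction_map N I f "local_ring \<pp>" \<pi> p v red \<psi>
  proof unfold_locales
    fix x assume "x \<notin> local_ring \<pp>"
    then show "inverse x \<in> local_ring \<pp>" using F.valuation_ring[of x] by blast
  qed (use assms \<psi> in auto)
  have "N < M + 1" using N_less_choose[OF degree_pos[OF assms(2,3)]] assms(14) by simp
  then obtain e where n: "n \<le> card (zero_points red N (closure_ideal (local_ring \<pp>) N I)) *
      card (GL_mat (M + 1) :: 'k mat set) * p ^ e"
    and e: "e = 0 \<or> (p \<noteq> 2 \<and> 2 ^ (e - 1) \<le> v) \<or> (p = 2 \<and> fib e \<le> v)"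
    using B.periodic_point_bound[OF assms(12,13) F.finite_residue_field] by metis
  have v1: "v \<ge> 1" by (rule A.v_pos)
  have "real e \<le> (if p \<noteq> 2 then 1 + log 2 (real v)
      else 1 + log ((1 + sqrt 5) / 2) ((sqrt 5 * real v + sqrt (5 * (real v)\<^sup>2 + 4)) / 2))"
  proof (cases "p = 2")
    case True
    then have "fib e \<le> v" using e by auto
    then show ?thesis using log_fib_bound True by simp
  next
    case False
    then have "2 ^ (e - 1) \<le> v" using e v1 by auto
    then have "real (e - 1) \<le> log 2 (real v)" by (rule le_log2_of_power)
    then show ?thesis using False by simp
  qed
  moreover have "card (zero_points red N (closure_ideal (local_ring \<pp>) N I)) \<le>
      card (proj_space N :: (nat \<Rightarrow> 'k) set set)"
    by (rule card_mono[OF finite_proj_space[OF F.finite_residue_field]]) (auto simp: zero_points_def)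
  ultimately show ?thesis using n
    by (intro exI[of _ e] conjI) (auto simp: v_def intro!: mult_le_mono)
qed

end
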